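(* Let $\kappa\ge 1$, let $A \in \mathbb{H}(\mathbb{C}^{\kappa\times\kappa})^{\tilde g}$ be a tuple of Hermitian matrices, and let $$C_A=\bigcup_{m\ge 1}\{U^*(I_m\otimes A)U : U \text{ a unitary matrix of size } \kappa m\}$$ be the nc smallest $A$-set. Let $F$ be a Hermitian matrix-valued nc function in the noncommuting tuples of variables $a=(a_1,\dots,a_{\tilde g})$ and $x=(x_1,\dots,x_g)$ which is both matrix convex in $x$ at $(C_A,0)$ and $x$-real entire at $(C_A,0)$. Let $F(a,x)=\sum_i F_i(a,x)$ be its $x$-power series. Then for every $m\ge 1$, every $\alpha\in C_A$ of size $\kappa m\times\kappa m$, and every $X\in\mathbb{H}(\mathbb{C}^{\kappa m\times\kappa m})^g$, $$F(\alpha,X)=F_0(\alpha,X)+F_1(\alpha,X)+F_2(\alpha,X),$$ where each $F_i$ is a matrix-valued nc polynomial of degree $i$ in $x$ (i.e. homogeneous of degree $i$ in $x$, possibly zero).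
   Context: **NC polynomials.** For noncommuting variables $z=(z_1,\dots,z_r)$, $\mathbb{C}\langle z\rangle$ denotes the ring of noncommutative (nc) polynomials, i.e. finite linear combinations $p=\sum_w p_w z^w$ of words. The involution $*$ on $\mathbb{C}\langle z\rangle$ is determined by $z_i^*=z_i$, $(pq)^*=q^*p^*$, $(\lambda p)^*=\overline{\lambda}p^*$. A matrix-valued nc polynomial is a matrix $P=(p_{ij})$ with entries in $\mathbb{C}\langle z\rangle$; it is Hermitian if $P^*=P$, where $(P^* )_{ij}=p_{ji}^*$. Polynomials are evaluated at tuples $Z$ of $n\times n$ Hermitian matrices by substituting $Z_i$ for $z_i$ (the constant $1$ becomes $I_n$), and matrix-valued polynomials are evaluated entrywise, giving block matrices. **NC sets and functions.** $\mathbb{H}(\mathbb{C}^{n\times n})^r$ is the set of $r$-tuples of $n\times n$ Hermitian matrices, and $\mathbb{H}(\mathbb{C})^r=\bigcup_{n\ge1}\mathbb{H}(\mathbb{C}^{n\times n})^r$. An nc set is a subset $D\subset\mathbb{H}(\mathbb{C})^r$ closed under direct sums ($Z,\tilde Z\in D\Rightarrow Z\oplus\tilde Z\in D$, taken coordinatewise) and under unitary equivalence ($Z\in D$ of size $n$, $U$ an $n\times n$ unitary $\Rightarrow U^*ZU=(U^*Z_1U,\dots,U^*Z_rU)\in D$). An nc function $f$ on $D$ assigns to each $Z\in D$ of size $n$ an $n\times n$ complex matrix $f(Z)$, with $f(Z\oplus\tilde Z)=f(Z)\oplus f(\tilde Z)$ and $f(U^*ZU)=U^*f(Z)U$. A matrix-valued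 nc function is a matrix $F=(F_{ij})$ of nc functions. For functions of two tuples $(a,x)$ take $z=(a,x)$, $r=\tilde g+g$; in a pair $(A,X)$ all matrices have the same size. The norm of a tuple $X\in\mathbb{H}(\mathbb{C}^{n\times n})^g$ is $\|X\|=$ the maximum eigenvalue of $(\sum_i X_iX_i^* )^{1/2}$. **$x$-power series, Hermitian.** An $x$-power series is a formal sum $\sum_{i\ge0}F_i(a,x)$ where each $F_i$ is a matrix-valued nc polynomial in $(a,x)$ homogeneous of degree $i$ in $x$. A matrix-valued nc function $F$ with such a power series is Hermitian if each $F_i$ is a Hermitian matrix-valued polynomial. **$x$-real entire at $(C_A,0)$.** An nc function $F$ is $x$-real entire at $(C_A,0)$ if: (1) there are $\varepsilon>0$ and an $x$-power series $\sum_iF_i(a,x)$ such that for each $m$ and each $\alpha=U^*(I_m\otimes A)U\in C_A$ the series $F(\alpha,X)=\sum_iF_i(\alpha,X)$ converges for all $X\in\mathbb{H}(\mathbb{C}^{\kappa m\times\kappa m})^g$ with $\|X\|<\varepsilon$; and (2) for each such $\alpha$ the analytic function $X\mapsto F(\alpha,X)$ on this ball continues analytically, as a function of $g(\kappa m)^2$ complex variables, to an open subset of $(\mathbb{C}^{\kappa m\times\kappa m})^g$ containing $\mathbb{H}(\mathbb{C}^{\kappa m\times\kappa m})^g$. For Hermitian $X$ outside the ball, $F(\alpha,X)$ denotes the value of this continuation. A matrix-valued nc function is $x$-real entire at $(C_A,0)$ if each entry is; its $x$-power series is then formed entrywise. **Matrix convex in $x$ at $(C_A,0)$.** $F$ is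 matrix convex in $x$ at $(C_A,0)$ if $F$ is Hermitian and there is a uniform $\varepsilon>0$ such that for every $m$, every $\alpha\in C_A$ of size $\kappa m$, all $X,Y\in\mathbb{H}(\mathbb{C}^{\kappa m\times\kappa m})^g$ with $\|X\|,\|Y\|<\varepsilon$, and all $t\in[0,1]$, $$F(\alpha,tX+(1-t)Y)\preceq tF(\alpha,X)+(1-t)F(\alpha,Y),$$ where $\preceq$ is the Loewner (positive semidefinite) order. *)

theory Defs
  imports
    "HOL-Library.Poly_Mapping"
    "Jordan_Normal_Form.Char_Poly"
    "Jordan_Normal_Form.Schur_Decomposition"
begin

section \<open>Tuples of square matrices\<close>

type_synonym mtuple = "complex mat list"

definition tuples :: "nat \<Rightarrow> nat \<Rightarrow> mtuple set" where
  "tuples g n = {X. length X = g \<and> (\<forall>M \<in> set X. M \<in> carrier_mat n n)}"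

definition herm_tuples :: "nat \<Rightarrow> nat \<Rightarrow> mtuple set" where
  "herm_tuples g n = {X \<in> tuples g n. \<forall>M \<in> set X. mat_adjoint M = M}"

definition unitary_mat :: "nat \<Rightarrow> complex mat \<Rightarrow> bool" where
  "unitary_mat n U \<longleftrightarrow>
     U \<in> carrier_mat n n \<and> mat_adjoint U * U = 1\<^sub>m n \<and> U * mat_adjoint U = 1\<^sub>m n"

definition dsum_mat :: "complex mat \<Rightarrow> complex mat \<Rightarrow> complex mat" where
  "dsum_mat M N = diag_block_mat [M, N]"

definition dsum_tuple :: "mtuple \<Rightarrow> mtuple \<Rightarrow> mtuple" where
  "dsum_tuple X Y = map2 dsum_mat X Y"

definition conj_mat :: "complex mat \<Rightarrow> complex mat \<Rightarrow> complex mat" where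
  "conj_mat U M = mat_adjoint U * M * U"

definition conj_tuple :: "complex mat \<Rightarrow> mtuple \<Rightarrow> mtuple" where
  "conj_tuple U X = map (conj_mat U) X"

definition kron :: "complex mat \<Rightarrow> complex mat \<Rightarrow> complex mat" where
  "kron M N = mat (dim_row M * dim_row N) (dim_col M * dim_col N)
     (\<lambda>(i, j). M $$ (i div dim_row N, j div dim_col N) * N $$ (i mod dim_row N, j mod dim_col N))"

definition psd :: "nat \<Rightarrow> complex mat \<Rightarrow> bool" where
  "psd n M \<longleftrightarrow> M \<in> carrier_mat n n \<and> mat_adjoint M = M \<and>
     (\<forall>v \<in> carrier_vec n. 0 \<le> Re ((M *\<^sub>v v) \<bullet>c v))"

definition loewner_le :: "nat \<Rightarrow> complex mat \<Rightarrow> complex mat \<Rightarrow> bool" where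
  "loewner_le n M N \<longleftrightarrow> psd n (N - M)"

text \<open>A positive semidefinite matrix has exactly one positive semidefinite square root,
  so the choice below is determined on such matrices.\<close>

definition psd_sqrt :: "nat \<Rightarrow> complex mat \<Rightarrow> complex mat" where
  "psd_sqrt n M = (SOME B. psd n B \<and> B * B = M)"

text \<open>The eigenvalues of a positive semidefinite matrix are real, so nothing is lost
  by taking the maximum over the real ones.\<close>

definition tuple_norm :: "nat \<Rightarrow> mtuple \<Rightarrow> real" where
  "tuple_norm n X =
     Max {r :: real. eigenvalue
            (psd_sqrt n (foldr (\<lambda>M S. M * mat_adjoint M + S) X (0\<^sub>m n n))) (complex_of_real r)}"

definition herm_ball :: "nat \<Rightarrow> nat \<Rightarrow> real \<Rightarrow> mtuple set" where
  "herm_ball g n \<epsilon> = {X \<in> herm_tuples g n. tuple_norm n X < \<epsilon>}"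

definition convex_comb :: "real \<Rightarrow> mtuple \<Rightarrow> mtuple \<Rightarrow> mtuple" where
  "convex_comb t X Y =
     map2 (\<lambda>M N. complex_of_real t \<cdot>\<^sub>m M + complex_of_real (1 - t) \<cdot>\<^sub>m N) X Y"

text \<open>The part of the nc set C_A at size \<open>\<kappa> * m\<close>, for a tuple \<open>A\<close> of size \<open>\<kappa>\<close>.\<close>

definition C_set :: "nat \<Rightarrow> mtuple \<Rightarrow> nat \<Rightarrow> mtuple set" where
  "C_set \<kappa> A m = {conj_tuple U (map (kron (1\<^sub>m m)) A) | U. unitary_mat (\<kappa> * m) U}"

section \<open>Noncommutative polynomials\<close>

text \<open>A letter \<open>Inl i\<close> stands for the variable \<open>a\<^sub>i\<close> and \<open>Inr i\<close> for \<open>x\<^sub>i\<close>, counting from 0;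
  a polynomial is the finitely supported family of its coefficients, indexed by words.\<close>

type_synonym nc_word = "(nat + nat) list"
type_synonym nc_poly = "nc_word \<Rightarrow>\<^sub>0 complex"

definition nc_poly_vars :: "nat \<Rightarrow> nat \<Rightarrow> nc_poly \<Rightarrow> bool" where
  "nc_poly_vars gt g p \<longleftrightarrow>
     (\<forall>w \<in> Poly_Mapping.keys p. set w \<subseteq> Inl ` {..<gt} \<union> Inr ` {..<g})"

definition x_homogeneous :: "nat \<Rightarrow> nc_poly \<Rightarrow> bool" where
  "x_homogeneous k p \<longleftrightarrow> (\<forall>w \<in> Poly_Mapping.keys p. length (filter (\<lambda>v. \<not> isl v) w) = k)"

text \<open>The letters are selfadjoint, so the involution reverses words and conjugates
  coefficients; see the lemma for the coefficientwise form.\<close>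

definition nc_star :: "nc_poly \<Rightarrow> nc_poly" where
  "nc_star p = Poly_Mapping.map_key rev (Poly_Mapping.map cnj p)"

lemma lookup_nc_star:
  "Poly_Mapping.lookup (nc_star p) w = cnj (Poly_Mapping.lookup p (rev w))"
  by (simp add: nc_star_def map_key.rep_eq Poly_Mapping.map.rep_eq when_def)

definition nc_mat_star :: "nc_poly mat \<Rightarrow> nc_poly mat" where
  "nc_mat_star P = mat (dim_col P) (dim_row P) (\<lambda>(i, j). nc_star (P $$ (j, i)))"

definition nc_word_eval :: "nat \<Rightarrow> mtuple \<Rightarrow> mtuple \<Rightarrow> nc_word \<Rightarrow> complex mat" where
  "nc_word_eval n a x w =
     foldr (\<lambda>v M. (case v of Inl i \<Rightarrow> a ! i | Inr i \<Rightarrow> x ! i) * M) w (1\<^sub>m n)"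

definition nc_poly_eval :: "nat \<Rightarrow> mtuple \<Rightarrow> mtuple \<Rightarrow> nc_poly \<Rightarrow> complex mat" where
  "nc_poly_eval n a x p =
     mat n n (\<lambda>(r, c). \<Sum>w \<in> Poly_Mapping.keys p.
                 Poly_Mapping.lookup p w * nc_word_eval n a x w $$ (r, c))"

definition block_mat :: "nat \<Rightarrow> complex mat mat \<Rightarrow> complex mat" where
  "block_mat n M = mat (dim_row M * n) (dim_col M * n)
     (\<lambda>(r, c). M $$ (r div n, c div n) $$ (r mod n, c mod n))"

definition nc_mat_eval :: "nat \<Rightarrow> mtuple \<Rightarrow> mtuple \<Rightarrow> nc_poly mat \<Rightarrow> complex mat" where
  "nc_mat_eval n a x P = block_mat n (map_mat (nc_poly_eval n a x) P)"

section \<open>Noncommutative sets and functions of pairs of tuples\<close>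

text \<open>\<open>D n\<close> is the set of the pairs of size \<open>n\<close> in the nc set, and \<open>f n a x\<close> is the value of
  an nc function at a pair of size \<open>n\<close>. The size is kept explicit because a tuple may be empty.\<close>

type_synonym nc_dom = "nat \<Rightarrow> (mtuple \<times> mtuple) set"
type_synonym nc_fun = "nat \<Rightarrow> mtuple \<Rightarrow> mtuple \<Rightarrow> complex mat"

definition nc_set :: "nat \<Rightarrow> nat \<Rightarrow> nc_dom \<Rightarrow> bool" where
  "nc_set gt g D \<longleftrightarrow>
     (\<forall>n. D n \<subseteq> herm_tuples gt n \<times> herm_tuples g n) \<and> D 0 = {} \<and>
     (\<forall>n k a x b y. (a, x) \<in> D n \<longrightarrow> (b, y) \<in> D k \<longrightarrow>
        (dsum_tuple a b, dsum_tuple x y) \<in> D (n + k)) \<and>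
     (\<forall>n a x U. (a, x) \<in> D n \<longrightarrow> unitary_mat n U \<longrightarrow> (conj_tuple U a, conj_tuple U x) \<in> D n)"

definition nc_function :: "nc_dom \<Rightarrow> nc_fun \<Rightarrow> bool" where
  "nc_function D f \<longleftrightarrow>
     (\<forall>n a x. (a, x) \<in> D n \<longrightarrow> f n a x \<in> carrier_mat n n) \<and>
     (\<forall>n k a x b y. (a, x) \<in> D n \<longrightarrow> (b, y) \<in> D k \<longrightarrow>
        f (n + k) (dsum_tuple a b) (dsum_tuple x y) = dsum_mat (f n a x) (f k b y)) \<and>
     (\<forall>n a x U. (a, x) \<in> D n \<longrightarrow> unitary_mat n U \<longrightarrow>
        f n (conj_tuple U a) (conj_tuple U x) = conj_mat U (f n a x))"

definition nc_mat_function :: "nat \<Rightarrow> nc_dom \<Rightarrow> nc_fun mat \<Rightarrow> bool" where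
  "nc_mat_function d D F \<longleftrightarrow>
     F \<in> carrier_mat d d \<and> (\<forall>i<d. \<forall>j<d. nc_function D (F $$ (i, j)))"

definition nc_fun_eval :: "nat \<Rightarrow> mtuple \<Rightarrow> mtuple \<Rightarrow> nc_fun mat \<Rightarrow> complex mat" where
  "nc_fun_eval n a x F = block_mat n (map_mat (\<lambda>f. f n a x) F)"

section \<open>Analytic functions of the \<open>g * n\<^sup>2\<close> entries of a tuple\<close>

definition tuple_dist :: "nat \<Rightarrow> nat \<Rightarrow> mtuple \<Rightarrow> mtuple \<Rightarrow> real" where
  "tuple_dist g n X Y =
     (\<Sum>k<g. \<Sum>i<n. \<Sum>j<n. cmod ((Y ! k) $$ (i, j) - (X ! k) $$ (i, j)))"

definition open_tuples :: "nat \<Rightarrow> nat \<Rightarrow> mtuple set \<Rightarrow> bool" where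
  "open_tuples g n \<Omega> \<longleftrightarrow> \<Omega> \<subseteq> tuples g n \<and>
     (\<forall>X \<in> \<Omega>. \<exists>\<delta>>0. \<forall>Y \<in> tuples g n. tuple_dist g n X Y < \<delta> \<longrightarrow> Y \<in> \<Omega>)"

text \<open>On an open set, analytic means complex differentiable at every point, as for
  \<open>analytic_on\<close> in one variable; \<open>c\<close> collects the partial derivatives at \<open>X\<close>.\<close>

definition analytic_tuples :: "nat \<Rightarrow> nat \<Rightarrow> mtuple set \<Rightarrow> (mtuple \<Rightarrow> complex) \<Rightarrow> bool" where
  "analytic_tuples g n \<Omega> h \<longleftrightarrow>
     (\<forall>X \<in> \<Omega>. \<exists>c :: nat \<Rightarrow> nat \<Rightarrow> nat \<Rightarrow> complex. \<forall>e>0. \<exists>\<delta>>0. \<forall>Y \<in> \<Omega>.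
        tuple_dist g n X Y < \<delta> \<longrightarrow>
        cmod (h Y - h X - (\<Sum>k<g. \<Sum>i<n. \<Sum>j<n. c k i j * ((Y ! k) $$ (i, j) - (X ! k) $$ (i, j))))
          \<le> e * tuple_dist g n X Y)"

text \<open>\<open>G\<close> on \<open>\<Omega>\<close> continues the restriction of \<open>f(\<alpha>, \<cdot>)\<close> to the Hermitian tuples of norm
  less than \<open>\<epsilon>\<close>.\<close>

definition continues ::
    "nat \<Rightarrow> nat \<Rightarrow> real \<Rightarrow> nc_fun \<Rightarrow> mtuple \<Rightarrow> mtuple set \<Rightarrow> (mtuple \<Rightarrow> complex mat) \<Rightarrow> bool" where
  "continues g n \<epsilon> f \<alpha> \<Omega> G \<longleftrightarrow>
     open_tuples g n \<Omega> \<and> herm_tuples g n \<subseteq> \<Omega> \<and>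
     (\<forall>X \<in> \<Omega>. G X \<in> carrier_mat n n) \<and>
     (\<forall>r<n. \<forall>c<n. analytic_tuples g n \<Omega> (\<lambda>X. G X $$ (r, c))) \<and>
     (\<forall>X \<in> herm_ball g n \<epsilon>. G X = f n \<alpha> X)"

text \<open>The value at Hermitian \<open>X\<close> of a continuation of \<open>f(\<alpha>, \<cdot>)\<close>. By the identity theorem along
  real lines through 0, this value depends neither on \<open>\<epsilon>\<close> nor on the continuation, and it
  is \<open>f(\<alpha>, X)\<close> for \<open>X\<close> in the ball.\<close>

definition x_extension :: "nat \<Rightarrow> nc_fun \<Rightarrow> nc_fun" where
  "x_extension g f n \<alpha> X =
     (THE V. \<exists>\<epsilon>>0. \<exists>\<Omega> G. continues g n \<epsilon> f \<alpha> \<Omega> G \<and> V = G X)"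

section \<open>Power series in x, real entire and matrix convex functions\<close>

definition x_series :: "nat \<Rightarrow> nat \<Rightarrow> (nat \<Rightarrow> nc_poly) \<Rightarrow> bool" where
  "x_series gt g p \<longleftrightarrow> (\<forall>k. nc_poly_vars gt g (p k) \<and> x_homogeneous k (p k))"

definition mat_sums :: "nat \<Rightarrow> (nat \<Rightarrow> complex mat) \<Rightarrow> complex mat \<Rightarrow> bool" where
  "mat_sums n S M \<longleftrightarrow> (\<forall>r<n. \<forall>c<n. (\<lambda>k. S k $$ (r, c)) sums (M $$ (r, c)))"

text \<open>The power series is an argument because it need not be unique: it is
  evaluated only at \<open>\<alpha>\<close> in C_A.\<close>

definition x_real_entire ::
    "nat \<Rightarrow> nat \<Rightarrow> nat \<Rightarrow> mtuple \<Rightarrow> nc_dom \<Rightarrow> nc_fun \<Rightarrow> (nat \<Rightarrow> nc_poly) \<Rightarrow> bool" where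
  "x_real_entire gt g \<kappa> A D f p \<longleftrightarrow> x_series gt g p \<and>
     (\<exists>\<epsilon>>0. \<forall>m\<ge>1. \<forall>\<alpha> \<in> C_set \<kappa> A m.
        (\<forall>X \<in> herm_ball g (\<kappa> * m) \<epsilon>. (\<alpha>, X) \<in> D (\<kappa> * m) \<and>
           mat_sums (\<kappa> * m) (\<lambda>k. nc_poly_eval (\<kappa> * m) \<alpha> X (p k)) (f (\<kappa> * m) \<alpha> X)) \<and>
        (\<exists>\<Omega> G. continues g (\<kappa> * m) \<epsilon> f \<alpha> \<Omega> G))"

definition mat_x_real_entire ::
    "nat \<Rightarrow> nat \<Rightarrow> nat \<Rightarrow> nat \<Rightarrow> mtuple \<Rightarrow> nc_dom \<Rightarrow> nc_fun mat \<Rightarrow> (nat \<Rightarrow> nc_poly mat) \<Rightarrow> bool" where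
  "mat_x_real_entire d gt g \<kappa> A D F P \<longleftrightarrow>
     (\<forall>k. P k \<in> carrier_mat d d) \<and>
     (\<forall>i<d. \<forall>j<d. x_real_entire gt g \<kappa> A D (F $$ (i, j)) (\<lambda>k. P k $$ (i, j)))"

definition hermitian_series :: "(nat \<Rightarrow> nc_poly mat) \<Rightarrow> bool" where
  "hermitian_series P \<longleftrightarrow> (\<forall>k. nc_mat_star (P k) = P k)"

definition matrix_convex_x ::
    "nat \<Rightarrow> nat \<Rightarrow> nat \<Rightarrow> mtuple \<Rightarrow> nc_dom \<Rightarrow> nc_fun mat \<Rightarrow> (nat \<Rightarrow> nc_poly mat) \<Rightarrow> bool" where
  "matrix_convex_x d g \<kappa> A D F P \<longleftrightarrow> hermitian_series P \<and>
     (\<exists>\<epsilon>>0. \<forall>m\<ge>1. \<forall>\<alpha> \<in> C_set \<kappa> A m.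
        (\<forall>X \<in> herm_ball g (\<kappa> * m) \<epsilon>. (\<alpha>, X) \<in> D (\<kappa> * m)) \<and>
        (\<forall>X \<in> herm_ball g (\<kappa> * m) \<epsilon>. \<forall>Y \<in> herm_ball g (\<kappa> * m) \<epsilon>. \<forall>t \<in> {0..1}.
           loewner_le (d * (\<kappa> * m))
             (nc_fun_eval (\<kappa> * m) \<alpha> (convex_comb t X Y) F)
             (complex_of_real t \<cdot>\<^sub>m nc_fun_eval (\<kappa> * m) \<alpha> X F
                + complex_of_real (1 - t) \<cdot>\<^sub>m nc_fun_eval (\<kappa> * m) \<alpha> Y F)))"

end

theory Submission
  imports "HOL-Complex_Analysis.Complex_Analysis" "Jordan_Normal_Form.Spectral_Radius" Defs
begin

text \<open>Fix \<alpha> in C_A, a Hermitian tuple X and a vector v, and let q k be the value at v of the quadratic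
  form of the k-th coefficient at (\<alpha>, X). Evaluating F at the amplified pair (1 \<otimes> \<alpha>, T \<otimes> X) for a
  Hermitian matrix T of any size shows that the one-variable series with coefficients q is matrix
  convex near 0. Convexity along the segment between two weighted adjacency matrices of a path, which
  differ in the sign of the edge at an end point, forces the Hankel matrix (q (i + j)) with i, j \<ge> 1
  to be positive semidefinite. The even coefficients q (2 j) are therefore nonnegative and log-convex,
  so q 4 > 0 would give a finite radius of convergence. By Pringsheim's theorem the continuation to
  the real line would then have a singularity there. Hence q 4 = 0 (or already q 2 = 0), and by
  Cauchy-Schwarz q k = 0 for all k \<ge> 3. The identity theorem on the real line gives the value of
  every continuation.\<close>

text \<open>Why a path: take s times the adjacency matrix of a path on the vertices 0, ..., n, with
  weight c on the edge between 0 and 1. The matrices for c = 1 and c = -1 are conjugate by a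
  diagonal sign matrix, and their midpoint, c = 0, isolates the vertex 0. For i, j \<ge> 1 the (i,
  j) entry of the convexity defect of the k-th power is therefore s^k times the number of walks of
  length k from i to j through 0. The shortest such walk has length i + j and is unique. Testing on
  the vector with entries \<nu> i / s^i and letting s tend to 0 isolates q (i + j). Since i, j \<ge>
  1, the numbers q 0 and q 1 never enter, as it must be: convexity does not see affine terms. Hankel
  positivity alone does not bound the degree: t^2 / (1 - t) has q k = 1 for all k \<ge> 2. What
  excludes it is its pole on the real axis. The continuation is known only near Hermitian tuples, so
  on a line only near the real axis; a singularity somewhere on the circle of convergence would be
  no contradiction, and it has to be located at the positive real point. This is why nonnegative
  coefficients are needed.\<close>

no_notation vec_nth (infixl "$" 90)
no_notation fps_nth (infixl "$" 75)

section \<open>Real entire power series\<close>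

text \<open>Termwise differentiation keeps the coefficients nonnegative, so the induction runs over
  all \<open>F\<close> and \<open>b\<close> at once. It serves to re-expand a series about a
  positive point closer to its presumed singularity.\<close>

lemma higher_deriv_nonneg:
  fixes b :: "nat \<Rightarrow> real" and F :: "complex \<Rightarrow> complex"
  assumes "\<And>n. b n \<ge> 0"
    and "\<And>z. norm z < r \<Longrightarrow> (\<lambda>n. of_real (b n) * z ^ n) sums F z"
    and "0 \<le> x" "x < r"
  shows "(deriv ^^ m) F (of_real x) \<in> \<real> \<and> Re ((deriv ^^ m) F (of_real x)) \<ge> 0"
  using assms(1,2)
proof (induction m arbitrary: F b)
  case 0
  have s: "(\<lambda>n. of_real (b n * x ^ n)) sums F (of_real x)"
    using 0(2)[of "of_real x"] assms(3,4) by simp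
  have "(\<lambda>n. b n * x ^ n) sums Re (F (of_real x))" "(\<lambda>n. 0) sums Im (F (of_real x))"
    using sums_Re[OF s] sums_Im[OF s] by simp_all
  then have "Im (F (of_real x)) = 0" "Re (F (of_real x)) \<ge> 0"
    using 0(1) assms(3) sums_unique2[OF _ sums_zero, of "Im (F (of_real x))"]
      sums_le[OF _ sums_zero, of "\<lambda>n. b n * x ^ n" "Re (F (of_real x))"] by simp_all
  then show ?case by (simp add: complex_is_Real_iff)
next
  case (Suc m)
  have hol: "F holomorphic_on ball 0 r"
    using power_series_holomorphic[of 0 r "\<lambda>n. of_real (b n)" F] Suc.prems(2) by simp
  have d: "(\<lambda>n. of_real (diffs b n) * z ^ n) sums deriv F z" if "norm z < r" for z
  proof -
    have "(F has_field_derivative deriv F z) (at z)"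
      using hol that by (intro holomorphic_derivI[of F "ball 0 r"]) auto
    from termdiffs_sums_strong[OF Suc.prems(2) this that] show ?thesis
      by (simp add: diffs_def)
  qed
  have "diffs b n \<ge> 0" for n
    using Suc.prems(1) by (simp add: diffs_def)
  from Suc.IH[OF this d] show ?case
    by (simp add: funpow_swap1)
qed

text \<open>The function \<open>g\<close> is compared with the series on a real interval only. The
  points of this interval accumulate at 0, which is enough for the identity theorem on the connected
  set \<open>V\<close>.\<close>

lemma holomorphic_sums_extend_real:
  fixes q :: "nat \<Rightarrow> complex"
  assumes S: "open S" "range complex_of_real \<subseteq> S" "g holomorphic_on S"
    and \<rho>: "\<rho> > 0" "\<And>t. \<bar>t\<bar> < \<rho> \<Longrightarrow> (\<lambda>k. q k * of_real t ^ k) sums g (of_real t)"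
    and f: "\<And>z. norm z < r \<Longrightarrow> (\<lambda>k. q k * z ^ k) sums f z" and r: "r > 0"
    and V: "open V" "connected V" "0 \<in> V" "V \<subseteq> S" "V \<subseteq> ball 0 r" and z: "z \<in> V"
  shows "g z = f z"
proof -
  let ?U = "{z \<in> V. g z - f z = 0}"
  have fh: "f holomorphic_on ball 0 r"
    using power_series_holomorphic[of 0 r q f] f by simp
  have lim: "0 islimpt ?U"
    unfolding islimpt_approachable
  proof (intro allI impI)
    fix e :: real assume e: "e > 0"
    obtain d where d: "d > 0" "ball 0 d \<subseteq> V"
      using V(1,3) open_contains_ball by blast
    define t where "t = min (min d e) (min r \<rho>) / 2"
    have t: "t > 0" "t < d" "t < e" "t < r" "t < \<rho>"
      using d e r \<rho> by (auto simp: t_def min_def)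
    have "g (of_real t) = f (of_real t)"
      using sums_unique2[OF \<rho>(2)[of t] f[of "of_real t"]] t by auto
    moreover have "complex_of_real t \<in> V" using d(2) t by auto
    ultimately show "\<exists>x'\<in>?U. x' \<noteq> 0 \<and> dist x' 0 < e"
      using t by (intro bexI[of _ "of_real t"]) auto
  qed
  have "g z - f z = 0"
    using analytic_continuation[of "\<lambda>z. g z - f z" V ?U 0 z] V z lim
      holomorphic_on_subset[OF S(3)] holomorphic_on_subset[OF fh]
    by (auto intro!: holomorphic_intros)
  then show ?thesis by simp
qed

text \<open>If the radius r were finite, the continuation across r would let the Taylor series about
  r/2 converge at some w > r. The Taylor coefficients stay nonnegative after any partial sum of the
  original series is subtracted, so these partial sums are bounded at w and the original series
  converges beyond r. Subtracting partial sums replaces the usual rearrangement of a double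
  series.\<close>

theorem pringsheim_real_line:
  fixes a :: "nat \<Rightarrow> real"
  assumes nonneg: "\<And>n. a n \<ge> 0"
    and S: "open S" "range complex_of_real \<subseteq> S" "g holomorphic_on S"
    and \<rho>: "\<rho> > 0" "\<And>t. \<bar>t\<bar> < \<rho> \<Longrightarrow> (\<lambda>k. complex_of_real (a k) * of_real t ^ k) sums g (of_real t)"
  shows "conv_radius a = \<infinity>"
proof (rule ccontr)
  assume fin: "conv_radius a \<noteq> \<infinity>"
  have cr: "conv_radius (\<lambda>n. complex_of_real (a n)) = conv_radius a"
    unfolding conv_radius_def by simp
  have "ereal (\<rho>/2) \<le> conv_radius (\<lambda>n. complex_of_real (a n))"
    using \<rho>(2)[of "\<rho>/2"] \<rho>(1) conv_radius_geI[of "\<lambda>n. complex_of_real (a n)" "of_real (\<rho>/2)"]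
    by (simp add: sums_iff del: of_real_divide)
  then have pos: "conv_radius a > 0"
    using \<rho>(1) unfolding cr by (auto intro: less_le_trans[rotated])
  obtain r where r: "conv_radius a = ereal r" "r > 0"
    using fin pos by (cases "conv_radius a") auto
  define f where "f z = suminf (\<lambda>n. complex_of_real (a n) * z ^ n)" for z
  have f: "(\<lambda>k. complex_of_real (a k) * z ^ k) sums f z" if "norm z < r" for z
    unfolding f_def using that r(1) cr by (intro summable_sums summable_in_conv_radius) auto
  have fh: "f holomorphic_on ball 0 r"
    using power_series_holomorphic[of 0 r "\<lambda>n. of_real (a n)" f] f by simp
  \<comment> \<open>\<open>S\<close> may become arbitrarily thin along the real line, but around the
    compact segment from 0 to r it contains a tube of fixed width. The tube is convex, hence
    connected after intersection with the disc, as the gluing of \<open>f\<close> and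
    \<open>g\<close> requires.\<close>
  define K where "K = complex_of_real ` {0..r}"
  have "compact K" unfolding K_def
    by (intro compact_continuous_image continuous_intros) auto
  moreover have "K \<subseteq> S" using S(2) by (auto simp: K_def)
  ultimately obtain \<delta> where \<delta>: "\<delta> > 0" "(\<Union>x\<in>K. ball x \<delta>) \<subseteq> S"
    using compact_subset_open_imp_ball_epsilon_subset S(1) by metis
  define V where "V = (\<Union>x\<in>K. ball x \<delta>)"
  have "convex K" unfolding K_def
    by (intro convex_linear_image bounded_linear.linear[OF bounded_linear_of_real]) auto
  then have "convex (\<Union>x\<in>K. \<Union>y\<in>ball 0 \<delta>. {x + y})"
    by (intro convex_sums) auto
  moreover have "(\<Union>x\<in>K. \<Union>y\<in>ball 0 \<delta>. {x + y}) = V"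
  proof -
    have "(\<Union>y\<in>ball 0 \<delta>. {x + y}) = (+) x ` ball 0 \<delta>" for x :: complex
      by (rule UNION_singleton_eq_range)
    then show ?thesis by (simp add: V_def image_add_ball)
  qed
  ultimately have Vc: "convex V" by simp
  have Vo: "open V" unfolding V_def by auto
  have "0 \<in> K" "of_real r \<in> K" unfolding K_def using r(2) by (auto intro: image_eqI[of _ _ 0])
  then have V0: "0 \<in> V" "of_real r \<in> V" unfolding V_def using \<delta>(1) centre_in_ball by blast+
  have VS: "V \<subseteq> S" using \<delta>(2) by (simp add: V_def)
  have agree: "g z = f z" if "z \<in> V \<inter> ball 0 r" for z
    by (rule holomorphic_sums_extend_real[OF S \<rho> f, of r "V \<inter> ball 0 r"])
      (use V0 VS Vo Vc r that in \<open>auto intro: convex_connected convex_Int\<close>)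
  define W where "W = ball 0 r \<union> V"
  define h where "h z = (if z \<in> ball 0 r then f z else g z)" for z
  have hh: "h holomorphic_on W" unfolding h_def W_def
    by (rule holomorphic_on_If_Un[OF fh])
       (use S(3) VS Vo agree in \<open>auto intro: holomorphic_on_subset\<close>)
  \<comment> \<open>The closed disc of radius r/2 about r/2 touches the circle of radius r only at
    r, and there \<open>V\<close> takes over. By compactness a slightly larger concentric disc still
    lies in \<open>W\<close>.\<close>
  define x0 where "x0 = complex_of_real (r/2)"
  have "cball x0 (r/2) \<subseteq> W"
  proof
    fix z assume "z \<in> cball x0 (r/2)"
    then have z: "norm (z - x0) \<le> r/2" by (simp add: dist_norm norm_minus_commute)
    show "z \<in> W"
    proof (cases "norm z < r")
      case False
      \<comment> \<open>The disc condition amounts to |z|^2 \<le> r Re z. Together with |z| \<ge> r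
        it gives Re z \<ge> r, and then z = r.\<close>
      have sq: "(Re z - r/2)\<^sup>2 + (Im z)\<^sup>2 \<le> (r/2)\<^sup>2"
        using power_mono[OF z, of 2] by (simp add: cmod_power2 x0_def)
      have "r\<^sup>2 \<le> (norm z)\<^sup>2" using False r(2) by (intro power_mono) auto
      then have nz: "r\<^sup>2 \<le> (Re z)\<^sup>2 + (Im z)\<^sup>2" by (simp add: cmod_power2)
      have "Re z * r \<ge> r * r"
        using sq nz by (simp add: power2_eq_square algebra_simps)
      then have re: "Re z \<ge> r" using r(2) by simp
      have "(r/2)\<^sup>2 \<le> (Re z - r/2)\<^sup>2" using re r(2) by (intro power_mono) auto
      then have im: "Im z = 0" using sq zero_le_power2[of "Im z"] by (metis add_le_same_cancel1 add_left_mono dual_order.trans order_antisym zero_eq_power2)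
      have "Re z - r/2 \<le> r/2"
        using z abs_Re_le_cmod[of "z - x0"] by (simp add: x0_def)
      then have "z = of_real r" using re im by (simp add: complex_eq_iff)
      then show ?thesis using V0 by (simp add: W_def)
    qed (simp add: W_def)
  qed
  moreover have "open W" unfolding W_def using Vo by blast
  ultimately obtain e where e: "e > 0" "(\<Union>x\<in>cball x0 (r/2). ball x e) \<subseteq> W"
    using compact_subset_open_imp_ball_epsilon_subset[OF compact_cball] by metis
  have big: "ball x0 (r/2 + e) \<subseteq> W"
  proof
    fix z assume "z \<in> ball x0 (r/2 + e)"
    then have z: "norm (z - x0) < r/2 + e" by (simp add: dist_norm norm_minus_commute)
    have "\<exists>y\<in>cball x0 (r/2). z \<in> ball y e"
    proof (cases "norm (z - x0) \<le> r/2")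
      case True then show ?thesis using e(1) by (intro bexI[of _ z]) (auto simp: dist_norm norm_minus_commute)
    next
      case False
      \<comment> \<open>A point outside the smaller disc is moved radially onto its boundary circle;
        the displacement stays below \<open>e\<close>.\<close>
      define c where "c = (r/2) / norm (z - x0)"
      have "norm (z - x0) > 0" using False r(2) by linarith
      then have c: "0 < c" "c < 1" using False r(2) by (simp_all only: c_def) (simp_all add: divide_less_eq)
      have n1: "c * norm (z - x0) = r/2" using False r(2) by (auto simp: c_def)
      have "z - (x0 + c *\<^sub>R (z - x0)) = (1 - c) *\<^sub>R (z - x0)" by (simp add: algebra_simps)
      then have "norm (z - (x0 + c *\<^sub>R (z - x0))) = (1 - c) * norm (z - x0)"
        using c by simp
      also have "\<dots> < e" using z n1 by (simp add: algebra_simps)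
      finally have "z \<in> ball (x0 + c *\<^sub>R (z - x0)) e" by (simp add: dist_norm norm_minus_commute)
      moreover have "x0 + c *\<^sub>R (z - x0) \<in> cball x0 (r/2)"
        using c n1 by (simp add: dist_norm)
      ultimately show ?thesis by blast
    qed
    then show "z \<in> W" using e(2) by blast
  qed
  define w where "w = r + e/2"
  have wr: "w > r" using e by (simp add: w_def)
  have wb: "of_real w \<in> ball x0 (r/2 + e)"
  proof -
    have "x0 - of_real w = of_real (r/2 - w)" by (simp add: x0_def)
    then have "norm (x0 - of_real w) = \<bar>r/2 - w\<bar>" by (simp only: norm_of_real)
    then show ?thesis using e r(2) by (simp add: w_def dist_norm)
  qed
  have bound: "(\<Sum>n<N. a n * w ^ n) \<le> Re (h (of_real w))" for N
  proof -
    define p where "p z = (\<Sum>n<N. complex_of_real (a n) * z ^ n)" for z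
    \<comment> \<open>Near r/2 the function \<open>u\<close> is the tail of the series, so its
      Taylor coefficients there are nonnegative and so is its value at \<open>w\<close>, which lies
      to the right of r/2.\<close>
    define u where "u z = h z - p z" for z
    have uh: "u holomorphic_on ball x0 (r/2 + e)" unfolding u_def p_def
      by (intro holomorphic_intros holomorphic_on_subset[OF hh big])
    define F where "F z = f z - p z" for z
    have F: "(\<lambda>n. complex_of_real (if n < N then 0 else a n) * z ^ n) sums F z" if "norm z < r" for z
    proof -
      have "(\<lambda>n. if n \<in> {..<N} then complex_of_real (a n) * z ^ n else 0) sums p z"
        unfolding p_def by (rule sums_If_finite_set) simp
      from sums_diff[OF f[OF that] this] show ?thesis unfolding F_def
        by (rule sums_cong[THEN iffD1, rotated]) auto
    qed
    have ev: "(deriv ^^ m) u x0 = (deriv ^^ m) F x0" for m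
    proof (rule higher_deriv_cong_ev)
      have "eventually (\<lambda>z. z \<in> ball 0 r) (nhds x0)"
        by (rule eventually_nhds_in_open) (use r(2) in \<open>auto simp: x0_def\<close>)
      then show "eventually (\<lambda>z. u z = F z) (nhds x0)"
        by eventually_elim (simp add: u_def F_def h_def)
    qed simp
    have nn: "(deriv ^^ m) u x0 \<in> \<real> \<and> Re ((deriv ^^ m) u x0) \<ge> 0" for m
      unfolding ev unfolding x0_def
      by (rule higher_deriv_nonneg[OF _ F]) (use nonneg r(2) in auto)
    have s: "(\<lambda>m. (deriv ^^ m) u x0 / fact m * (of_real w - x0) ^ m) sums u (of_real w)"
      by (rule holomorphic_power_series[OF uh wb])
    have t: "Re ((deriv ^^ m) u x0 / fact m * (of_real w - x0) ^ m)
        = Re ((deriv ^^ m) u x0) / fact m * (w - r/2) ^ m" for m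
    proof -
      obtain y where y: "(deriv ^^ m) u x0 = of_real y" using nn[of m] by (auto elim: Reals_cases)
      have e1: "of_real w - x0 = of_real (w - r/2)" by (simp add: x0_def)
      have "(deriv ^^ m) u x0 / fact m * (of_real w - x0) ^ m = of_real (y / fact m * (w - r/2) ^ m)"
        unfolding y e1 by simp
      then show ?thesis unfolding y by (simp only: Re_complex_of_real)
    qed
    have "0 \<le> Re ((deriv ^^ m) u x0) / fact m * (w - r/2) ^ m" for m
      by (intro mult_nonneg_nonneg divide_nonneg_nonneg zero_le_power) (use nn[of m] wr r(2) in simp_all)
    then have "0 \<le> Re (u (of_real w))"
      by (rule sums_le[OF _ sums_zero sums_Re[OF s, unfolded t]])
    moreover have "p (of_real w) = of_real (\<Sum>n<N. a n * w ^ n)" by (simp add: p_def)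
    then have "Re (p (of_real w)) = (\<Sum>n<N. a n * w ^ n)" by (simp only: Re_complex_of_real)
    ultimately show ?thesis by (simp add: u_def)
  qed
  have "0 \<le> a n * w ^ n" for n
    using nonneg[of n] wr r(2) by simp
  then have "summable (\<lambda>n. a n * w ^ n)"
    by (rule summableI_nonneg_bounded[OF _ bound])
  from conv_radius_geI[OF this] show False using r wr by simp
qed

text \<open>The trace on a line of the continuation property of F. The series is compared with
  \<open>g\<close> at small real arguments only, because F is given at Hermitian tuples only. The
  function \<open>g\<close> is kept beside its coefficients because its value far from 0 is what has
  to be computed.\<close>

definition real_entire :: "(nat \<Rightarrow> complex) \<Rightarrow> (complex \<Rightarrow> complex) \<Rightarrow> bool" where
  "real_entire q g \<longleftrightarrow>
     (\<exists>S. open S \<and> range complex_of_real \<subseteq> S \<and> g holomorphic_on S) \<and>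
     (\<exists>\<rho>>0. \<forall>t. \<bar>t\<bar> < \<rho> \<longrightarrow> (\<lambda>k. q k * of_real t ^ k) sums g (of_real t))"

section \<open>Linear operations, reflection and uniqueness of values for real entire series\<close>

lemma real_entire_0: "real_entire (\<lambda>k. 0) (\<lambda>z. 0)"
  unfolding real_entire_def
  by (intro conjI exI[of _ UNIV] exI[of _ "1::real"]) auto

lemma real_entire_add:
  assumes "real_entire p f" "real_entire q g"
  shows "real_entire (\<lambda>k. p k + q k) (\<lambda>z. f z + g z)"
proof -
  from assms obtain S T \<rho> \<sigma> where
    S: "open S" "range complex_of_real \<subseteq> S" "f holomorphic_on S" and
    T: "open T" "range complex_of_real \<subseteq> T" "g holomorphic_on T" and
    r: "\<rho> > 0" "\<And>t. \<bar>t\<bar> < \<rho> \<Longrightarrow> (\<lambda>k. p k * of_real t ^ k) sums f (of_real t)" and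
    s: "\<sigma> > 0" "\<And>t. \<bar>t\<bar> < \<sigma> \<Longrightarrow> (\<lambda>k. q k * of_real t ^ k) sums g (of_real t)"
    unfolding real_entire_def by blast
  have "(\<lambda>z. f z + g z) holomorphic_on S \<inter> T"
    by (intro holomorphic_intros holomorphic_on_subset[OF S(3)] holomorphic_on_subset[OF T(3)]) auto
  moreover have "(\<lambda>k. (p k + q k) * of_real t ^ k) sums (f (of_real t) + g (of_real t))"
    if "\<bar>t\<bar> < min \<rho> \<sigma>" for t
    using sums_add[OF r(2) s(2)] that by (simp add: algebra_simps)
  moreover have "open (S \<inter> T)" "range complex_of_real \<subseteq> S \<inter> T" "min \<rho> \<sigma> > 0"
    using S T r s by auto
  ultimately show ?thesis unfolding real_entire_def by blast
qed

lemma real_entire_cmult: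
  assumes "real_entire q g"
  shows "real_entire (\<lambda>k. c * q k) (\<lambda>z. c * g z)"
proof -
  from assms obtain S \<rho> where
    S: "open S" "range complex_of_real \<subseteq> S" "g holomorphic_on S" and
    r: "\<rho> > 0" "\<And>t. \<bar>t\<bar> < \<rho> \<Longrightarrow> (\<lambda>k. q k * of_real t ^ k) sums g (of_real t)"
    unfolding real_entire_def by blast
  have "(\<lambda>z. c * g z) holomorphic_on S" by (intro holomorphic_intros S)
  moreover have "(\<lambda>k. (c * q k) * of_real t ^ k) sums (c * g (of_real t))"
    if "\<bar>t\<bar> < \<rho>" for t
    using sums_mult[OF r(2)[OF that]] by (simp add: mult_ac)
  ultimately show ?thesis using S r(1) unfolding real_entire_def by blast
qed

lemma real_entire_sum:
  assumes "finite I" "\<And>i. i \<in> I \<Longrightarrow> real_entire (q i) (g i)"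
  shows "real_entire (\<lambda>k. \<Sum>i\<in>I. q i k) (\<lambda>z. \<Sum>i\<in>I. g i z)"
  using assms by (induction I rule: finite_induct) (auto intro: real_entire_0 real_entire_add)

text \<open>Supplies the even part of a series: Pringsheim's theorem can be applied to it although
  the signs of the odd coefficients are unknown.\<close>

lemma real_entire_reflect:
  assumes "real_entire q g"
  shows "real_entire (\<lambda>k. (-1) ^ k * q k) (\<lambda>z. g (- z))"
proof -
  from assms obtain S \<rho> where
    S: "open S" "range complex_of_real \<subseteq> S" "g holomorphic_on S" and
    r: "\<rho> > 0" "\<And>t. \<bar>t\<bar> < \<rho> \<Longrightarrow> (\<lambda>k. q k * of_real t ^ k) sums g (of_real t)"
    unfolding real_entire_def by blast
  have "open (uminus ` S)" using S(1) by (rule open_negations)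
  moreover have "range complex_of_real \<subseteq> uminus ` S"
  proof
    fix z assume "z \<in> range complex_of_real"
    then obtain t where "z = of_real t" by blast
    moreover have "of_real (- t) \<in> S" using S(2) by blast
    ultimately show "z \<in> uminus ` S" by (intro image_eqI[of _ _ "of_real (- t)"]) simp_all
  qed
  moreover have "(\<lambda>z. g (- z)) holomorphic_on uminus ` S"
    using holomorphic_on_compose_gen[OF holomorphic_on_minus[OF holomorphic_on_ident] S(3), of "uminus ` S"]
    by (auto simp: o_def image_image)
  moreover have "(\<lambda>k. ((-1) ^ k * q k) * of_real t ^ k) sums g (- of_real t)" if "\<bar>t\<bar> < \<rho>" for t
    using r(2)[of "- t"] that by (simp add: power_minus[of "complex_of_real t"] mult_ac)
  ultimately show ?thesis using r(1) unfolding real_entire_def by blast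
qed

text \<open>The difference has the zero series and vanishes on a real interval about 0. The common
  domain may be disconnected, but its component of 0 contains the whole real line, so the identity
  theorem reaches \<open>x\<close>.\<close>

lemma real_entire_unique_value:
  assumes "real_entire q g" "real_entire q h"
  shows "g (of_real x) = h (of_real x)"
proof -
  have "real_entire (\<lambda>k. q k + (-1) * q k) (\<lambda>z. g z + (-1) * h z)"
    by (intro real_entire_add real_entire_cmult assms)
  then obtain S \<rho> where
    S: "open S" "range complex_of_real \<subseteq> S" "(\<lambda>z. g z - h z) holomorphic_on S" and
    \<rho>: "\<rho> > 0" "\<And>t. \<bar>t\<bar> < \<rho> \<Longrightarrow> (\<lambda>k. 0) sums (g (of_real t) - h (of_real t))"
    unfolding real_entire_def by auto
  have r: "\<rho> > 0" "\<And>t. \<bar>t\<bar> < \<rho> \<Longrightarrow> g (of_real t) - h (of_real t) = 0"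
    using \<rho> sums_unique2[OF sums_zero] by metis+
  define C where "C = connected_component_set S 0"
  have "open C" unfolding C_def using S(1) by (rule open_connected_component)
  moreover have "connected C" unfolding C_def by simp
  moreover have CR: "range complex_of_real \<subseteq> C" unfolding C_def
    by (rule connected_component_maximal)
       (use S(2) in \<open>auto intro!: connected_continuous_image continuous_intros\<close>)
  moreover have lim: "0 islimpt complex_of_real ` {t. \<bar>t\<bar> < \<rho>}"
    unfolding islimpt_approachable
  proof (intro allI impI)
    fix e :: real assume "e > 0"
    then show "\<exists>x'\<in>complex_of_real ` {t. \<bar>t\<bar> < \<rho>}. x' \<noteq> 0 \<and> dist x' 0 < e"
      using r(1) by (intro bexI[of _ "of_real (min \<rho> e / 2)"] imageI) (auto simp: min_def)
  qed
  moreover have CS: "C \<subseteq> S" unfolding C_def by (rule connected_component_subset)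
  ultimately have C: "open C" "connected C" by blast+
  have U: "complex_of_real ` {t. \<bar>t\<bar> < \<rho>} \<subseteq> C" and "0 \<in> C" "of_real x \<in> C"
    using CR by (blast, metis of_real_0 rangeI subsetD, blast)
  then have "g (of_real x) - h (of_real x) = 0"
    using analytic_continuation[OF holomorphic_on_subset[OF S(3) CS] C U _ lim _, of "of_real x"] r(2)
    by blast
  then show ?thesis by simp
qed

text \<open>The polynomial is itself a continuation with the same coefficients. The argument 1 is
  the parameter at which the line of the tuples z X passes through X.\<close>

lemma real_entire_polynomial:
  assumes "real_entire q g" "\<And>k. k \<ge> 3 \<Longrightarrow> q k = 0"
  shows "g 1 = q 0 + q 1 + q 2"
proof -
  have "real_entire q (\<lambda>z. \<Sum>k\<in>{..<3}. q k * z ^ k)"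
    unfolding real_entire_def
  proof (intro conjI exI[of _ UNIV] exI[of _ "1::real"] allI impI)
    fix t :: real
    have "q k = 0" if "k \<notin> {..<3}" for k using assms(2) that by auto
    then show "(\<lambda>k. q k * of_real t ^ k) sums (\<Sum>k\<in>{..<3}. q k * of_real t ^ k)"
      by (intro sums_finite) auto
  qed (auto intro!: holomorphic_intros)
  moreover have "{..<3::nat} = {0, 1, 2}" by auto
  ultimately show ?thesis
    using real_entire_unique_value[of q g "\<lambda>z. \<Sum>k\<in>{..<3}. q k * z ^ k" 1] assms(1) by simp
qed

text \<open>Only vectors \<open>\<nu>\<close> with at most two nonzero entries are tested, so the
  argument rests on the 2 by 2 principal minors of the Hankel matrix. The hypothesis on imaginary
  parts is there because \<open>q\<close> is complex to begin with; the reality of its values from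
  index 2 on is derived from it.\<close>

lemma hankel_real_entire_vanishing:
  assumes ent: "real_entire q g"
    and re: "\<And>n \<nu>. 0 \<le> Re (\<Sum>i\<in>{1..n}. \<Sum>j\<in>{1..n}. of_real (\<nu> i) * of_real (\<nu> j) * q (i + j))"
    and im: "\<And>n \<nu>. Im (\<Sum>i\<in>{1..n}. \<Sum>j\<in>{1..n}. of_real (\<nu> i) * of_real (\<nu> j) * q (i + j)) = 0"
    and k: "k \<ge> (3::nat)"
  shows "q k = 0"
proof -
  have two: "(\<Sum>i\<in>{1..n}. \<Sum>j\<in>{1..n}. of_real (\<nu> i) * of_real (\<nu> j) * q (i + j))
     = of_real (x * x) * q (a + a) + of_real (2 * x * y) * q (a + b) + of_real (y * y) * q (b + b)"
    if "\<nu> = (\<lambda>i. if i = a then x else if i = b then y else 0)" "n = max a b" "a \<ge> 1" "b \<ge> 1" "a \<noteq> b"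
    for a b n :: nat and x y :: real and \<nu>
  proof -
    have red: "(\<Sum>i\<in>{1..n}. of_real (\<nu> i) * h i) = of_real x * h a + of_real y * h b" for h :: "nat \<Rightarrow> complex"
    proof -
      have "(\<Sum>i\<in>{1..n}. of_real (\<nu> i) * h i) = (\<Sum>i\<in>{a, b}. of_real (\<nu> i) * h i)"
        by (rule sum.mono_neutral_right) (use that in auto)
      then show ?thesis using that by simp
    qed
    have "(\<Sum>i\<in>{1..n}. \<Sum>j\<in>{1..n}. of_real (\<nu> i) * of_real (\<nu> j) * q (i + j))
      = (\<Sum>i\<in>{1..n}. of_real (\<nu> i) * (\<Sum>j\<in>{1..n}. of_real (\<nu> j) * q (i + j)))"
      by (simp add: sum_distrib_left mult_ac)
    then show ?thesis unfolding red by (simp add: algebra_simps add.commute[of b a])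
  qed
  define c where "c n = Re (q n)" for n
  have disc: "0 \<le> x * x * c (a + a) + 2 * x * y * c (a + b) + y * y * c (b + b)"
    and discI: "x * x * Im (q (a + a)) + 2 * x * y * Im (q (a + b)) + y * y * Im (q (b + b)) = 0"
    if "a \<ge> 1" "b \<ge> 1" "a \<noteq> b" for a b :: nat and x y :: real
    using re[of "\<lambda>i. if i = a then x else if i = b then y else 0" "max a b"]
      im[of "\<lambda>i. if i = a then x else if i = b then y else 0" "max a b"]
    unfolding two[OF refl refl that, of x y] by (simp_all add: c_def)
  have diag: "c (a + a) \<ge> 0" "Im (q (a + a)) = 0" if "a \<ge> 1" for a
    using disc[of a "Suc a" 1 0] discI[of a "Suc a" 1 0] that by auto
  \<comment> \<open>For n > 2 the pair of indices 1 and n - 1 shows \<open>q n\<close> as an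
    off-diagonal entry between two diagonal entries already known to be real.\<close>
  have real: "Im (q n) = 0" if n: "n \<ge> 2" for n
  proof (cases "n = 2")
    case True then show ?thesis using diag(2)[of 1, unfolded one_add_one] by simp
  next
    case False
    then show ?thesis using discI[of 1 "n - 1" 1 1] n diag(2)[of 1] diag(2)[of "n-1"] by simp
  qed
  have cs: "(c (a + b))\<^sup>2 \<le> c (a + a) * c (b + b)" if ab: "a \<ge> 1" "b \<ge> 1" for a b
  proof (cases "a = b")
    case False
    show ?thesis
    proof (cases "c (a + a) = 0")
      case True
      have "c (a + b) = 0"
      proof (rule ccontr)
        assume nz: "c (a + b) \<noteq> 0"
        have "0 \<le> 2 * x * c (a + b) + c (b + b)" for x
          using disc[OF ab False, of x 1] True by simp
        \<comment> \<open>With this choice the supposedly nonnegative quantity equals -1.\<close>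
        from this[of "- (c (b + b) + 1) / (2 * c (a + b))"] show False using nz by (simp add: field_simps)
      qed
      then show ?thesis using True by simp
    next
      case nz: False
      then have p: "c (a + a) > 0" using diag(1)[OF ab(1)] by simp
      \<comment> \<open>The test vector is chosen so that the form becomes \<open>c (a + a)\<close>
        times the determinant of the minor.\<close>
      have "0 \<le> c (a + a) * (c (a + a) * c (b + b) - (c (a + b))\<^sup>2)"
        using disc[OF ab False, of "- c (a + b)" "c (a + a)"]
        by (simp add: power2_eq_square algebra_simps)
      then show ?thesis using p by (simp add: zero_le_mult_iff)
    qed
  qed (simp add: power2_eq_square)
  \<comment> \<open>The even part without its constant term: \<open>q 0\<close> is not an entry of
    the Hankel matrix, so neither its sign nor its reality is known.\<close>
  define e where "e n = (if even n \<and> n \<ge> 2 then c n else 0)" for n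
  have e_nonneg: "e n \<ge> 0" for n
  proof (cases "even n \<and> n \<ge> 2")
    case True
    then obtain m where "n = m + m" by (metis evenE mult_2)
    then show ?thesis using True diag(1)[of m] by (simp add: e_def)
  qed (auto simp: e_def)
  have "real_entire (\<lambda>k. if k = 0 then 1 else 0) (\<lambda>z. 1)"
    unfolding real_entire_def
  proof (intro conjI exI[of _ UNIV] exI[of _ "1::real"] allI impI)
    fix t :: real
    show "(\<lambda>k. (if k = 0 then 1 else 0) * complex_of_real t ^ k) sums 1"
      using sums_single[of 0 "\<lambda>k. complex_of_real t ^ k"]
      by (simp add: if_distribR if_distrib[of "\<lambda>x. x * _"] cong: if_cong)
  qed auto
  from real_entire_add[OF real_entire_cmult[OF real_entire_add[OF ent real_entire_reflect[OF ent]], of "1/2"]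
      real_entire_cmult[OF this, of "- q 0"]]
  have E: "real_entire (\<lambda>k. 1/2 * (q k + (-1) ^ k * q k) + (- q 0) * (if k = 0 then 1 else 0))
      (\<lambda>z. 1/2 * (g z + g (- z)) + (- q 0) * 1)" .
  have "(\<lambda>k. 1/2 * (q k + (-1) ^ k * q k) + (- q 0) * (if k = 0 then 1 else 0)) = (\<lambda>k. complex_of_real (e k))"
  proof
    fix k
    show "1/2 * (q k + (-1) ^ k * q k) + (- q 0) * (if k = 0 then 1 else 0) = complex_of_real (e k)"
    proof (cases "even k")
      case True
      then have "k = 0 \<or> k \<ge> 2" by presburger
      then show ?thesis using True real[of k] by (auto simp: e_def c_def complex_eq_iff)
    qed (auto simp: e_def)
  qed
  with E have "real_entire (\<lambda>k. complex_of_real (e k)) (\<lambda>z. 1/2 * (g z + g (- z)) + (- q 0) * 1)"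
    by (simp only:)
  then have R: "conv_radius e = \<infinity>"
    unfolding real_entire_def using pringsheim_real_line[of e] e_nonneg by blast
  have c4: "c 2 = 0 \<or> c 4 = 0"
  proof (rule ccontr)
    assume "\<not> (c 2 = 0 \<or> c 4 = 0)"
    then have p: "c 2 > 0" "c 4 > 0" using diag(1)[of 1, unfolded one_add_one] diag(1)[of 2] by (auto simp: less_le)
    \<comment> \<open>By log-convexity the ratio of consecutive even coefficients never falls below
      this initial value, so they grow at least geometrically.\<close>
    define r where "r = c 4 / c 2"
    have r: "r > 0" using p by (simp add: r_def)
    have step: "c (2 * j + 2) > 0 \<and> c (2 * j + 4) \<ge> r * c (2 * j + 2)" for j
    proof (induction j)
      case 0 then show ?case using p by (simp add: r_def del: add_2_eq_Suc')
    next
      case (Suc j)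
      have pos: "c (2 * j + 4) > 0" using Suc r by (meson less_le_trans mult_pos_pos)
      have "(c (2 * j + 4))\<^sup>2 \<le> c (2 * j + 2) * c (2 * j + 6)"
        proof -
        have "(j + 1) + (j + 1) = 2 * j + 2" "(j + 1) + (j + 3) = 2 * j + 4" "(j + 3) + (j + 3) = 2 * j + 6"
          by simp_all
        then show ?thesis using cs[of "j + 1" "j + 3"] by (simp only:)
      qed
      moreover have "r * c (2 * j + 2) * c (2 * j + 4) \<le> (c (2 * j + 4))\<^sup>2"
        using Suc pos by (simp add: power2_eq_square)
      ultimately have "c (2 * j + 2) * (r * c (2 * j + 4)) \<le> c (2 * j + 2) * c (2 * j + 6)"
        by (simp add: mult_ac)
      then have "r * c (2 * j + 4) \<le> c (2 * j + 6)" using Suc by simp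
      moreover have "2 * Suc j + 2 = 2 * j + 4" "2 * Suc j + 4 = 2 * j + 6" by simp_all
      ultimately show ?case using pos by (simp only:)
    qed
    have grow: "c (2 * j + 2) \<ge> c 2 * r ^ j" for j
    proof (induction j)
      case (Suc j)
      have i: "2 * Suc j + 2 = 2 * j + 4" by simp
      have "c 2 * r ^ Suc j \<le> r * c (2 * j + 2)" using Suc r by simp
      also have "\<dots> \<le> c (2 * Suc j + 2)" unfolding i using step[of j] by blast
      finally show ?case .
    qed (simp del: add_2_eq_Suc')
    \<comment> \<open>At this point every even term from index 2 on is at least
      \<open>c 2 / r\<close>, so the terms cannot tend to 0 although the series converges everywhere
      by \<open>R\<close>.\<close>
    define x where "x = 1 / sqrt r"
    have x: "x > 0" "x ^ 2 = 1 / r" using r by (simp_all add: x_def power_divide)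
    have "summable (\<lambda>n. e n * x ^ n)"
      by (rule summable_in_conv_radius) (simp add: R)
    from summable_LIMSEQ_zero[OF this]
    have "(\<lambda>j. e (2 * j + 2) * x ^ (2 * j + 2)) \<longlonglongrightarrow> 0"
      by (rule LIMSEQ_subseq_LIMSEQ[where f = "\<lambda>j. 2 * j + 2", unfolded o_def])
         (simp add: strict_mono_def)
    moreover have "c 2 / r \<le> e (2 * j + 2) * x ^ (2 * j + 2)" for j
    proof -
      have "x ^ (2 * j + 2) = (1 / r) ^ (j + 1)"
        using power_mult[of x 2 "j + 1"] x(2) by simp
      moreover have "c 2 / r = c 2 * r ^ j * (1 / r) ^ (j + 1)"
        using r by (simp add: power_divide)
      moreover have "c 2 * r ^ j * (1 / r) ^ (j + 1) \<le> c (2 * j + 2) * (1 / r) ^ (j + 1)"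
        by (rule mult_right_mono[OF grow]) (use r in simp)
      moreover have "e (2 * j + 2) = c (2 * j + 2)" by (simp add: e_def)
      ultimately show ?thesis by (simp only:)
    qed
    ultimately have "c 2 / r \<le> 0" by (intro LIMSEQ_le_const) auto
    then show False using p r by (simp add: divide_le_0_iff)
  qed
  have "c 4 = 0"
    using cs[of 1 3, unfolded one_add_one] c4 by auto
  \<comment> \<open>The splittings 1 + (k - 1) and 2 + (k - 2) bound the square of
    \<open>c k\<close> by a multiple of \<open>c 2\<close> and of \<open>c 4\<close>. The second one
    uses the index k - 2, which is at least 1 precisely for k \<ge> 3; the degree bound 2 comes from
    here.\<close>
  have i: "1 + (k - 1) = k" "2 + (k - 2) = k" "1 + 1 = (2::nat)" "2 + 2 = (4::nat)" using k by auto
  have "(c k)\<^sup>2 \<le> 0"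
    using c4 \<open>c 4 = 0\<close> cs[of 1 "k - 1", unfolded i] cs[of 2 "k - 2", unfolded i] k by auto
  then have "c k = 0" by simp
  then show ?thesis using real[of k] k by (simp add: c_def complex_eq_iff)
qed

section \<open>Matrix convex power series in one variable\<close>

fun path_walks :: "real \<Rightarrow> nat \<Rightarrow> nat \<Rightarrow> nat \<Rightarrow> nat \<Rightarrow> real" where
  "path_walks c N 0 i j = (if i = j then 1 else 0)"
| "path_walks c N (Suc k) i j =
     (if j = 0 then 0 else path_walks c N k i (j - 1) * (if j = 1 then c else 1)) +
     (if Suc j < N then path_walks c N k i (Suc j) * (if j = 0 then c else 1) else 0)"

text \<open>This is \<open>s\<close> times the adjacency matrix of the path on 0, ..., N - 1 in
  which the edge between 0 and 1 has weight \<open>c\<close>. Correspondingly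
  \<open>path_walks c N k i j\<close> is the total weight, without the factor \<open>s\<close>, of
  the walks of length \<open>k\<close> from \<open>i\<close> to \<open>j\<close>; its recursion
  removes the last step.\<close>

definition path_mat :: "real \<Rightarrow> real \<Rightarrow> nat \<Rightarrow> complex mat" where
  "path_mat s c N = mat N N (\<lambda>(i, j). of_real
     (if i = Suc j \<or> j = Suc i then (if i = 0 \<or> j = 0 then s * c else s) else 0))"

lemma path_mat_carrier [simp]: "path_mat s c N \<in> carrier_mat N N"
  by (simp add: path_mat_def)

lemma path_mat_dim [simp]: "dim_row (path_mat s c N) = N" "dim_col (path_mat s c N) = N"
  by (simp_all add: path_mat_def)

lemma path_mat_pow:
  assumes "i < N" "j < N"
  shows "(path_mat s c N ^\<^sub>m k) $$ (i, j) = of_real (s ^ k * path_walks c N k i j)"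
  using assms(2)
proof (induction k arbitrary: j)
  case 0
  then show ?case using assms(1) by (simp add: path_mat_def)
next
  case (Suc k)
  let ?w = "\<lambda>l. s ^ k * path_walks c N k i l * (if l = Suc j \<or> j = Suc l then (if l = 0 \<or> j = 0 then s * c else s) else 0)"
  have "(path_mat s c N ^\<^sub>m Suc k) $$ (i, j)
      = (\<Sum>l\<in>{0..<N}. (path_mat s c N ^\<^sub>m k) $$ (i, l) * path_mat s c N $$ (l, j))"
    using assms(1) Suc.prems
    by (simp add: times_mat_def scalar_prod_def carrier_matD[OF pow_carrier_mat[OF path_mat_carrier]])
  also have "\<dots> = (\<Sum>l\<in>{0..<N}. of_real (?w l))"
    by (rule sum.cong[OF refl]) (use Suc in \<open>simp add: path_mat_def\<close>)
  also have "\<dots> = of_real (\<Sum>l\<in>{0..<N}. ?w l)"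
    by (rule of_real_sum[symmetric])
  also have "(\<Sum>l\<in>{0..<N}. ?w l) = (\<Sum>l\<in>(if j = 0 then {} else {j - 1}) \<union> (if Suc j < N then {Suc j} else {}). ?w l)"
    by (rule sum.mono_neutral_right) (use Suc.prems in \<open>auto split: if_splits\<close>)
  also have "\<dots> = (\<Sum>l\<in>(if j = 0 then {} else {j - 1}). ?w l) + (\<Sum>l\<in>(if Suc j < N then {Suc j} else {}). ?w l)"
    by (rule sum.union_disjoint) auto
  also have "\<dots> = s ^ Suc k * path_walks c N (Suc k) i j"
    by (auto simp: algebra_simps)
  finally show ?case .
qed

text \<open>A walk from \<open>i \<ge> 1\<close> crosses the edge between 0 and 1 an odd number of
  times exactly when it ends at 0. In matrix terms, the two weights give matrices conjugate by
  diag(-1, 1, ..., 1).\<close>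

lemma path_walks_flip:
  assumes "i \<ge> 1"
  shows "path_walks (-1) N k i j = (if j = 0 then - 1 else 1) * path_walks 1 N k i j"
  using assms by (induction k arbitrary: j) auto

text \<open>Every vertex has at most two neighbours. The factor 2 per step will only shrink a radius
  of convergence by 2.\<close>

lemma path_walks_bound:
  assumes "\<bar>c\<bar> \<le> 1"
  shows "\<bar>path_walks c N k i j\<bar> \<le> 2 ^ k"
proof (induction k arbitrary: j)
  case (Suc k)
  have m: "\<bar>x * (if b then c else 1)\<bar> \<le> \<bar>x\<bar>" for x b
    using assms mult_left_le[of "\<bar>c\<bar>" "\<bar>x\<bar>"] by (simp add: abs_mult)
  have "\<bar>if j = 0 then 0 else path_walks c N k i (j - 1) * (if j = 1 then c else 1)\<bar> \<le> \<bar>path_walks c N k i (j - 1)\<bar>"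
    by (cases "j = 0") (simp, use m[of "path_walks c N k i (j - 1)" "j = 1"] in \<open>simp only: if_False\<close>)
  moreover have "\<bar>if Suc j < N then path_walks c N k i (Suc j) * (if j = 0 then c else 1) else 0\<bar> \<le> \<bar>path_walks c N k i (Suc j)\<bar>"
    by (cases "Suc j < N") (use m[of "path_walks c N k i (Suc j)" "j = 0"] in \<open>simp only: if_True\<close>, simp)
  ultimately have "\<bar>path_walks c N (Suc k) i j\<bar> \<le> \<bar>path_walks c N k i (j - 1)\<bar> + \<bar>path_walks c N k i (Suc j)\<bar>"
    unfolding path_walks.simps by (rule order_trans[OF abs_triangle_ineq add_mono])
  then show ?case using Suc[of "j - 1"] Suc[of "Suc j"] by simp
qed auto

lemma path_walks_0_0: "i \<ge> 1 \<Longrightarrow> path_walks 0 N k i 0 = 0"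
  by (cases k) auto

text \<open>Each step moves by one vertex, so going down from \<open>i\<close> to \<open>j\<close>
  takes at least i - j steps, and with exactly that many the walk must descend at every
  step.\<close>

lemma path_walks_straight:
  assumes "i < N"
  shows "(k + j < i \<longrightarrow> path_walks 1 N k i j = 0) \<and> (k + j = i \<longrightarrow> path_walks 1 N k i j = 1)"
proof (induction k arbitrary: j)
  case (Suc k)
  show ?case using Suc[of "j - 1"] Suc[of "Suc j"] assms by (cases j) auto
qed auto

text \<open>The difference counts the walks from i to j that visit the vertex 0.\<close>
lemma path_walks_through_0:
  assumes "1 \<le> i" "i < N" "j < N"
  shows "(k < i + j \<longrightarrow> path_walks 1 N k i j - path_walks 0 N k i j = 0) \<and>
         (k = i + j \<longrightarrow> path_walks 1 N k i j - path_walks 0 N k i j = 1)"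
  using assms(3)
proof (induction k arbitrary: j)
  case 0
  then show ?case using assms by auto
next
  case (Suc k)
  show ?case
  proof (cases "j = 0")
    case True
    \<comment> \<open>All walks that end at 0 visit 0, so here the difference counts every walk, and
      the shortest is the straight descent.\<close>
    have "path_walks 0 N (Suc k) i 0 = 0" by (rule path_walks_0_0[OF assms(1)])
    then show ?thesis using path_walks_straight[OF assms(2), of "Suc k" 0] True
      by (auto simp del: path_walks.simps)
  next
    case False
    then obtain j' where j': "j = Suc j'" by (cases j) auto
    have "path_walks 0 N k i 0 = 0" by (rule path_walks_0_0[OF assms(1)])
    then have "path_walks 1 N (Suc k) i j - path_walks 0 N (Suc k) i j =
        (path_walks 1 N k i j' - path_walks 0 N k i j') +
        (if Suc j < N then path_walks 1 N k i (Suc j) - path_walks 0 N k i (Suc j) else 0)"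
      using j' by (auto simp: algebra_simps)
    then show ?thesis
      using j' Suc.IH[of j'] Suc.IH[of "Suc j"] Suc.prems by (auto simp del: path_walks.simps)
  qed
qed

section \<open>Matrix convexity of a scalar series and positivity of its Hankel matrix\<close>

definition small_midpoint :: "nat \<Rightarrow> real \<Rightarrow> complex mat \<Rightarrow> complex mat \<Rightarrow> complex mat \<Rightarrow> bool" where
  "small_midpoint N \<delta> T T' M \<longleftrightarrow>
     T \<in> carrier_mat N N \<and> T' \<in> carrier_mat N N \<and> M \<in> carrier_mat N N \<and>
     (\<forall>i<N. \<forall>j<N. cmod (T $$ (i, j)) < \<delta> \<and> T $$ (j, i) = cnj (T $$ (i, j)) \<and>
        cmod (T' $$ (i, j)) < \<delta> \<and> T' $$ (j, i) = cnj (T' $$ (i, j)) \<and>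
        M $$ (i, j) = (T $$ (i, j) + T' $$ (i, j)) / 2)"

text \<open>The formal series with coefficients q is midpoint convex on small Hermitian matrices of
  every size, tested on real vectors.\<close>
definition matrix_convex_series :: "(nat \<Rightarrow> complex) \<Rightarrow> bool" where
  "matrix_convex_series q \<longleftrightarrow>
     (\<forall>N\<ge>1. \<exists>\<delta>>0. \<forall>T T' M. \<forall>x :: nat \<Rightarrow> real. small_midpoint N \<delta> T T' M \<longrightarrow>
        (\<exists>s\<ge>0. (\<lambda>k. q k * (\<Sum>i<N. \<Sum>j<N. of_real (x i) * of_real (x j) *
            (((T ^\<^sub>m k) $$ (i, j) + (T' ^\<^sub>m k) $$ (i, j)) / 2 - (M ^\<^sub>m k) $$ (i, j)))) sums of_real s))"

text \<open>With the weights \<open>\<nu> i / s ^ i\<close> the convexity defect is a power series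
  in \<open>s\<close> whose constant term is the Hankel form. It is real and nonnegative for small s
  > 0, so its limit at 0 is too. Summability at one positive \<open>t\<close> bounds the growth of
  \<open>q\<close> and so makes this series converge.\<close>

lemma matrix_convex_series_hankel:
  assumes conv: "matrix_convex_series q"
    and t: "t > 0" "summable (\<lambda>k. q k * of_real t ^ k)"
  shows "0 \<le> Re (\<Sum>i\<in>{1..n}. \<Sum>j\<in>{1..n}. of_real (\<nu> i) * of_real (\<nu> j) * q (i + j)) \<and>
    Im (\<Sum>i\<in>{1..n}. \<Sum>j\<in>{1..n}. of_real (\<nu> i) * of_real (\<nu> j) * q (i + j)) = 0"
proof -
  define N where "N = Suc n"
  define u where "u i j k = complex_of_real (path_walks 1 N k i j - path_walks 0 N k i j)" for i j k
  \<comment> \<open>No walk shorter than i + j visits 0 on the way from \<open>i\<close> to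
    \<open>j\<close>, so the first i + j terms of the defect vanish; \<open>b\<close> lists the
    coefficients left after division by \<open>s ^ (i + j)\<close>.\<close>
  define b where "b i j l = q (l + (i + j)) * u i j (l + (i + j))" for i j l
  define f where "f i j z = suminf (\<lambda>l. b i j l * z ^ l)" for i j and z :: complex
  have ub: "norm (u i j k) \<le> 2 * 2 ^ k" for i j k
  proof -
    have "\<bar>path_walks 1 N k i j - path_walks 0 N k i j\<bar> \<le> 2 ^ k + 2 ^ k"
      using path_walks_bound[of 1 N k i j] path_walks_bound[of 0 N k i j] by simp
    then show ?thesis unfolding u_def norm_of_real by simp
  qed
  \<comment> \<open>Passing from t to t/2 gives absolute convergence; passing from t/2 to t/4
    absorbs the bound \<open>2 ^ k\<close> on the walks.\<close>
  have s0: "summable (\<lambda>l. b i j l * (of_real (t / 4)) ^ l)" for i j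
  proof (rule summable_comparison_test)
    let ?m = "i + j"
    have "summable (\<lambda>k. norm (q k * (of_real (t / 2)) ^ k))"
      by (rule powser_insidea[OF t(2)]) (use t(1) in simp)
    then have "summable (\<lambda>l. norm (q (l + ?m) * (of_real (t / 2)) ^ (l + ?m)))"
      by (subst summable_iff_shift)
    then show "summable (\<lambda>l. 2 / (t / 4) ^ ?m * norm (q (l + ?m) * (of_real (t / 2)) ^ (l + ?m)))"
      by (rule summable_mult)
    have "norm (b i j l * (of_real (t / 4)) ^ l) \<le> 2 / (t / 4) ^ ?m * norm (q (l + ?m) * (of_real (t / 2)) ^ (l + ?m))" for l
    proof -
      have "norm (b i j l * (of_real (t / 4)) ^ l) = norm (q (l + ?m)) * norm (u i j (l + ?m)) * (t / 4) ^ l"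
        using t(1) by (simp add: b_def norm_mult norm_power)
      also have "\<dots> \<le> norm (q (l + ?m)) * (2 * 2 ^ (l + ?m)) * (t / 4) ^ l"
        using ub t(1) by (intro mult_right_mono mult_left_mono) auto
      also have "\<dots> = 2 / (t / 4) ^ ?m * (norm (q (l + ?m)) * (2 * (t / 4)) ^ (l + ?m))"
      proof -
        have "a * (2 * 2 ^ (l + m)) * y ^ l = 2 / y ^ m * (a * (2 * y) ^ (l + m))"
          if "y > 0" for a y :: real and m
          using that by (simp add: power_add power_mult_distrib)
        moreover have "t / 4 > 0" using t(1) by simp
        ultimately show ?thesis .
      qed
      also have "2 * (t / 4) = t / 2" by simp
      finally show ?thesis using t(1) by (simp add: norm_mult norm_power)
    qed
    then show "\<exists>K. \<forall>l\<ge>K. norm (b i j l * (of_real (t / 4)) ^ l) \<le> 2 / (t / 4) ^ ?m * norm (q (l + ?m) * (of_real (t / 2)) ^ (l + ?m))"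
      by blast
  qed
  have fs: "(\<lambda>l. b i j l * z ^ l) sums f i j z" if "norm z < t / 4" for i j z
    unfolding f_def by (intro summable_sums powser_inside[OF s0]) (use that t(1) in simp)
  have flim: "(f i j \<longlongrightarrow> b i j 0) (at 0)" for i j
    by (rule powser_limit_0[where s = "t / 4", OF _ fs]) (use t(1) in auto)
  have b0: "b i j 0 = q (i + j)" if "i \<in> {1..n}" "j \<in> {1..n}" for i j
    using path_walks_through_0[of i N j "i + j"] that by (simp add: b_def u_def N_def)
  define G where "G z = (\<Sum>i\<in>{1..n}. \<Sum>j\<in>{1..n}. of_real (\<nu> i) * of_real (\<nu> j) * f i j z)" for z
  let ?H = "\<Sum>i\<in>{1..n}. \<Sum>j\<in>{1..n}. of_real (\<nu> i) * of_real (\<nu> j) * q (i + j)"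
  have "(G \<longlongrightarrow> (\<Sum>i\<in>{1..n}. \<Sum>j\<in>{1..n}. of_real (\<nu> i) * of_real (\<nu> j) * b i j 0)) (at 0)"
    unfolding G_def by (intro tendsto_intros flim)
  also have "(\<Sum>i\<in>{1..n}. \<Sum>j\<in>{1..n}. of_real (\<nu> i) * of_real (\<nu> j) * b i j 0) = ?H"
    using b0 by simp
  finally have "(G \<longlongrightarrow> ?H) (at 0)" .
  moreover have "filterlim complex_of_real (at 0) (at_right 0)"
    by (auto simp: filterlim_at eventually_at_filter intro!: tendsto_eq_intros)
  ultimately have lim: "((\<lambda>s. G (of_real s)) \<longlongrightarrow> ?H) (at_right 0)"
    by (rule filterlim_compose)
  have "N \<ge> 1" by (simp add: N_def)
  with conv obtain \<delta> where \<delta>: "\<delta> > 0" and conv':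
    "\<forall>T T' M. \<forall>x :: nat \<Rightarrow> real. small_midpoint N \<delta> T T' M \<longrightarrow>
        (\<exists>s\<ge>0. (\<lambda>k. q k * (\<Sum>i<N. \<Sum>j<N. of_real (x i) * of_real (x j) *
            (((T ^\<^sub>m k) $$ (i, j) + (T' ^\<^sub>m k) $$ (i, j)) / 2 - (M ^\<^sub>m k) $$ (i, j)))) sums of_real s)"
    unfolding matrix_convex_series_def by blast
  have ev: "\<exists>r\<ge>0. G (of_real s) = of_real r" if s: "0 < s" "s < min \<delta> (t / 4)" for s
  proof -
    \<comment> \<open>The vertex 0 gets weight 0 because the powers for c = 1 and c = -1 are known
      to agree only at entries (i, j) with i, j \<ge> 1.\<close>
    define x where "x i = (if i = 0 then 0 else \<nu> i / s ^ i)" for i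
    have "\<exists>r\<ge>0. (\<lambda>k. q k * (\<Sum>i<N. \<Sum>j<N. of_real (x i) * of_real (x j) *
            (((path_mat s 1 N ^\<^sub>m k) $$ (i, j) + (path_mat s (-1) N ^\<^sub>m k) $$ (i, j)) / 2
              - (path_mat s 0 N ^\<^sub>m k) $$ (i, j)))) sums of_real r"
      by (rule conv'[rule_format]) (use s \<delta> in \<open>auto simp: path_mat_def small_midpoint_def\<close>)
    then obtain r where r: "r \<ge> 0" "(\<lambda>k. q k * (\<Sum>i<N. \<Sum>j<N. of_real (x i) * of_real (x j) *
            (((path_mat s 1 N ^\<^sub>m k) $$ (i, j) + (path_mat s (-1) N ^\<^sub>m k) $$ (i, j)) / 2
              - (path_mat s 0 N ^\<^sub>m k) $$ (i, j)))) sums of_real r" by blast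
    have eq: "(\<Sum>i<N. \<Sum>j<N. of_real (x i) * of_real (x j) *
            (((path_mat s 1 N ^\<^sub>m k) $$ (i, j) + (path_mat s (-1) N ^\<^sub>m k) $$ (i, j)) / 2
              - (path_mat s 0 N ^\<^sub>m k) $$ (i, j)))
        = (\<Sum>i\<in>{1..n}. \<Sum>j\<in>{1..n}. of_real (x i) * of_real (x j) * (of_real s ^ k * u i j k))" (is "?L = ?R") for k
    proof -
      have "?L = (\<Sum>i<N. \<Sum>j<N. of_real (x i) * of_real (x j) * (of_real s ^ k * u i j k))"
      proof (intro sum.cong refl)
        fix i j assume "i \<in> {..<N}" "j \<in> {..<N}"
        then show "of_real (x i) * of_real (x j) *
            (((path_mat s 1 N ^\<^sub>m k) $$ (i, j) + (path_mat s (-1) N ^\<^sub>m k) $$ (i, j)) / 2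
              - (path_mat s 0 N ^\<^sub>m k) $$ (i, j)) = of_real (x i) * of_real (x j) * (of_real s ^ k * u i j k)"
          using path_walks_flip[of i N k j]
          by (cases "i = 0 \<or> j = 0") (auto simp: x_def path_mat_pow u_def algebra_simps)
      qed
      also have "\<dots> = (\<Sum>i\<in>{1..n}. \<Sum>j<N. of_real (x i) * of_real (x j) * (of_real s ^ k * u i j k))"
        by (rule sum.mono_neutral_right) (auto simp: N_def x_def)
      also have "\<dots> = ?R"
        by (intro sum.cong refl sum.mono_neutral_right) (auto simp: N_def x_def)
      finally show ?thesis .
    qed
    have term_sums: "(\<lambda>k. q k * (of_real (x i) * of_real (x j) * (of_real s ^ k * u i j k)))
        sums (of_real (\<nu> i) * of_real (\<nu> j) * f i j (of_real s))"
      if ij: "i \<in> {1..n}" "j \<in> {1..n}" for i j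
    proof -
      let ?g = "\<lambda>k. q k * (of_real (x i) * of_real (x j) * (of_real s ^ k * u i j k))"
      have z: "?g k = 0" if "k < i + j" for k
        using path_walks_through_0[of i N j k] ij that by (simp add: u_def N_def)
      have "?g (l + (i + j)) = of_real (\<nu> i) * of_real (\<nu> j) * (b i j l * of_real s ^ l)" for l
        using s ij by (simp add: x_def b_def power_add field_simps)
      moreover have "(\<lambda>l. of_real (\<nu> i) * of_real (\<nu> j) * (b i j l * of_real s ^ l))
          sums (of_real (\<nu> i) * of_real (\<nu> j) * f i j (of_real s))"
        by (intro sums_mult fs) (use s in simp)
      ultimately have "(\<lambda>l. ?g (l + (i + j))) sums (of_real (\<nu> i) * of_real (\<nu> j) * f i j (of_real s))"
        by simp
      then show ?thesis using sums_zero_iff_shift[of "i + j" ?g] z by blast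
    qed
    have "(\<lambda>k. \<Sum>i\<in>{1..n}. \<Sum>j\<in>{1..n}. q k * (of_real (x i) * of_real (x j) * (of_real s ^ k * u i j k))) sums G (of_real s)"
      unfolding G_def by (intro sums_sum term_sums)
    with r(2) have "G (of_real s) = of_real r"
      unfolding eq sum_distrib_left by (rule sums_unique2[symmetric])
    then show ?thesis using r(1) by blast
  qed
  have ev': "\<forall>\<^sub>F s in at_right 0. \<exists>r\<ge>0. G (of_real s) = of_real r"
    unfolding eventually_at_right_field
    using ev \<delta> t(1) by (intro exI[of _ "min \<delta> (t / 4)"]) auto
  have "\<forall>\<^sub>F s in at_right 0. 0 \<le> Re (G (of_real s))"
    using ev' by eventually_elim (metis Re_complex_of_real)
  then have "0 \<le> Re ?H"
    by (rule tendsto_lowerbound[OF tendsto_Re[OF lim] _ trivial_limit_at_right_real])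
  moreover have "\<forall>\<^sub>F s in at_right 0. Im (G (of_real s)) = 0"
    using ev' by eventually_elim (metis Im_complex_of_real)
  then have "((\<lambda>s. Im (G (of_real s))) \<longlongrightarrow> 0) (at_right 0)"
    by (rule tendsto_eventually)
  then have "Im ?H = 0"
    by (rule tendsto_unique[OF trivial_limit_at_right_real tendsto_Im[OF lim]])
  ultimately show ?thesis by blast
qed

section \<open>Matrices and positive semidefinite square roots\<close>

lemma mult_mat_entry:
  assumes "A \<in> carrier_mat a b" "B \<in> carrier_mat b c" "i < a" "j < c"
  shows "(A * B) $$ (i, j) = (\<Sum>k<b. A $$ (i, k) * B $$ (k, j))"
  using assms by (simp add: scalar_prod_def lessThan_atLeast0)

lemma mult_vec_entry:
  assumes "A \<in> carrier_mat a b" "v \<in> carrier_vec b" "i < a"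
  shows "(A *\<^sub>v v) $ i = (\<Sum>k<b. A $$ (i, k) * v $ k)"
  using assms by (simp add: scalar_prod_def lessThan_atLeast0)

lemma mat_adjoint_carrier [simp, intro]: "A \<in> carrier_mat a b \<Longrightarrow> mat_adjoint A \<in> carrier_mat b a"
  unfolding mat_adjoint_def by (auto simp: mat_of_rows_def)

lemma mat_adjoint_dim [simp]: "dim_row (mat_adjoint A) = dim_col A" "dim_col (mat_adjoint A) = dim_row A"
  unfolding mat_adjoint_def by (auto simp: mat_of_rows_def)

lemma mat_adjoint_entry:
  "i < dim_col A \<Longrightarrow> j < dim_row A \<Longrightarrow> mat_adjoint A $$ (i, j) = cnj ((A :: complex mat) $$ (j, i))"
  unfolding mat_adjoint_def by (simp add: mat_of_rows_def)

lemma mat_adjoint_adjoint [simp]: "mat_adjoint (mat_adjoint A) = (A :: complex mat)"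
  by (rule eq_matI) (auto simp: mat_adjoint_entry)

lemma mat_adjoint_mult:
  fixes A B :: "complex mat"
  assumes "A \<in> carrier_mat a b" "B \<in> carrier_mat b c"
  shows "mat_adjoint (A * B) = mat_adjoint B * mat_adjoint A"
proof (rule eq_matI)
  fix i j assume "i < dim_row (mat_adjoint B * mat_adjoint A)" "j < dim_col (mat_adjoint B * mat_adjoint A)"
  then have ij: "i < c" "j < a" using assms by auto
  have "mat_adjoint (A * B) $$ (i, j) = cnj (\<Sum>k<b. A $$ (j, k) * B $$ (k, i))"
    using ij assms by (simp add: mat_adjoint_entry mult_mat_entry[OF assms ij(2,1)] del: index_mult_mat(1))
  also have "\<dots> = (\<Sum>k<b. mat_adjoint B $$ (i, k) * mat_adjoint A $$ (k, j))"
    using ij assms by (simp add: mat_adjoint_entry mult.commute)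
  also have "\<dots> = (mat_adjoint B * mat_adjoint A) $$ (i, j)"
    by (rule mult_mat_entry[symmetric]) (use assms ij in auto)
  finally show "mat_adjoint (A * B) $$ (i, j) = (mat_adjoint B * mat_adjoint A) $$ (i, j)" .
qed (use assms in auto)

lemma quadratic_form_sum:
  assumes "A \<in> carrier_mat n n" "v \<in> carrier_vec n"
  shows "(A *\<^sub>v v) \<bullet>c v = (\<Sum>i<n. \<Sum>j<n. cnj (v $ i) * A $$ (i, j) * v $ j)"
proof -
  have "(A *\<^sub>v v) \<bullet>c v = (\<Sum>i<n. (A *\<^sub>v v) $ i * cnj (v $ i))"
    using assms by (simp add: scalar_prod_def lessThan_atLeast0 del: index_mult_mat_vec)
  also have "\<dots> = (\<Sum>i<n. \<Sum>j<n. cnj (v $ i) * A $$ (i, j) * v $ j)"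
    by (intro sum.cong refl)
       (simp add: mult_vec_entry[OF assms] sum_distrib_left sum_distrib_right mult_ac del: index_mult_mat_vec)
  finally show ?thesis .
qed

lemma adjoint_inner:
  fixes A :: "complex mat"
  assumes "A \<in> carrier_mat a b" "x \<in> carrier_vec a" "y \<in> carrier_vec b"
  shows "(mat_adjoint A *\<^sub>v x) \<bullet>c y = x \<bullet>c (A *\<^sub>v y)"
proof -
  have "(mat_adjoint A *\<^sub>v x) \<bullet>c y = (\<Sum>i<b. (mat_adjoint A *\<^sub>v x) $ i * cnj (y $ i))"
    using assms by (simp add: scalar_prod_def lessThan_atLeast0 del: index_mult_mat_vec)
  also have "\<dots> = (\<Sum>i<b. \<Sum>k<a. cnj (A $$ (k, i)) * x $ k * cnj (y $ i))"
    using assms mult_vec_entry[OF mat_adjoint_carrier[OF assms(1)] assms(2)]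
    by (intro sum.cong refl) (simp add: sum_distrib_right mat_adjoint_entry del: index_mult_mat_vec)
  also have "\<dots> = (\<Sum>k<a. \<Sum>i<b. cnj (A $$ (k, i)) * x $ k * cnj (y $ i))"
    by (rule sum.swap)
  also have "\<dots> = (\<Sum>k<a. x $ k * cnj ((A *\<^sub>v y) $ k))"
    by (intro sum.cong refl)
      (simp add: mult_vec_entry[OF assms(1,3)] sum_distrib_left mult_ac del: index_mult_mat_vec)
  also have "\<dots> = x \<bullet>c (A *\<^sub>v y)"
    using assms by (simp add: scalar_prod_def lessThan_atLeast0 del: index_mult_mat_vec)
  finally show ?thesis .
qed

text \<open>\<open>U\<close> is an arbitrary rectangular matrix: besides unitary changes of basis
  this covers \<open>M * mat_adjoint M\<close>, which is the identity conjugated by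
  \<open>mat_adjoint M\<close>.\<close>

lemma psd_conj_mat:
  assumes "psd n M" "U \<in> carrier_mat n m"
  shows "psd m (conj_mat U M)"
  unfolding psd_def
proof (intro conjI ballI)
  have M: "M \<in> carrier_mat n n" "mat_adjoint M = M" using assms by (auto simp: psd_def)
  have adU: "mat_adjoint U \<in> carrier_mat m n" using assms(2) by simp
  have MU: "M * U \<in> carrier_mat n m" using M assms(2) by simp
  have eq: "conj_mat U M = mat_adjoint U * (M * U)"
    unfolding conj_mat_def using assoc_mult_mat[OF adU M(1) assms(2)] .
  show "conj_mat U M \<in> carrier_mat m m" unfolding eq using adU MU by simp
  show "mat_adjoint (conj_mat U M) = conj_mat U M"
    unfolding eq mat_adjoint_mult[OF adU MU] mat_adjoint_mult[OF M(1) assms(2)] M(2)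
    using assoc_mult_mat[OF adU M(1) assms(2)] by simp
  fix v :: "complex Matrix.vec" assume v: "v \<in> carrier_vec m"
  have Uv: "U *\<^sub>v v \<in> carrier_vec n" using assms(2) v by simp
  have "conj_mat U M *\<^sub>v v = mat_adjoint U *\<^sub>v (M *\<^sub>v (U *\<^sub>v v))"
    unfolding eq using assoc_mult_mat_vec[OF adU MU v] assoc_mult_mat_vec[OF M(1) assms(2) v] by simp
  then have "(conj_mat U M *\<^sub>v v) \<bullet>c v = (M *\<^sub>v (U *\<^sub>v v)) \<bullet>c (U *\<^sub>v v)"
    using adjoint_inner[OF assms(2) _ v, of "M *\<^sub>v (U *\<^sub>v v)"] M Uv by simp
  then show "0 \<le> Re ((conj_mat U M *\<^sub>v v) \<bullet>c v)"
    using assms(1) Uv by (simp add: psd_def)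
qed

text \<open>\<open>gram_schmidt\<close> keeps \<open>v\<close> as its first vector but returns
  orthogonal vectors that are not normalised, so each column is divided by its length. This is why
  the first column is only a multiple of \<open>v\<close>.\<close>

lemma unitary_first_column:
  assumes v: "v \<in> carrier_vec n" "v \<noteq> 0\<^sub>v n" and n: "n > 0"
  obtains W c where "unitary_mat n W" "col W 0 = c \<cdot>\<^sub>v v"
proof -
  interpret cof_vec_space n "TYPE(complex)" .
  define ws where "ws = gram_schmidt n (basis_completion v)"
  note b = basis_completion[OF v]
  note g = gram_schmidt_result[OF b(2,4,5) ws_def]
  have len: "length ws = n" using g(4) b(6) by simp
  obtain vs where vs: "basis_completion v = v # vs"
    using b(6,7) n by (cases "basis_completion v") auto
  have hd: "ws ! 0 = v"
  proof -
    have "hd ws = v" unfolding ws_def vs by (rule gram_schmidt_hd[OF v(1)])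
    then show ?thesis using len n by (cases ws) auto
  qed
  have wc: "ws ! i \<in> carrier_vec n" if "i < n" for i using g(3) len that by (auto simp: subset_iff)
  define r where "r i = sqrt (Re (ws ! i \<bullet>c ws ! i))" for i
  have sq: "ws ! i \<bullet>c ws ! i = of_real (r i) * of_real (r i) \<and> r i > 0" if i: "i < n" for i
  proof -
    have "ws ! i \<bullet>c ws ! i \<noteq> 0" using corthogonalD[OF g(2), of i i] i len by simp
    moreover have "ws ! i \<bullet>c ws ! i = (\<Sum>k<n. of_real ((cmod (ws ! i $ k))\<^sup>2))"
      using wc[OF i]
      by (simp add: scalar_prod_def lessThan_atLeast0 complex_norm_square[symmetric] del: of_real_power)
    then have 1: "ws ! i \<bullet>c ws ! i = of_real (\<Sum>k<n. (cmod (ws ! i $ k))\<^sup>2)" by simp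
    moreover have "(\<Sum>k<n. (cmod (ws ! i $ k))\<^sup>2) \<ge> 0" by (intro sum_nonneg) simp
    ultimately have "(\<Sum>k<n. (cmod (ws ! i $ k))\<^sup>2) > 0" by (metis less_le of_real_0)
    then show ?thesis unfolding r_def 1 Re_complex_of_real
      by (simp flip: of_real_mult)
  qed
  define W where "W = mat n n (\<lambda>(i, j). ws ! j $ i / of_real (r j))"
  have W: "W \<in> carrier_mat n n" by (simp add: W_def)
  have "mat_adjoint W * W = 1\<^sub>m n"
  proof (rule eq_matI)
    fix i j assume "i < dim_row (1\<^sub>m n)" "j < dim_col (1\<^sub>m n)"
    then have ij: "i < n" "j < n" by auto
    have "(mat_adjoint W * W) $$ (i, j) = (\<Sum>k<n. cnj (ws ! i $ k / of_real (r i)) * (ws ! j $ k / of_real (r j)))"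
      using mult_mat_entry[OF mat_adjoint_carrier[OF W] W ij] ij W
      by (simp add: mat_adjoint_entry del: index_mult_mat(1)) (simp add: W_def)
    also have "\<dots> = (ws ! j \<bullet>c ws ! i) / (of_real (r i) * of_real (r j))"
      using wc[OF ij(1)] wc[OF ij(2)]
      by (simp add: scalar_prod_def lessThan_atLeast0 sum_divide_distrib mult.commute)
    also have "\<dots> = (1\<^sub>m n) $$ (i, j)"
      using corthogonalD[OF g(2), of j i] sq[OF ij(1)] ij len by auto
    finally show "(mat_adjoint W * W) $$ (i, j) = (1\<^sub>m n) $$ (i, j)" .
  qed (use W in auto)
  moreover from this have "W * mat_adjoint W = 1\<^sub>m n"
    by (rule mat_mult_left_right_inverse[OF mat_adjoint_carrier[OF W] W])
  ultimately have "unitary_mat n W" using W by (simp add: unitary_mat_def)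
  moreover have "col W 0 = (1 / of_real (r 0)) \<cdot>\<^sub>v v"
    by (rule eq_vecI) (use n v(1) hd in \<open>auto simp: W_def\<close>)
  ultimately show ?thesis by (rule that)
qed

text \<open>Needed because \<open>psd_sqrt\<close>, and with it \<open>tuple_norm\<close>, is
  defined by a choice that means nothing until a root exists. The induction splits off one
  eigenvector: in a unitary basis that starts with it, \<open>S\<close> is an eigenvalue e \<ge> 0
  plus a smaller positive semidefinite block.\<close>

lemma psd_sqrt_exists: "psd n S \<Longrightarrow> \<exists>B. psd n B \<and> B * B = S"
proof (induction n arbitrary: S)
  case 0
  then have "S * S = S" by (intro eq_matI) (auto simp: psd_def)
  then show ?case using 0 by blast
next
  case (Suc n)
  let ?n = "Suc n"
  have S: "S \<in> carrier_mat ?n ?n" "mat_adjoint S = S" using Suc.prems by (auto simp: psd_def)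
  obtain e where "eigenvalue S e" using spectrum_non_empty[OF S(1)] by (auto simp: spectrum_def)
  then obtain v where v: "v \<in> carrier_vec ?n" "v \<noteq> 0\<^sub>v ?n" "S *\<^sub>v v = e \<cdot>\<^sub>v v"
    using S by (auto simp: eigenvalue_def eigenvector_def)
  obtain W c where W: "unitary_mat ?n W" "col W 0 = c \<cdot>\<^sub>v v"
    using unitary_first_column[OF v(1,2)] by auto
  have Wc: "W \<in> carrier_mat ?n ?n" "mat_adjoint W \<in> carrier_mat ?n ?n"
    and WW: "mat_adjoint W * W = 1\<^sub>m ?n" "W * mat_adjoint W = 1\<^sub>m ?n"
    using W(1) by (auto simp: unitary_mat_def)
  define A where "A = conj_mat W S"
  have pA: "psd ?n A" unfolding A_def by (rule psd_conj_mat[OF Suc.prems Wc(1)])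
  then have A: "A \<in> carrier_mat ?n ?n" "mat_adjoint A = A" by (auto simp: psd_def)
  have A0: "A $$ (i, 0) = (if i = 0 then e else 0)" if i: "i < ?n" for i
  proof -
    have "col (S * W) 0 = S *\<^sub>v col W 0" by (rule col_mult2[OF S(1) Wc(1)]) simp
    also have "\<dots> = e \<cdot>\<^sub>v col W 0" unfolding W(2) using S v
      by (simp add: mult_mat_vec smult_smult_assoc mult.commute)
    finally have c: "col (S * W) 0 = e \<cdot>\<^sub>v col W 0" .
    have "A = mat_adjoint W * (S * W)" unfolding A_def conj_mat_def
      using assoc_mult_mat[OF Wc(2) S(1) Wc(1)] .
    then have "A $$ (i, 0) = row (mat_adjoint W) i \<bullet> col (S * W) 0"
      using i Wc S by simp
    also have "\<dots> = e * (row (mat_adjoint W) i \<bullet> col W 0)"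
      unfolding c using Wc by (intro scalar_prod_smult_distrib[of _ ?n] carrier_vecI) auto
    also have "row (mat_adjoint W) i \<bullet> col W 0 = (mat_adjoint W * W) $$ (i, 0)"
      using i Wc by simp
    finally show ?thesis unfolding WW using i by simp
  qed
  \<comment> \<open>The eigenvector clears the first column; Hermitian symmetry clears the first
    row.\<close>
  have A0': "A $$ (0, i) = (if i = 0 then e else 0)" if i: "i < ?n" for i
    using mat_adjoint_entry[of 0 A i] A0[of i] A0[of 0] A i by (cases "i = 0") auto
  have qA: "0 \<le> Re (\<Sum>i<?n. \<Sum>j<?n. cnj (v $ i) * A $$ (i, j) * v $ j)" if "v \<in> carrier_vec ?n" for v
    using pA that unfolding psd_def quadratic_form_sum[OF A(1) that, symmetric] by blast
  have e: "Im e = 0" "Re e \<ge> 0"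
  proof -
    have "cnj e = e" using mat_adjoint_entry[of 0 A 0] A A0[of 0] by simp
    then show "Im e = 0" by (simp add: complex_eq_iff)
    have "(\<Sum>i<?n. \<Sum>j<?n. cnj (vec ?n (\<lambda>i. if i = 0 then 1 else 0) $ i) * A $$ (i, j)
        * vec ?n (\<lambda>i. if i = 0 then 1 else 0) $ j) = e"
      using A0[of 0]
      by (simp add: sum.lessThan_Suc_shift del: sum.lessThan_Suc)
    then show "Re e \<ge> 0" using qA[of "vec ?n (\<lambda>i. if i = 0 then 1 else 0)"] by simp
  qed
  define S' where "S' = mat n n (\<lambda>(i, j). A $$ (Suc i, Suc j))"
  have S'c: "S' \<in> carrier_mat n n" by (simp add: S'_def)
  have "psd n S'"
    unfolding psd_def
  proof (intro conjI ballI S'c)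
    show "mat_adjoint S' = S'"
    proof (rule eq_matI)
      fix i j assume "i < dim_row S'" "j < dim_col S'"
      then have ij: "i < n" "j < n" by (auto simp: S'_def)
      have "A $$ (Suc i, Suc j) = cnj (A $$ (Suc j, Suc i))"
        using mat_adjoint_entry[of "Suc i" A "Suc j"] A ij by simp
      then show "mat_adjoint S' $$ (i, j) = S' $$ (i, j)" using ij
        by (simp add: mat_adjoint_entry S'c[THEN carrier_matD(1)] S'c[THEN carrier_matD(2)]) (simp add: S'_def)
    qed (auto simp: S'_def)
    fix v :: "complex vec" assume v: "v \<in> carrier_vec n"
    have "(S' *\<^sub>v v) \<bullet>c v = (\<Sum>i<n. \<Sum>j<n. cnj (v $ i) * A $$ (Suc i, Suc j) * v $ j)"
      unfolding quadratic_form_sum[OF S'c v] by (simp add: S'_def)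
    then show "0 \<le> Re ((S' *\<^sub>v v) \<bullet>c v)"
      using qA[of "vec ?n (\<lambda>i. if i = 0 then 0 else v $ (i - 1))"]
      by (simp add: sum.lessThan_Suc_shift del: sum.lessThan_Suc)
  qed
  from Suc.IH[OF this] obtain B' where B': "psd n B'" "B' * B' = S'" by blast
  have B'c: "B' \<in> carrier_mat n n" "mat_adjoint B' = B'" using B' by (auto simp: psd_def)
  define C where "C = mat ?n ?n (\<lambda>(i, j). if i = 0 then (if j = 0 then complex_of_real (sqrt (Re e)) else 0)
      else if j = 0 then 0 else B' $$ (i - 1, j - 1))"
  have Cc: "C \<in> carrier_mat ?n ?n" by (simp add: C_def)
  have CC: "C * C = A"
  proof (rule eq_matI)
    fix i j assume "i < dim_row A" "j < dim_col A"
    then have ij: "i < ?n" "j < ?n" using A by auto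
    have m: "(C * C) $$ (i, j) = (\<Sum>k<?n. C $$ (i, k) * C $$ (k, j))"
      by (rule mult_mat_entry[OF Cc Cc ij])
    show "(C * C) $$ (i, j) = A $$ (i, j)"
    proof (cases i)
      case 0
      have "complex_of_real (sqrt (Re e)) * complex_of_real (sqrt (Re e)) = e"
        using e by (simp add: complex_eq_iff flip: of_real_mult)
      then show ?thesis unfolding m using 0 ij A0'[of j] by (simp add: C_def sum.lessThan_Suc_shift del: sum.lessThan_Suc)
    next
      case i': (Suc i')
      show ?thesis
      proof (cases j)
        case 0
        then show ?thesis unfolding m using i' ij A0[of i] by (simp add: C_def sum.lessThan_Suc_shift del: sum.lessThan_Suc)
      next
        case (Suc j')
        have "(C * C) $$ (i, j) = (\<Sum>k<n. B' $$ (i', k) * B' $$ (k, j'))"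
          unfolding m using i' Suc ij by (simp add: C_def sum.lessThan_Suc_shift del: sum.lessThan_Suc)
        also have "\<dots> = (B' * B') $$ (i', j')"
          by (rule mult_mat_entry[symmetric]) (use B'c i' Suc ij in auto)
        finally show ?thesis unfolding B'(2) using i' Suc ij by (simp add: S'_def)
      qed
    qed
  qed (use A Cc in auto)
  have "psd ?n C"
    unfolding psd_def
  proof (intro conjI ballI Cc)
    show "mat_adjoint C = C"
    proof (rule eq_matI)
      fix i j assume "i < dim_row C" "j < dim_col C"
      then have ij: "i < ?n" "j < ?n" by (auto simp: C_def)
      have "B' $$ (i - 1, j - 1) = cnj (B' $$ (j - 1, i - 1))" if "i > 0" "j > 0"
        using mat_adjoint_entry[of "i - 1" B' "j - 1"] B'c ij that by simp
      then show "mat_adjoint C $$ (i, j) = C $$ (i, j)" using ij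
        by (simp add: mat_adjoint_entry Cc[THEN carrier_matD(1)] Cc[THEN carrier_matD(2)]) (simp add: C_def)
    qed (auto simp: C_def)
    fix v :: "complex vec" assume v: "v \<in> carrier_vec ?n"
    have w: "vec n (\<lambda>i. v $ Suc i) \<in> carrier_vec n" by simp
    have "(C *\<^sub>v v) \<bullet>c v = cnj (v $ 0) * of_real (sqrt (Re e)) * v $ 0
        + (\<Sum>i<n. \<Sum>j<n. cnj (v $ Suc i) * B' $$ (i, j) * v $ Suc j)"
      unfolding quadratic_form_sum[OF Cc v] by (simp add: C_def sum.lessThan_Suc_shift del: sum.lessThan_Suc)
    also have "(\<Sum>i<n. \<Sum>j<n. cnj (v $ Suc i) * B' $$ (i, j) * v $ Suc j)
        = (B' *\<^sub>v vec n (\<lambda>i. v $ Suc i)) \<bullet>c vec n (\<lambda>i. v $ Suc i)"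
      unfolding quadratic_form_sum[OF B'c(1) w] by simp
    also have "cnj (v $ 0) * of_real (sqrt (Re e)) * v $ 0 = of_real (sqrt (Re e) * (cmod (v $ 0))\<^sup>2)"
      by (simp only: of_real_mult complex_norm_square mult_ac)
    finally show "0 \<le> Re ((C *\<^sub>v v) \<bullet>c v)"
      using B'(1) w e(2) by (simp add: psd_def)
  qed
  define B where "B = conj_mat (mat_adjoint W) C"
  have "psd ?n B" unfolding B_def by (rule psd_conj_mat[OF \<open>psd ?n C\<close> Wc(2)])
  moreover have "B * B = S"
  proof -
    let ?W = "mat_adjoint W"
    have a: "X * Y * Z = X * (Y * Z)" if "X \<in> carrier_mat ?n ?n" "Y \<in> carrier_mat ?n ?n" "Z \<in> carrier_mat ?n ?n"
      for X Y Z :: "complex mat" using assoc_mult_mat[OF that] .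
    have m: "X * Y \<in> carrier_mat ?n ?n" if "X \<in> carrier_mat ?n ?n" "Y \<in> carrier_mat ?n ?n"
      for X Y :: "complex mat" using mult_carrier_mat[OF that] .
    have "B * B = W * (C * (?W * W) * C) * ?W"
      unfolding B_def conj_mat_def using Wc Cc by (simp add: a m)
    also have "C * (?W * W) * C = ?W * S * W"
      unfolding WW using Cc CC by (simp add: A_def conj_mat_def)
    also have "W * (?W * S * W) * ?W = (W * ?W) * S * (W * ?W)"
      using Wc S by (simp add: a m)
    finally show ?thesis unfolding WW using S by simp
  qed
  ultimately show ?case by blast
qed

section \<open>The norm of a tuple estimated by its entries\<close>

lemma psd_mult_adjoint:
  assumes "M \<in> carrier_mat n n"
  shows "psd n (M * mat_adjoint M)"
proof -
  have one: "psd n (1\<^sub>m n)"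
    unfolding psd_def
  proof (intro conjI ballI)
    show "mat_adjoint (1\<^sub>m n) = (1\<^sub>m n :: complex mat)" by (rule eq_matI) (auto simp: mat_adjoint_entry)
    fix v :: "complex Matrix.vec" assume v: "v \<in> carrier_vec n"
    have "v \<bullet>c v = (\<Sum>k<n. complex_of_real ((cmod (v $ k))\<^sup>2))"
      using v by (simp add: scalar_prod_def lessThan_atLeast0 complex_norm_square[symmetric] del: of_real_power)
    then have "v \<bullet>c v = of_real (\<Sum>k<n. (cmod (v $ k))\<^sup>2)" by simp
    moreover have "(\<Sum>k<n. (cmod (v $ k))\<^sup>2) \<ge> 0" by (intro sum_nonneg) simp
    ultimately show "0 \<le> Re ((1\<^sub>m n *\<^sub>v v) \<bullet>c v)" using v by (simp del: of_real_sum)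
  qed simp
  from psd_conj_mat[OF this mat_adjoint_carrier[OF assms]] show ?thesis
    using assms by (simp add: conj_mat_def)
qed

lemma psd_zero: "psd n (0\<^sub>m n n)"
  unfolding psd_def
proof (intro conjI ballI)
  show "mat_adjoint (0\<^sub>m n n) = (0\<^sub>m n n :: complex mat)" by (rule eq_matI) (auto simp: mat_adjoint_entry)
  fix v :: "complex Matrix.vec" assume v: "v \<in> carrier_vec n"
  show "0 \<le> Re ((0\<^sub>m n n *\<^sub>v v) \<bullet>c v)"
    by (simp add: quadratic_form_sum[OF zero_carrier_mat v])
qed simp

lemma psd_add:
  assumes "psd n A" "psd n B"
  shows "psd n (A + B)"
  unfolding psd_def
proof (intro conjI ballI)
  have A: "A \<in> carrier_mat n n" "mat_adjoint A = A" and B: "B \<in> carrier_mat n n" "mat_adjoint B = B"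
    using assms by (auto simp: psd_def)
  show "A + B \<in> carrier_mat n n" using A B by simp
  show "mat_adjoint (A + B) = A + B"
  proof (rule eq_matI)
    fix i j assume "i < dim_row (A + B)" "j < dim_col (A + B)"
    then show "mat_adjoint (A + B) $$ (i, j) = (A + B) $$ (i, j)"
      using A B mat_adjoint_entry[of i A j] mat_adjoint_entry[of i B j] by (simp add: mat_adjoint_entry)
  qed (use A B in auto)
  fix v :: "complex Matrix.vec" assume v: "v \<in> carrier_vec n"
  have "((A + B) *\<^sub>v v) \<bullet>c v = (A *\<^sub>v v) \<bullet>c v + (B *\<^sub>v v) \<bullet>c v"
    using A B v by (simp add: add_mult_distrib_mat_vec[of _ n n] add_scalar_prod_distrib[of _ n])
  then show "0 \<le> Re (((A + B) *\<^sub>v v) \<bullet>c v)" using assms v by (simp add: psd_def)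
qed

lemma gram_sum:
  assumes "\<And>M. M \<in> set X \<Longrightarrow> M \<in> carrier_mat n n"
    and "\<And>M i j. M \<in> set X \<Longrightarrow> i < n \<Longrightarrow> j < n \<Longrightarrow> cmod (M $$ (i, j)) \<le> \<delta>"
  defines "S \<equiv> foldr (\<lambda>M S. M * mat_adjoint M + S) X (0\<^sub>m n n)"
  shows "psd n S \<and> (\<forall>i<n. \<forall>j<n. cmod (S $$ (i, j)) \<le> of_nat (length X) * (of_nat n * \<delta>\<^sup>2))"
  using assms(1,2) unfolding S_def
proof (induction X)
  case Nil
  then show ?case by (auto simp: psd_zero)
next
  case (Cons M X)
  let ?S = "foldr (\<lambda>M S. M * mat_adjoint M + S) X (0\<^sub>m n n)"
  have IH: "psd n ?S" "\<And>i j. i < n \<Longrightarrow> j < n \<Longrightarrow> cmod (?S $$ (i, j)) \<le> of_nat (length X) * (of_nat n * \<delta>\<^sup>2)"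
    using Cons by auto
  have M: "M \<in> carrier_mat n n" "mat_adjoint M \<in> carrier_mat n n" using Cons.prems(1)[of M] by auto
  have S: "?S \<in> carrier_mat n n" using IH(1) by (simp add: psd_def)
  have "cmod ((M * mat_adjoint M + ?S) $$ (i, j)) \<le> of_nat (Suc (length X)) * (of_nat n * \<delta>\<^sup>2)"
    if ij: "i < n" "j < n" for i j
  proof -
    have "cmod ((M * mat_adjoint M) $$ (i, j)) \<le> (\<Sum>k<n. cmod (M $$ (i, k) * mat_adjoint M $$ (k, j)))"
      unfolding mult_mat_entry[OF M ij] by (rule norm_sum)
    also have "\<dots> \<le> (\<Sum>k<n. \<delta> * \<delta>)"
    proof (rule sum_mono)
      fix k assume "k \<in> {..<n}"
      then have k: "k < n" by simp
      have "0 \<le> \<delta>" using Cons.prems(2)[of M i k] k ij by (auto intro: order_trans[OF norm_ge_zero])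
      then show "cmod (M $$ (i, k) * mat_adjoint M $$ (k, j)) \<le> \<delta> * \<delta>"
        using Cons.prems(2)[of M i k] Cons.prems(2)[of M j k] k ij M
        by (auto simp: norm_mult mat_adjoint_entry intro!: mult_mono)
    qed
    finally have 1: "cmod ((M * mat_adjoint M) $$ (i, j)) \<le> of_nat n * \<delta>\<^sup>2" by (simp add: power2_eq_square)
    have "(M * mat_adjoint M + ?S) $$ (i, j) = (M * mat_adjoint M) $$ (i, j) + ?S $$ (i, j)"
      using S ij by (intro index_add_mat) auto
    then show ?thesis using 1 IH(2)[OF ij] norm_triangle_ineq[of "(M * mat_adjoint M) $$ (i, j)" "?S $$ (i, j)"]
      by (simp add: algebra_simps)
  qed
  then show ?case using psd_add[OF psd_mult_adjoint[OF M(1)] IH(1)] by simp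
qed

text \<open>r^2 is an eigenvalue of \<open>S\<close>. Reading the eigenvector equation at a
  coordinate of largest modulus bounds it by a sum of moduli along one row of
  \<open>S\<close>.\<close>

lemma eigenvalue_square_bound:
  fixes B :: "complex mat"
  assumes B: "B \<in> carrier_mat n n" "B * B = S" and S: "\<And>i j. i < n \<Longrightarrow> j < n \<Longrightarrow> cmod (S $$ (i, j)) \<le> b"
    and ev: "eigenvalue B (of_real r)"
  shows "r\<^sup>2 \<le> of_nat n * b"
proof -
  obtain v where v: "v \<in> carrier_vec n" "v \<noteq> 0\<^sub>v n" "B *\<^sub>v v = of_real r \<cdot>\<^sub>v v"
    using ev B by (auto simp: eigenvalue_def eigenvector_def)
  have Sc: "S \<in> carrier_mat n n" using B by auto
  have "S *\<^sub>v v = B *\<^sub>v (B *\<^sub>v v)" unfolding B(2)[symmetric] by (rule assoc_mult_mat_vec[OF B(1) B(1) v(1)])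
  also have "\<dots> = of_real (r * r) \<cdot>\<^sub>v v"
    unfolding v(3) using B v by (simp add: mult_mat_vec smult_smult_assoc)
  finally have Sv: "S *\<^sub>v v = of_real (r * r) \<cdot>\<^sub>v v" .
  have "\<exists>i<n. v $ i \<noteq> 0"
  proof (rule ccontr)
    assume "\<not> ?thesis"
    then have "v = 0\<^sub>v n" using v(1) by (intro eq_vecI) auto
    then show False using v(2) by simp
  qed
  then obtain i0 where i0: "i0 < n" "v $ i0 \<noteq> 0" by blast
  define m where "m = Max ((\<lambda>i. cmod (v $ i)) ` {..<n})"
  have m: "cmod (v $ i) \<le> m" if "i < n" for i unfolding m_def using that by (intro Max_ge) auto
  have mpos: "m > 0" using m[OF i0(1)] i0(2) by (meson less_le_trans zero_less_norm_iff)
  have "m \<in> (\<lambda>i. cmod (v $ i)) ` {..<n}" unfolding m_def using i0 by (intro Max_in) auto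
  then obtain i where i: "i < n" "cmod (v $ i) = m" by auto
  have "r * r * m = cmod ((S *\<^sub>v v) $ i)"
    unfolding Sv using i v by (simp add: norm_mult)
  also have "\<dots> \<le> (\<Sum>k<n. cmod (S $$ (i, k) * v $ k))"
    unfolding mult_vec_entry[OF Sc v(1) i(1)] by (rule norm_sum)
  also have "\<dots> \<le> (\<Sum>k<n. b * m)"
  proof (rule sum_mono)
    fix k assume "k \<in> {..<n}"
    then have k: "k < n" by simp
    have "0 \<le> b" using S[OF i(1) k] norm_ge_zero order_trans by blast
    then show "cmod (S $$ (i, k) * v $ k) \<le> b * m"
      unfolding norm_mult using S[OF i(1) k] m[OF k] by (intro mult_mono) auto
  qed
  finally have "r * r * m \<le> of_nat n * b * m" by simp
  then show ?thesis using mpos by (simp add: power2_eq_square)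
qed

text \<open>\<open>tuple_norm\<close> takes a maximum over real eigenvalues; this shows that the set
  is nonempty, so that \<open>Max\<close> has its intended meaning.\<close>

lemma psd_eigenvalue_real:
  assumes "psd n B" "eigenvalue B e"
  shows "Im e = 0"
proof -
  have B: "B \<in> carrier_mat n n" "mat_adjoint B = B" using assms by (auto simp: psd_def)
  obtain v where v: "v \<in> carrier_vec n" "v \<noteq> 0\<^sub>v n" "B *\<^sub>v v = e \<cdot>\<^sub>v v"
    using assms(2) B by (auto simp: eigenvalue_def eigenvector_def)
  have "(B *\<^sub>v v) \<bullet>c v = v \<bullet>c (B *\<^sub>v v)"
    using adjoint_inner[OF B(1) v(1) v(1)] B(2) by simp
  then have "e * (v \<bullet>c v) = cnj e * (v \<bullet>c v)"
    unfolding v(3) using v(1) by (simp add: conjugate_smult_vec)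
  moreover have "v \<bullet>c v \<noteq> 0" using v by simp
  ultimately have "e = cnj e" by simp
  then show ?thesis by (simp add: complex_eq_iff)
qed

text \<open>The only information about the norm that the proof uses: small entries make it small. A
  crude constant is enough, since the size \<open>n\<close> is fixed before the entries are scaled
  down.\<close>

lemma tuple_norm_bound:
  assumes n: "n > 0" and X: "X \<in> tuples g n"
    and \<delta>: "\<And>M i j. M \<in> set X \<Longrightarrow> i < n \<Longrightarrow> j < n \<Longrightarrow> cmod (M $$ (i, j)) \<le> \<delta>"
  shows "(tuple_norm n X)\<^sup>2 \<le> of_nat g * (of_nat n)\<^sup>2 * \<delta>\<^sup>2"
proof -
  let ?S = "foldr (\<lambda>M S. M * mat_adjoint M + S) X (0\<^sub>m n n)"
  have g: "length X = g" using X by (simp add: tuples_def)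
  have S: "psd n ?S" "\<And>i j. i < n \<Longrightarrow> j < n \<Longrightarrow> cmod (?S $$ (i, j)) \<le> of_nat g * (of_nat n * \<delta>\<^sup>2)"
    using gram_sum[of X n \<delta>] X \<delta> unfolding g by (auto simp: tuples_def)
  define B where "B = psd_sqrt n ?S"
  have B: "psd n B" "B * B = ?S"
    using someI_ex[OF psd_sqrt_exists[OF S(1)]] unfolding B_def psd_sqrt_def by auto
  have Bc: "B \<in> carrier_mat n n" using B by (simp add: psd_def)
  let ?E = "{r :: real. eigenvalue B (complex_of_real r)}"
  have "of_real ` ?E \<subseteq> spectrum B" by (auto simp: spectrum_def)
  then have fin: "finite ?E"
    using card_finite_spectrum(1)[OF Bc] finite_imageD[of complex_of_real ?E]
    by (metis finite_subset inj_of_real inj_on_subset top_greatest)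
  obtain e where e: "eigenvalue B e" using spectrum_non_empty[OF Bc n] by (auto simp: spectrum_def)
  then have "e = of_real (Re e)" using psd_eigenvalue_real[OF B(1) e] by (simp add: complex_eq_iff)
  then have "?E \<noteq> {}" using e by (metis (mono_tags, lifting) empty_iff mem_Collect_eq)
  then have "Max ?E \<in> ?E" using fin by (rule Max_in[rotated])
  then have "eigenvalue B (of_real (tuple_norm n X))" unfolding tuple_norm_def B_def[symmetric] by simp
  from eigenvalue_square_bound[OF Bc B(2) S(2) this] show ?thesis
    by (simp add: power2_eq_square mult_ac)
qed

lemma small_entries_in_herm_ball:
  assumes n: "n > 0" and \<epsilon>: "\<epsilon> > 0"
  obtains \<delta> where "\<delta> > 0"
    "\<And>X. X \<in> herm_tuples g n \<Longrightarrow> (\<And>M i j. M \<in> set X \<Longrightarrow> i < n \<Longrightarrow> j < n \<Longrightarrow> cmod (M $$ (i, j)) \<le> \<delta>)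
      \<Longrightarrow> X \<in> herm_ball g n \<epsilon>"
proof
  \<comment> \<open>The bound on the squared norm becomes \<epsilon>^2 times g / (g + 1)^2. Taking
    \<open>Suc g\<close> in place of \<open>g\<close> makes the inequality strict and covers the
    empty tuple.\<close>
  define \<delta> where "\<delta> = \<epsilon> / (of_nat (Suc g) * of_nat n)"
  show "\<delta> > 0" using n \<epsilon> by (simp add: \<delta>_def)
  fix X assume X: "X \<in> herm_tuples g n"
    "\<And>M i j. M \<in> set X \<Longrightarrow> i < n \<Longrightarrow> j < n \<Longrightarrow> cmod (M $$ (i, j)) \<le> \<delta>"
  have "(tuple_norm n X)\<^sup>2 \<le> of_nat g * (of_nat n)\<^sup>2 * \<delta>\<^sup>2"
    by (rule tuple_norm_bound[OF n _ X(2)]) (use X(1) in \<open>auto simp: herm_tuples_def\<close>)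
  also have "\<dots> = of_nat g * (\<epsilon> / of_nat (Suc g))\<^sup>2"
    using n by (simp add: \<delta>_def power2_eq_square)
  also have "\<dots> < \<epsilon>\<^sup>2"
  proof -
    have "real g < (real (Suc g))\<^sup>2" by (simp add: power2_eq_square algebra_simps add_pos_nonneg)
    then have "real g * \<epsilon>\<^sup>2 < (real (Suc g))\<^sup>2 * \<epsilon>\<^sup>2" using \<epsilon> by simp
    then show ?thesis by (simp add: power_divide field_simps)
  qed
  finally have "tuple_norm n X < \<epsilon>" using \<epsilon> by (auto intro: power_less_imp_less_base)
  then show "X \<in> herm_ball g n \<epsilon>" using X(1) by (simp add: herm_ball_def)
qed

section \<open>Kronecker products and amplification\<close>

text \<open>All indices of Kronecker products and block matrices are handled in the form block
  number times block size plus position; this lemma splits sums over them, and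
  \<open>block_index_less\<close> and \<open>block_index_cases\<close> pass between the two
  forms.\<close>

lemma sum_lessThan_mult:
  "(\<Sum>k<a * b. f k) = (\<Sum>i<a. \<Sum>j<b. f (i * b + j :: nat))"
proof -
  have "(\<Sum>k<a * b. f k) = (\<Sum>i<a. sum f {i * b..<i * b + b})"
    by (rule sum.nat_group[symmetric])
  also have "\<dots> = (\<Sum>i<a. \<Sum>j<b. f (i * b + j))"
  proof (rule sum.cong[OF refl])
    fix i
    have "sum f {i * b..<i * b + b} = sum (f \<circ> (+) (i * b)) {0..<i * b + b - i * b}"
      by (rule sum.atLeastLessThan_shift_0)
    then show "sum f {i * b..<i * b + b} = (\<Sum>j<b. f (i * b + j))"
      by (simp only: lessThan_atLeast0 o_def add_diff_cancel_left')
  qed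
  finally show ?thesis .
qed

lemma block_index_less:
  fixes p r N n :: nat
  assumes "p < N" "r < n"
  shows "p * n + r < N * n"
proof -
  have "p * n + r < Suc p * n" using assms(2) by simp
  also have "\<dots> \<le> N * n" using assms(1) by (intro mult_le_mono1) simp
  finally show ?thesis .
qed

lemma block_index_cases:
  fixes k N n :: nat
  assumes "k < N * n"
  obtains p r where "k = p * n + r" "p < N" "r < n"
proof
  have "n > 0" using assms by (cases n) auto
  then show "k = (k div n) * n + k mod n" "k div n < N" "k mod n < n"
    using assms by (auto simp: less_mult_imp_div_less)
qed

lemma kron_dim [simp]: "dim_row (kron A B) = dim_row A * dim_row B" "dim_col (kron A B) = dim_col A * dim_col B"
  by (simp_all add: kron_def)

lemma kron_carrier [intro]:
  "A \<in> carrier_mat a b \<Longrightarrow> B \<in> carrier_mat c d \<Longrightarrow> kron A B \<in> carrier_mat (a * c) (b * d)"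
  by (auto simp: kron_def)

lemma kron_entry:
  assumes "A \<in> carrier_mat a b" "B \<in> carrier_mat c d" "p < a" "q < b" "r < c" "s < d"
  shows "kron A B $$ (p * c + r, q * d + s) = A $$ (p, q) * B $$ (r, s)"
  using assms block_index_less[of p a r c] block_index_less[of q b s d]
  by (auto simp: kron_def)

lemma kron_eqI:
  assumes "M \<in> carrier_mat (a * c) (b * d)" "M' \<in> carrier_mat (a * c) (b * d)"
    and "\<And>p q r s. p < a \<Longrightarrow> q < b \<Longrightarrow> r < c \<Longrightarrow> s < d \<Longrightarrow>
      M $$ (p * c + r, q * d + s) = M' $$ (p * c + r, q * d + s)"
  shows "M = M'"
proof (rule eq_matI)
  fix i j assume "i < dim_row M'" "j < dim_col M'"
  then have "i < a * c" "j < b * d" using assms(2) by auto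
  then show "M $$ (i, j) = M' $$ (i, j)"
    using assms(3) by (auto elim!: block_index_cases)
qed (use assms in auto)

lemma kron_mult:
  assumes A: "A \<in> carrier_mat a b" "C \<in> carrier_mat b c"
    and B: "B \<in> carrier_mat a' b'" "D \<in> carrier_mat b' c'"
  shows "kron A B * kron C D = kron (A * C) (B * D)"
proof (rule kron_eqI[of _ a a' c c'])
  fix p q r s assume i: "p < a" "q < c" "r < a'" "s < c'"
  have AC: "A * C \<in> carrier_mat a c" and BD: "B * D \<in> carrier_mat a' c'" using A B by auto
  have "(kron A B * kron C D) $$ (p * a' + r, q * c' + s) =
      (\<Sum>k<b * b'. kron A B $$ (p * a' + r, k) * kron C D $$ (k, q * c' + s))"
    by (rule mult_mat_entry[OF kron_carrier[OF A(1) B(1)] kron_carrier[OF A(2) B(2)]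
          block_index_less[OF i(1,3)] block_index_less[OF i(2,4)]])
  also have "\<dots> = (\<Sum>k<b. \<Sum>l<b'. (A $$ (p, k) * C $$ (k, q)) * (B $$ (r, l) * D $$ (l, s)))"
    unfolding sum_lessThan_mult
  proof (intro sum.cong refl)
    fix k l assume "k \<in> {..<b}" "l \<in> {..<b'}"
    then have kl: "k < b" "l < b'" by auto
    show "kron A B $$ (p * a' + r, k * b' + l) * kron C D $$ (k * b' + l, q * c' + s) =
        (A $$ (p, k) * C $$ (k, q)) * (B $$ (r, l) * D $$ (l, s))"
      unfolding kron_entry[OF A(1) B(1) i(1) kl(1) i(3) kl(2)] kron_entry[OF A(2) B(2) kl(1) i(2) kl(2) i(4)]
      by (simp only: mult_ac)
  qed
  also have "\<dots> = (\<Sum>k<b. A $$ (p, k) * C $$ (k, q)) * (\<Sum>l<b'. B $$ (r, l) * D $$ (l, s))"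
    by (rule sum_product[symmetric])
  also have "\<dots> = kron (A * C) (B * D) $$ (p * a' + r, q * c' + s)"
    unfolding kron_entry[OF AC BD i] mult_mat_entry[OF A i(1,2)] mult_mat_entry[OF B i(3,4)] ..
  finally show "(kron A B * kron C D) $$ (p * a' + r, q * c' + s) = kron (A * C) (B * D) $$ (p * a' + r, q * c' + s)" .
qed (use A B in \<open>auto intro!: carrier_matI\<close>)

lemma kron_one: "kron (1\<^sub>m a) (1\<^sub>m b) = 1\<^sub>m (a * b)"
proof (rule kron_eqI[of _ a b a b])
  fix p q r s assume i: "p < a" "q < a" "r < b" "s < b"
  have "p * b + r = q * b + s \<longleftrightarrow> p = q \<and> r = s"
  proof
    assume e: "p * b + r = q * b + s"
    from arg_cong[OF e, of "\<lambda>k. k div b"] arg_cong[OF e, of "\<lambda>k. k mod b"] i show "p = q \<and> r = s" by simp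
  qed simp
  then show "kron (1\<^sub>m a) (1\<^sub>m b) $$ (p * b + r, q * b + s) = 1\<^sub>m (a * b) $$ (p * b + r, q * b + s)"
    using i block_index_less[of p a r b] block_index_less[of q a s b]
    by (simp add: kron_entry[OF one_carrier_mat one_carrier_mat])
qed (auto intro!: carrier_matI)

lemma kron_adjoint: "mat_adjoint (kron A B) = kron (mat_adjoint A) (mat_adjoint B)"
proof (rule kron_eqI[of _ "dim_col A" "dim_col B" "dim_row A" "dim_row B"])
  fix p q r s assume i: "p < dim_col A" "q < dim_row A" "r < dim_col B" "s < dim_row B"
  have A: "A \<in> carrier_mat (dim_row A) (dim_col A)" and B: "B \<in> carrier_mat (dim_row B) (dim_col B)" by auto
  show "mat_adjoint (kron A B) $$ (p * dim_col B + r, q * dim_row B + s) =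
      kron (mat_adjoint A) (mat_adjoint B) $$ (p * dim_col B + r, q * dim_row B + s)"
    unfolding kron_entry[OF mat_adjoint_carrier[OF A] mat_adjoint_carrier[OF B] i]
    using i block_index_less[OF i(1,3)] block_index_less[OF i(2,4)]
    by (simp add: mat_adjoint_entry kron_entry[OF A B])
qed (auto intro!: carrier_matI)

lemma kron_assoc: "kron A (kron B C) = kron (kron A B) C"
proof (rule eq_matI)
  fix i j assume "i < dim_row (kron (kron A B) C)" "j < dim_col (kron (kron A B) C)"
  then obtain p q r p' q' r' where
    i: "i = (p * dim_row B + q) * dim_row C + r" "p < dim_row A" "q < dim_row B" "r < dim_row C" and
    j: "j = (p' * dim_col B + q') * dim_col C + r'" "p' < dim_col A" "q' < dim_col B" "r' < dim_col C"
    by (auto elim!: block_index_cases)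
  have A: "A \<in> carrier_mat (dim_row A) (dim_col A)" and B: "B \<in> carrier_mat (dim_row B) (dim_col B)"
    and C: "C \<in> carrier_mat (dim_row C) (dim_col C)" by auto
  have i': "i = p * (dim_row B * dim_row C) + (q * dim_row C + r)"
    and j': "j = p' * (dim_col B * dim_col C) + (q' * dim_col C + r')"
    unfolding i(1) j(1) by (simp_all add: algebra_simps)
  have "kron A (kron B C) $$ (i, j) = A $$ (p, p') * (B $$ (q, q') * C $$ (r, r'))"
    unfolding i' j'
    using kron_entry[OF A kron_carrier[OF B C] i(2) j(2) block_index_less[OF i(3,4)] block_index_less[OF j(3,4)]]
      kron_entry[OF B C i(3) j(3) i(4) j(4)] by simp
  also have "\<dots> = kron (kron A B) C $$ (i, j)"
    unfolding i(1) j(1)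
    using kron_entry[OF kron_carrier[OF A B] C block_index_less[OF i(2,3)] block_index_less[OF j(2,3)] i(4) j(4)]
      kron_entry[OF A B i(2) j(2) i(3) j(3)] by simp
  finally show "kron A (kron B C) $$ (i, j) = kron (kron A B) C $$ (i, j)" .
qed (auto simp: mult_ac)

lemma kron_one_unitary:
  assumes "unitary_mat n U"
  shows "unitary_mat (N * n) (kron (1\<^sub>m N) U)"
proof -
  have U: "U \<in> carrier_mat n n" "mat_adjoint U * U = 1\<^sub>m n" "U * mat_adjoint U = 1\<^sub>m n"
    using assms by (auto simp: unitary_mat_def)
  have I: "mat_adjoint (1\<^sub>m N :: complex mat) = 1\<^sub>m N" by (rule eq_matI) (auto simp: mat_adjoint_entry)
  show ?thesis unfolding unitary_mat_def kron_adjoint I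
    using U kron_mult[OF one_carrier_mat[of N] one_carrier_mat[of N] mat_adjoint_carrier[OF U(1)] U(1)]
      kron_mult[OF one_carrier_mat[of N] one_carrier_mat[of N] U(1) mat_adjoint_carrier[OF U(1)]]
    by (auto simp: kron_one)
qed

text \<open>Two nested identities merge by associativity:
  \<open>kron (1\<^sub>m N) (kron (1\<^sub>m m) M)\<close> is
  \<open>kron (1\<^sub>m (N * m)) M\<close>. Hence repeating \<alpha> does not leave C_A, and a
  matrix of any size \<open>N\<close> can be attached to X while \<alpha> is merely copied.\<close>

lemma C_set_ampliation:
  assumes \<alpha>: "\<alpha> \<in> C_set \<kappa> A m" and A: "A \<in> tuples gt \<kappa>"
  shows "map (kron (1\<^sub>m N)) \<alpha> \<in> C_set \<kappa> A (N * m)"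
proof -
  obtain U where U: "unitary_mat (\<kappa> * m) U" "\<alpha> = conj_tuple U (map (kron (1\<^sub>m m)) A)"
    using \<alpha> by (auto simp: C_set_def)
  have Uc: "U \<in> carrier_mat (m * \<kappa>) (m * \<kappa>)" using U(1) by (simp add: unitary_mat_def mult.commute)
  have I: "mat_adjoint (1\<^sub>m N :: complex mat) = 1\<^sub>m N" by (rule eq_matI) (auto simp: mat_adjoint_entry)
  have "kron (1\<^sub>m N) (conj_mat U (kron (1\<^sub>m m) M)) = conj_mat (kron (1\<^sub>m N) U) (kron (1\<^sub>m (N * m)) M)"
    if "M \<in> set A" for M
  proof -
    have "M \<in> carrier_mat \<kappa> \<kappa>" using A that by (simp add: tuples_def)
    then have K: "kron (1\<^sub>m m) M \<in> carrier_mat (m * \<kappa>) (m * \<kappa>)" by auto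
    have UK: "mat_adjoint U * kron (1\<^sub>m m) M \<in> carrier_mat (m * \<kappa>) (m * \<kappa>)"
      by (rule mult_carrier_mat[OF mat_adjoint_carrier[OF Uc] K])
    note one = one_carrier_mat[of N]
    have "conj_mat (kron (1\<^sub>m N) U) (kron (1\<^sub>m (N * m)) M)
        = kron (1\<^sub>m N) (mat_adjoint U) * kron (1\<^sub>m N) (kron (1\<^sub>m m) M) * kron (1\<^sub>m N) U"
      unfolding conj_mat_def kron_adjoint I kron_assoc kron_one ..
    also have "\<dots> = kron (1\<^sub>m N) (mat_adjoint U * kron (1\<^sub>m m) M * U)"
      unfolding kron_mult[OF one one mat_adjoint_carrier[OF Uc] K] kron_mult[OF mult_carrier_mat[OF one one] one UK Uc]
      by simp
    finally show ?thesis by (simp add: conj_mat_def)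
  qed
  then have "map (kron (1\<^sub>m N)) \<alpha> = conj_tuple (kron (1\<^sub>m N) U) (map (kron (1\<^sub>m (N * m))) A)"
    unfolding U(2) conj_tuple_def by simp
  moreover have "unitary_mat (\<kappa> * (N * m)) (kron (1\<^sub>m N) U)"
    using kron_one_unitary[OF U(1), of N] by (simp add: mult_ac)
  ultimately show ?thesis unfolding C_set_def by blast
qed

lemma C_set_tuples:
  assumes "\<alpha> \<in> C_set \<kappa> A m" "A \<in> tuples gt \<kappa>"
  shows "\<alpha> \<in> tuples gt (\<kappa> * m)"
proof -
  obtain U where U: "unitary_mat (\<kappa> * m) U" "\<alpha> = conj_tuple U (map (kron (1\<^sub>m m)) A)"
    using assms(1) by (auto simp: C_set_def)
  have "conj_mat U (kron (1\<^sub>m m) M) \<in> carrier_mat (\<kappa> * m) (\<kappa> * m)" if "M \<in> set A" for M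
    using U(1) unfolding conj_mat_def unitary_mat_def by auto
  then show ?thesis using U(2) assms(2) by (auto simp: tuples_def conj_tuple_def)
qed

text \<open>Powers of matrices grow on the right by definition, whereas word evaluation adds letters
  on the left.\<close>

lemma pow_mat_commute:
  assumes "T \<in> carrier_mat N N"
  shows "T * T ^\<^sub>m k = T ^\<^sub>m k * (T :: complex mat)"
proof (induction k)
  case (Suc k)
  have P: "T ^\<^sub>m k \<in> carrier_mat N N" using assms by simp
  have "T * (T ^\<^sub>m k * T) = (T * T ^\<^sub>m k) * T" by (rule assoc_mult_mat[symmetric, OF assms P assms])
  then show ?case using Suc by simp
qed (use assms in simp)

section \<open>Evaluation of nc polynomials at amplified pairs\<close>

definition letters :: "nat \<Rightarrow> nat \<Rightarrow> (nat + nat) set" where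
  "letters gt g = Inl ` {..<gt} \<union> Inr ` {..<g}"

lemma nc_word_eval_Nil [simp]: "nc_word_eval n a x [] = 1\<^sub>m n"
  by (simp add: nc_word_eval_def)

lemma nc_word_eval_Cons [simp]:
  "nc_word_eval n a x (v # w) = (case v of Inl i \<Rightarrow> a ! i | Inr i \<Rightarrow> x ! i) * nc_word_eval n a x w"
  by (simp add: nc_word_eval_def)

lemma nc_word_eval_carrier:
  assumes "a \<in> tuples gt n" "x \<in> tuples g n" "set w \<subseteq> letters gt g"
  shows "nc_word_eval n a x w \<in> carrier_mat n n"
  using assms(3)
proof (induction w)
  case (Cons v w)
  have "(case v of Inl i \<Rightarrow> a ! i | Inr i \<Rightarrow> x ! i) \<in> carrier_mat n n"
    using Cons.prems assms(1,2) by (auto simp: tuples_def letters_def)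
  then show ?case using Cons by (auto intro: mult_carrier_mat)
qed simp

text \<open>By the mixed product rule a letter of \<open>a\<close> contributes 1 to the left factor
  and a letter of \<open>x\<close> contributes \<open>T\<close>. The left factor thus sees how many
  letters of \<open>x\<close> occur but not where they stand.\<close>

lemma nc_word_eval_kron:
  assumes a: "a \<in> tuples gt n" and x: "x \<in> tuples g n" and T: "T \<in> carrier_mat N N"
    and "set w \<subseteq> letters gt g"
  shows "nc_word_eval (N * n) (map (kron (1\<^sub>m N)) a) (map (kron T) x) w =
    kron (T ^\<^sub>m length (filter (\<lambda>v. \<not> isl v) w)) (nc_word_eval n a x w)"
  using assms(4)
proof (induction w)
  case Nil
  then show ?case using T by (simp add: kron_one)
next
  case (Cons v w)
  let ?k = "length (filter (\<lambda>v. \<not> isl v) w)"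
  have P: "T ^\<^sub>m ?k \<in> carrier_mat N N" using T by simp
  have W: "nc_word_eval n a x w \<in> carrier_mat n n" using nc_word_eval_carrier[OF a x] Cons.prems by simp
  show ?case
  proof (cases v)
    case (Inl i)
    then have i: "i < gt" using Cons.prems by (auto simp: letters_def)
    then have ai: "a ! i \<in> carrier_mat n n" "i < length a" using a by (auto simp: tuples_def)
    show ?thesis using Inl Cons ai kron_mult[OF one_carrier_mat P ai(1) W] left_mult_one_mat[OF P] by simp
  next
    case (Inr i)
    then have i: "i < g" using Cons.prems by (auto simp: letters_def)
    then have xi: "x ! i \<in> carrier_mat n n" "i < length x" using x by (auto simp: tuples_def)
    show ?thesis using Inr Cons xi P kron_mult[OF T P xi(1) W] pow_mat_commute[OF T] by simp
  qed
qed

text \<open>Homogeneity gives all words the same power of \<open>T\<close>, so the value is the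
  Kronecker product of \<open>T ^\<^sub>m k\<close> with the value at (a, x). Through this identity
  the nc series turns into a scalar series evaluated at \<open>T\<close>.\<close>

lemma nc_poly_eval_kron:
  assumes a: "a \<in> tuples gt n" and x: "x \<in> tuples g n" and T: "T \<in> carrier_mat N N"
    and P: "nc_poly_vars gt g P" "x_homogeneous k P" and i: "p < N" "q < N" "r < n" "s < n"
  shows "nc_poly_eval (N * n) (map (kron (1\<^sub>m N)) a) (map (kron T) x) P $$ (p * n + r, q * n + s)
    = (T ^\<^sub>m k) $$ (p, q) * nc_poly_eval n a x P $$ (r, s)"
proof -
  have Tk: "T ^\<^sub>m k \<in> carrier_mat N N" using T by simp
  have "nc_poly_eval (N * n) (map (kron (1\<^sub>m N)) a) (map (kron T) x) P $$ (p * n + r, q * n + s)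
      = (\<Sum>w\<in>Poly_Mapping.keys P. Poly_Mapping.lookup P w *
          nc_word_eval (N * n) (map (kron (1\<^sub>m N)) a) (map (kron T) x) w $$ (p * n + r, q * n + s))"
    using block_index_less[OF i(1,3)] block_index_less[OF i(2,4)] by (simp add: nc_poly_eval_def)
  also have "\<dots> = (\<Sum>w\<in>Poly_Mapping.keys P. Poly_Mapping.lookup P w * ((T ^\<^sub>m k) $$ (p, q) * nc_word_eval n a x w $$ (r, s)))"
  proof (intro sum.cong refl)
    fix w assume w: "w \<in> Poly_Mapping.keys P"
    have l: "set w \<subseteq> letters gt g" using P(1) w by (auto simp: nc_poly_vars_def letters_def)
    have k: "length (filter (\<lambda>v. \<not> isl v) w) = k" using P(2) w by (auto simp: x_homogeneous_def)
    show "Poly_Mapping.lookup P w * nc_word_eval (N * n) (map (kron (1\<^sub>m N)) a) (map (kron T) x) w $$ (p * n + r, q * n + s)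
        = Poly_Mapping.lookup P w * ((T ^\<^sub>m k) $$ (p, q) * nc_word_eval n a x w $$ (r, s))"
      unfolding nc_word_eval_kron[OF a x T l] k
      using kron_entry[OF Tk nc_word_eval_carrier[OF a x l] i(1,2,3,4)] by simp
  qed
  also have "\<dots> = (T ^\<^sub>m k) $$ (p, q) * nc_poly_eval n a x P $$ (r, s)"
    using i by (simp add: nc_poly_eval_def sum_distrib_left mult_ac)
  finally show ?thesis .
qed

section \<open>Restriction to lines\<close>

definition scale_tuple :: "complex \<Rightarrow> mtuple \<Rightarrow> mtuple" where
  "scale_tuple z X = map (\<lambda>M. z \<cdot>\<^sub>m M) X"

lemma scale_tuple_1 [simp]: "scale_tuple 1 X = X"
  unfolding scale_tuple_def by (intro map_idI eq_matI) auto

lemma scale_tuple_tuples: "X \<in> tuples g n \<Longrightarrow> scale_tuple z X \<in> tuples g n"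
  by (auto simp: tuples_def scale_tuple_def)

lemma scale_tuple_herm:
  assumes "X \<in> herm_tuples g n"
  shows "scale_tuple (of_real t) X \<in> herm_tuples g n"
proof -
  have "mat_adjoint (of_real t \<cdot>\<^sub>m M) = of_real t \<cdot>\<^sub>m M" if "mat_adjoint M = M" for M :: "complex mat"
  proof (rule eq_matI)
    fix i j assume "i < dim_row (of_real t \<cdot>\<^sub>m M)" "j < dim_col (of_real t \<cdot>\<^sub>m M)"
    moreover have "dim_row M = dim_col M" using arg_cong[OF that, of dim_row] by simp
    ultimately show "mat_adjoint (of_real t \<cdot>\<^sub>m M) $$ (i, j) = (of_real t \<cdot>\<^sub>m M) $$ (i, j)"
      using mat_adjoint_entry[of i M j] that by (simp add: mat_adjoint_entry)
  qed (use arg_cong[OF that, of dim_row] in auto)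
  then show ?thesis using assms scale_tuple_tuples
    by (auto simp: herm_tuples_def scale_tuple_def tuples_def)
qed

text \<open>Scaling \<open>x\<close> by \<open>z\<close> is the amplification by the 1 by 1 matrix
  with entry \<open>z\<close>.\<close>

lemma nc_poly_eval_scale:
  assumes a: "a \<in> tuples gt n" and x: "x \<in> tuples g n"
    and P: "nc_poly_vars gt g P" "x_homogeneous k P" and i: "r < n" "s < n"
  shows "nc_poly_eval n a (scale_tuple z x) P $$ (r, s) = z ^ k * nc_poly_eval n a x P $$ (r, s)"
proof -
  define T :: "complex mat" where "T = mat 1 1 (\<lambda>_. z)"
  have T: "T \<in> carrier_mat 1 1" by (simp add: T_def)
  have pow: "(T ^\<^sub>m k) $$ (0, 0) = z ^ k"
  proof (induction k)
    case (Suc k)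
    have "(T ^\<^sub>m k * T) $$ (0, 0) = (\<Sum>l<1. (T ^\<^sub>m k) $$ (0, l) * T $$ (l, 0))"
      by (rule mult_mat_entry[OF pow_carrier_mat[OF T] T]) auto
    then show ?case using Suc by (simp add: T_def)
  qed (simp add: T_def)
  have "kron (1\<^sub>m 1) M = M" for M
    by (rule eq_matI) (auto simp: kron_def)
  then have k1: "map (kron (1\<^sub>m 1)) a = a" by (simp add: map_idI)
  have "kron T M = z \<cdot>\<^sub>m M" for M
    by (rule eq_matI) (auto simp: kron_def T_def)
  then have k2: "map (kron T) x = scale_tuple z x" by (simp add: scale_tuple_def)
  show ?thesis
    using nc_poly_eval_kron[OF a x T P, of 0 0 r s] i by (simp add: k1[unfolded One_nat_def] k2 pow)
qed

lemma tuple_entries_bounded: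
  assumes "X \<in> tuples g n"
  obtains K where "K > 0" "\<And>M i j. M \<in> set X \<Longrightarrow> i < n \<Longrightarrow> j < n \<Longrightarrow> cmod (M $$ (i, j)) \<le> K"
proof
  define E where "E = (\<lambda>(M, i, j). cmod (M $$ (i, j))) ` (set X \<times> {..<n} \<times> {..<n})"
  have fin: "finite E" by (simp add: E_def)
  have "1 \<le> Max (insert 1 E)" by (rule Max_ge) (use fin in auto)
  then show "Max (insert 1 E) > 0" by linarith
  fix M i j assume "M \<in> set X" "i < n" "j < n"
  then have "cmod (M $$ (i, j)) \<in> E" by (force simp: E_def)
  then show "cmod (M $$ (i, j)) \<le> Max (insert 1 E)" using fin by simp
qed

lemma scale_tuple_herm_ball:
  assumes n: "n > 0" and \<epsilon>: "\<epsilon> > 0" and X: "X \<in> herm_tuples g n"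
  obtains \<rho> where "\<rho> > 0" "\<And>t. \<bar>t\<bar> < \<rho> \<Longrightarrow> scale_tuple (of_real t) X \<in> herm_ball g n \<epsilon>"
proof -
  have Xt: "X \<in> tuples g n" using X by (simp add: herm_tuples_def)
  obtain \<delta> where \<delta>: "\<delta> > 0"
    "\<And>X. X \<in> herm_tuples g n \<Longrightarrow> (\<And>M i j. M \<in> set X \<Longrightarrow> i < n \<Longrightarrow> j < n \<Longrightarrow> cmod (M $$ (i, j)) \<le> \<delta>)
      \<Longrightarrow> X \<in> herm_ball g n \<epsilon>"
    using small_entries_in_herm_ball[OF n \<epsilon>] by blast
  obtain K where K: "K > 0" "\<And>M i j. M \<in> set X \<Longrightarrow> i < n \<Longrightarrow> j < n \<Longrightarrow> cmod (M $$ (i, j)) \<le> K"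
    using tuple_entries_bounded[OF Xt] by blast
  show ?thesis
  proof (rule that[of "\<delta> / K"])
    show "\<delta> / K > 0" using \<delta> K by simp
    fix t :: real assume t: "\<bar>t\<bar> < \<delta> / K"
    show "scale_tuple (of_real t) X \<in> herm_ball g n \<epsilon>"
    proof (rule \<delta>(2)[OF scale_tuple_herm[OF X]])
      fix M i j assume M: "M \<in> set (scale_tuple (of_real t) X)" and ij: "i < n" "j < n"
      then obtain M' where M': "M' \<in> set X" "M = of_real t \<cdot>\<^sub>m M'" by (auto simp: scale_tuple_def)
      have "M' \<in> carrier_mat n n" using Xt M' by (simp add: tuples_def)
      then have "cmod (M $$ (i, j)) = \<bar>t\<bar> * cmod (M' $$ (i, j))"
        using M' ij by (simp add: norm_mult)
      also have "\<dots> \<le> \<delta> / K * K"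
        by (rule mult_mono) (use K M' ij t \<delta> in auto)
      finally show "cmod (M $$ (i, j)) \<le> \<delta>" using K by simp
    qed
  qed
qed

lemma herm_ball_mono: "\<epsilon> \<le> \<epsilon>' \<Longrightarrow> herm_ball g n \<epsilon> \<subseteq> herm_ball g n \<epsilon>'"
  by (auto simp: herm_ball_def)

text \<open>The continuation is composed with the linear map that sends z to z X. Real z give
  Hermitian tuples, so the preimage of \<open>\<Omega>\<close> contains the real axis.\<close>

lemma continuation_along_line:
  assumes cont: "continues g n \<epsilon> f \<alpha> \<Omega> G" and X: "X \<in> herm_tuples g n" and rc: "r < n" "c < n"
  shows "\<exists>S. open S \<and> range complex_of_real \<subseteq> S \<and> (\<lambda>z. G (scale_tuple z X) $$ (r, c)) holomorphic_on S"
proof (intro exI conjI)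
  define S where "S = {z. scale_tuple z X \<in> \<Omega>}"
  have Xt: "X \<in> tuples g n" and len: "length X = g" using X by (auto simp: herm_tuples_def tuples_def)
  have op: "\<And>Y. Y \<in> \<Omega> \<Longrightarrow> \<exists>\<delta>>0. \<forall>Z \<in> tuples g n. tuple_dist g n Y Z < \<delta> \<longrightarrow> Z \<in> \<Omega>"
    and herm: "herm_tuples g n \<subseteq> \<Omega>"
    and an: "analytic_tuples g n \<Omega> (\<lambda>X. G X $$ (r, c))"
    using cont rc by (auto simp: continues_def open_tuples_def)
  \<comment> \<open>\<open>K\<close> is the speed of the line with respect to
    \<open>tuple_dist\<close>. It is 0 for X = 0, so radii are divided by
    \<open>K + 1\<close>.\<close>
  define K where "K = (\<Sum>k<g. \<Sum>i<n. \<Sum>j<n. cmod ((X ! k) $$ (i, j)))"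
  have K: "K \<ge> 0" unfolding K_def by (intro sum_nonneg) simp
  have entry: "(scale_tuple z X ! k) $$ (i, j) = z * (X ! k) $$ (i, j)" if "k < g" "i < n" "j < n" for z k i j
  proof -
    have "X ! k \<in> carrier_mat n n" using Xt that by (auto simp: tuples_def)
    then show ?thesis using that len by (simp add: scale_tuple_def)
  qed
  have dist: "tuple_dist g n (scale_tuple z X) (scale_tuple w X) = cmod (w - z) * K" for z w
    unfolding tuple_dist_def K_def sum_distrib_left
    by (intro sum.cong refl) (simp add: entry flip: norm_mult left_diff_distrib)
  show oS: "open S"
    unfolding open_dist
  proof
    fix z assume "z \<in> S"
    then obtain \<delta> where \<delta>: "\<delta> > 0" "\<And>Z. Z \<in> tuples g n \<Longrightarrow> tuple_dist g n (scale_tuple z X) Z < \<delta> \<Longrightarrow> Z \<in> \<Omega>"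
      using op unfolding S_def by blast
    show "\<exists>e>0. \<forall>w. dist w z < e \<longrightarrow> w \<in> S"
    proof (intro exI[of _ "\<delta> / (K + 1)"] conjI allI impI)
      show "\<delta> / (K + 1) > 0" using \<delta> K by simp
      fix w assume "dist w z < \<delta> / (K + 1)"
      then have "cmod (w - z) * (K + 1) < \<delta>" using K by (simp add: dist_norm pos_less_divide_eq)
      then have "cmod (w - z) * K < \<delta>" by (smt (verit) norm_ge_zero distrib_left mult_cancel_left1)
      then show "w \<in> S" unfolding S_def using \<delta>(2)[OF scale_tuple_tuples[OF Xt]] dist by simp
    qed
  qed
  show "range complex_of_real \<subseteq> S" unfolding S_def using scale_tuple_herm[OF X] herm by auto
  show "(\<lambda>z. G (scale_tuple z X) $$ (r, c)) holomorphic_on S"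
    unfolding holomorphic_on_open[OF oS]
  proof
    fix z assume z: "z \<in> S"
    define h where "h w = G (scale_tuple w X) $$ (r, c)" for w
    obtain p where p: "\<And>e. e > 0 \<Longrightarrow> \<exists>\<delta>>0. \<forall>Y\<in>\<Omega>. tuple_dist g n (scale_tuple z X) Y < \<delta> \<longrightarrow>
        cmod (G Y $$ (r, c) - G (scale_tuple z X) $$ (r, c)
          - (\<Sum>k<g. \<Sum>i<n. \<Sum>j<n. p k i j * ((Y ! k) $$ (i, j) - (scale_tuple z X ! k) $$ (i, j))))
          \<le> e * tuple_dist g n (scale_tuple z X) Y"
      using an z unfolding analytic_tuples_def S_def by blast
    define L where "L = (\<Sum>k<g. \<Sum>i<n. \<Sum>j<n. p k i j * (X ! k) $$ (i, j))"
    have lin: "(\<Sum>k<g. \<Sum>i<n. \<Sum>j<n. p k i j * ((scale_tuple w X ! k) $$ (i, j) - (scale_tuple z X ! k) $$ (i, j)))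
        = L * (w - z)" for w
      unfolding L_def sum_distrib_right
      by (intro sum.cong refl) (simp add: entry algebra_simps)
    have "(h has_derivative (*) L) (at z)"
      unfolding has_derivative_at_alt
    proof (intro conjI allI impI bounded_linear_mult_right)
      fix e :: real assume e: "e > 0"
      then have "e / (K + 1) > 0" using K by simp
      from p[OF this] obtain \<delta> where \<delta>: "\<delta> > 0" "\<And>Y. Y \<in> \<Omega> \<Longrightarrow> tuple_dist g n (scale_tuple z X) Y < \<delta> \<Longrightarrow>
        cmod (G Y $$ (r, c) - G (scale_tuple z X) $$ (r, c)
          - (\<Sum>k<g. \<Sum>i<n. \<Sum>j<n. p k i j * ((Y ! k) $$ (i, j) - (scale_tuple z X ! k) $$ (i, j))))
          \<le> e / (K + 1) * tuple_dist g n (scale_tuple z X) Y" by blast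
      obtain d where d: "d > 0" "ball z d \<subseteq> S" using oS z open_contains_ball by blast
      show "\<exists>d>0. \<forall>w. norm (w - z) < d \<longrightarrow> norm (h w - h z - L * (w - z)) \<le> e * norm (w - z)"
      proof (intro exI[of _ "min d (\<delta> / (K + 1))"] conjI allI impI)
        show "min d (\<delta> / (K + 1)) > 0" using d \<delta> K by simp
        fix w assume w: "norm (w - z) < min d (\<delta> / (K + 1))"
        then have "w \<in> S" using d by (auto simp: dist_norm norm_minus_commute)
        then have wO: "scale_tuple w X \<in> \<Omega>" by (simp add: S_def)
        have "cmod (w - z) * (K + 1) < \<delta>" using w K by (simp add: pos_less_divide_eq)
        then have "cmod (w - z) * K < \<delta>" by (smt (verit) norm_ge_zero distrib_left mult_cancel_left1)
        then have "norm (h w - h z - L * (w - z)) \<le> e / (K + 1) * (cmod (w - z) * K)"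
          using \<delta>(2)[OF wO] unfolding dist lin h_def by blast
        also have "\<dots> = (e * cmod (w - z)) * (K / (K + 1))" by simp
        also have "\<dots> \<le> (e * cmod (w - z)) * 1" using K e by (intro mult_left_mono) auto
        finally show "norm (h w - h z - L * (w - z)) \<le> e * norm (w - z)" by simp
      qed
    qed
    then show "\<exists>f'. ((\<lambda>z. G (scale_tuple z X) $$ (r, c)) has_field_derivative f') (at z)"
      unfolding has_field_derivative_def h_def by blast
  qed
qed

text \<open>The radius of convergence and the radius of the continuation are kept apart:
  \<open>x_extension\<close> ranges over all continuations, each with a radius of its own.\<close>

lemma real_entire_coefficients:
  assumes n: "n > 0" and ser: "x_series gt g p" and \<alpha>: "\<alpha> \<in> tuples gt n" and X: "X \<in> herm_tuples g n"
    and \<epsilon>: "\<epsilon> > 0" "\<epsilon>' > 0"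
    and sums: "\<And>Y. Y \<in> herm_ball g n \<epsilon> \<Longrightarrow> mat_sums n (\<lambda>k. nc_poly_eval n \<alpha> Y (p k)) (f n \<alpha> Y)"
    and cont: "continues g n \<epsilon>' f \<alpha> \<Omega> G" and rc: "r < n" "c < n"
  shows "real_entire (\<lambda>k. nc_poly_eval n \<alpha> X (p k) $$ (r, c)) (\<lambda>z. G (scale_tuple z X) $$ (r, c))"
  unfolding real_entire_def
proof
  show "\<exists>S. open S \<and> range complex_of_real \<subseteq> S \<and> (\<lambda>z. G (scale_tuple z X) $$ (r, c)) holomorphic_on S"
    by (rule continuation_along_line[OF cont X rc])
  have Xt: "X \<in> tuples g n" using X by (simp add: herm_tuples_def)
  have "min \<epsilon> \<epsilon>' > 0" using \<epsilon> by simp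
  then obtain \<rho> where \<rho>: "\<rho> > 0" "\<And>t. \<bar>t\<bar> < \<rho> \<Longrightarrow> scale_tuple (of_real t) X \<in> herm_ball g n (min \<epsilon> \<epsilon>')"
    using scale_tuple_herm_ball[OF n _ X] by blast
  have "(\<lambda>k. nc_poly_eval n \<alpha> X (p k) $$ (r, c) * of_real t ^ k) sums (G (scale_tuple (of_real t) X) $$ (r, c))"
    if t: "\<bar>t\<bar> < \<rho>" for t
  proof -
    let ?Y = "scale_tuple (of_real t) X"
    have Y: "?Y \<in> herm_ball g n \<epsilon>" "?Y \<in> herm_ball g n \<epsilon>'"
      using \<rho>(2)[OF t] by (auto simp: herm_ball_def)
    have "G ?Y = f n \<alpha> ?Y" using cont Y(2) by (simp add: continues_def)
    moreover have "(\<lambda>k. nc_poly_eval n \<alpha> ?Y (p k) $$ (r, c)) sums (f n \<alpha> ?Y $$ (r, c))"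
      using sums[OF Y(1)] rc by (simp add: mat_sums_def)
    moreover have "nc_poly_eval n \<alpha> ?Y (p k) $$ (r, c) = nc_poly_eval n \<alpha> X (p k) $$ (r, c) * of_real t ^ k" for k
      using nc_poly_eval_scale[OF \<alpha> Xt _ _ rc, of "p k" k "of_real t"] ser by (simp add: x_series_def mult.commute)
    ultimately show ?thesis by simp
  qed
  then show "\<exists>\<rho>>0. \<forall>t. \<bar>t\<bar> < \<rho> \<longrightarrow>
      (\<lambda>k. nc_poly_eval n \<alpha> X (p k) $$ (r, c) * of_real t ^ k) sums (G (scale_tuple (of_real t) X) $$ (r, c))"
    using \<rho>(1) by blast
qed

text \<open>Complex polarization: two-entry vectors with entries 1, 1 and 1, \<i> make both the sum
  and the difference of \<open>Q i j\<close> and \<open>Q j i\<close> vanish, with no symmetry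
  assumed for \<open>Q\<close>.\<close>

lemma quadratic_form_zero:
  fixes Q :: "nat \<Rightarrow> nat \<Rightarrow> complex"
  assumes zero: "\<And>v. (\<Sum>i<m. \<Sum>j<m. cnj (v i) * Q i j * v j) = 0" and ij: "i < m" "j < m"
  shows "Q i j = 0"
proof -
  have two: "x * cnj x * Q a a + cnj x * y * Q a b + cnj y * x * Q b a + y * cnj y * Q b b = 0"
    if ab: "a < m" "b < m" "a \<noteq> b" for a b x y
  proof -
    define v where "v i = (if i = a then x else if i = b then y else 0)" for i
    have red: "(\<Sum>i<m. v i * h i) = x * h a + y * h b" "(\<Sum>i<m. cnj (v i) * h i) = cnj x * h a + cnj y * h b"
      for h :: "nat \<Rightarrow> complex"
    proof -
      have "(\<Sum>i<m. v i * h i) = (\<Sum>i\<in>{a, b}. v i * h i)" "(\<Sum>i<m. cnj (v i) * h i) = (\<Sum>i\<in>{a, b}. cnj (v i) * h i)"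
        by (rule sum.mono_neutral_right; use ab in \<open>auto simp: v_def\<close>)+
      then show "(\<Sum>i<m. v i * h i) = x * h a + y * h b" "(\<Sum>i<m. cnj (v i) * h i) = cnj x * h a + cnj y * h b"
        using ab by (simp_all add: v_def)
    qed
    have "0 = (\<Sum>i<m. cnj (v i) * (\<Sum>j<m. v j * Q i j))"
      using zero[of v] by (simp add: sum_distrib_left mult_ac)
    then show ?thesis unfolding red by (simp add: algebra_simps)
  qed
  show ?thesis
  proof (cases "i = j")
    case True
    define v where "v k = (if k = i then 1 else 0 :: complex)" for k
    have red: "(\<Sum>k<m. v k * h k) = h i" "(\<Sum>k<m. cnj (v k) * h k) = h i" for h :: "nat \<Rightarrow> complex"
    proof -
      have "(\<Sum>k<m. v k * h k) = (\<Sum>k\<in>{i}. v k * h k)" "(\<Sum>k<m. cnj (v k) * h k) = (\<Sum>k\<in>{i}. cnj (v k) * h k)"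
        by (rule sum.mono_neutral_right; use ij in \<open>auto simp: v_def\<close>)+
      then show "(\<Sum>k<m. v k * h k) = h i" "(\<Sum>k<m. cnj (v k) * h k) = h i" by (simp_all add: v_def)
    qed
    have "0 = (\<Sum>k<m. cnj (v k) * (\<Sum>l<m. v l * Q k l))"
      using zero[of v] by (simp add: sum_distrib_left mult_ac)
    then show ?thesis unfolding red using True by simp
  next
    case False
    have ii: "Q i i = 0" "Q j j = 0" using two[OF ij False, of 1 0] two[OF ij False, of 0 1] by simp_all
    have "Q i j + Q j i = 0" using two[OF ij False, of 1 1] ii by simp
    moreover have "\<i> * Q i j - \<i> * Q j i = 0" using two[OF ij False, of 1 \<i>] ii by simp
    ultimately show ?thesis by (simp add: add_eq_0_iff)
  qed
qed

section \<open>Quadratic forms of the coefficients\<close>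

lemma psd_form_real:
  assumes "psd n M" "v \<in> carrier_vec n"
  shows "Im ((M *\<^sub>v v) \<bullet>c v) = 0"
proof -
  have M: "M \<in> carrier_mat n n" "mat_adjoint M = M" using assms by (auto simp: psd_def)
  have sym: "cnj (M $$ (i, j)) = M $$ (j, i)" if "i < n" "j < n" for i j
    using mat_adjoint_entry[of j M i] M that by simp
  have "cnj (\<Sum>i<n. \<Sum>j<n. cnj (v $ i) * M $$ (i, j) * v $ j) = (\<Sum>i<n. \<Sum>j<n. cnj (v $ j) * M $$ (j, i) * v $ i)"
    by (simp add: sym mult_ac)
  also have "\<dots> = (\<Sum>i<n. \<Sum>j<n. cnj (v $ i) * M $$ (i, j) * v $ j)"
    by (rule sum.swap)
  finally have "cnj ((M *\<^sub>v v) \<bullet>c v) = (M *\<^sub>v v) \<bullet>c v"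
    unfolding quadratic_form_sum[OF M(1) assms(2)] .
  then show ?thesis by (simp add: complex_eq_iff)
qed

lemma block_mat_carrier: "M \<in> carrier_mat d d \<Longrightarrow> block_mat n M \<in> carrier_mat (d * n) (d * n)"
  by (auto simp: block_mat_def)

lemma block_mat_entry:
  assumes "M \<in> carrier_mat d d" "i < d" "j < d" "r < n" "c < n"
  shows "block_mat n M $$ (i * n + r, j * n + c) = M $$ (i, j) $$ (r, c)"
  using assms block_index_less[of i d r n] block_index_less[of j d c n] by (auto simp: block_mat_def)

lemma block_quadratic_form:
  assumes M: "M \<in> carrier_mat d d" and v: "v \<in> carrier_vec (d * n)"
  shows "(block_mat n M *\<^sub>v v) \<bullet>c v =
    (\<Sum>i<d. \<Sum>r<n. \<Sum>j<d. \<Sum>c<n. cnj (v $ (i * n + r)) * M $$ (i, j) $$ (r, c) * v $ (j * n + c))"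
  unfolding quadratic_form_sum[OF block_mat_carrier[OF M] v] sum_lessThan_mult
  by (intro sum.cong refl) (simp add: block_mat_entry[OF M])

lemma kron_midpoint:
  assumes T: "T \<in> carrier_mat N N" "T' \<in> carrier_mat N N" "M \<in> carrier_mat N N"
    and M: "\<And>i j. i < N \<Longrightarrow> j < N \<Longrightarrow> M $$ (i, j) = (T $$ (i, j) + T' $$ (i, j)) / 2"
    and X: "X \<in> tuples g n"
  shows "convex_comb (1/2) (map (kron T) X) (map (kron T') X) = map (kron M) X"
proof -
  have "complex_of_real (1/2) \<cdot>\<^sub>m kron T Y + complex_of_real (1 - 1/2) \<cdot>\<^sub>m kron T' Y = kron M Y"
    if "Y \<in> set X" for Y
  proof -
    have Y: "Y \<in> carrier_mat n n" using X that by (simp add: tuples_def)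
    show ?thesis
    proof (rule kron_eqI[of _ N n N n])
      fix p q r s assume i: "p < N" "q < N" "r < n" "s < n"
      have K: "kron T Y \<in> carrier_mat (N * n) (N * n)" "kron T' Y \<in> carrier_mat (N * n) (N * n)"
        using T Y by auto
      have "(complex_of_real (1/2) \<cdot>\<^sub>m kron T Y + complex_of_real (1 - 1/2) \<cdot>\<^sub>m kron T' Y) $$ (k, l)
          = kron T Y $$ (k, l) / 2 + kron T' Y $$ (k, l) / 2" if "k < N * n" "l < N * n" for k l
        using K that by (simp add: carrier_matD del: kron_dim)
      note this[OF block_index_less[OF i(1,3)] block_index_less[OF i(2,4)]]
      then show "(complex_of_real (1/2) \<cdot>\<^sub>m kron T Y + complex_of_real (1 - 1/2) \<cdot>\<^sub>m kron T' Y) $$ (p * n + r, q * n + s)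
          = kron M Y $$ (p * n + r, q * n + s)"
        unfolding kron_entry[OF T(1) Y i] kron_entry[OF T(2) Y i] kron_entry[OF T(3) Y i] M[OF i(1,2)]
        by (simp only: add_divide_distrib distrib_right times_divide_eq_left)
    qed (use T Y in \<open>auto intro!: carrier_matI\<close>)
  qed
  then show ?thesis unfolding convex_comb_def map2_map_map by (intro map_cong refl)
qed

lemma kron_herm_tuples:
  assumes T: "T \<in> carrier_mat N N" "\<And>i j. i < N \<Longrightarrow> j < N \<Longrightarrow> T $$ (j, i) = cnj (T $$ (i, j))"
    and X: "X \<in> herm_tuples g n"
  shows "map (kron T) X \<in> herm_tuples g (N * n)"
proof -
  have "mat_adjoint T = T"
  proof (rule eq_matI)
    fix i j assume "i < dim_row T" "j < dim_col T"
    then show "mat_adjoint T $$ (i, j) = T $$ (i, j)"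
      using T(1) T(2)[of j i] mat_adjoint_entry[of i T j] by simp
  qed (use T(1) in auto)
  then show ?thesis using X T(1)
    by (auto simp: herm_tuples_def tuples_def kron_adjoint)
qed

text \<open>\<open>\<delta>\<close> depends on \<open>N\<close> and on \<open>X\<close>, which is
  harmless: \<open>matrix_convex_series\<close> lets the radius shrink with the size.\<close>

lemma kron_herm_ball:
  assumes "N > 0" "n > 0" "\<epsilon> > 0" and X: "X \<in> herm_tuples g n"
  obtains \<delta> where "\<delta> > 0" "\<And>T. T \<in> carrier_mat N N \<Longrightarrow>
     (\<And>i j. i < N \<Longrightarrow> j < N \<Longrightarrow> T $$ (j, i) = cnj (T $$ (i, j)) \<and> cmod (T $$ (i, j)) < \<delta>) \<Longrightarrow>
     map (kron T) X \<in> herm_ball g (N * n) \<epsilon>"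
proof -
  have Xt: "X \<in> tuples g n" using X by (simp add: herm_tuples_def)
  have "N * n > 0" using assms by simp
  then obtain \<delta> where \<delta>: "\<delta> > 0"
    "\<And>X. X \<in> herm_tuples g (N * n) \<Longrightarrow> (\<And>M i j. M \<in> set X \<Longrightarrow> i < N * n \<Longrightarrow> j < N * n \<Longrightarrow> cmod (M $$ (i, j)) \<le> \<delta>)
      \<Longrightarrow> X \<in> herm_ball g (N * n) \<epsilon>"
    using small_entries_in_herm_ball[OF _ assms(3)] by blast
  obtain K where K: "K > 0" "\<And>M i j. M \<in> set X \<Longrightarrow> i < n \<Longrightarrow> j < n \<Longrightarrow> cmod (M $$ (i, j)) \<le> K"
    using tuple_entries_bounded[OF Xt] by blast
  show ?thesis
  proof (rule that[of "\<delta> / K"])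
    show "\<delta> / K > 0" using \<delta> K by simp
    fix T :: "complex mat" assume T: "T \<in> carrier_mat N N"
      and Ts: "\<And>i j. i < N \<Longrightarrow> j < N \<Longrightarrow> T $$ (j, i) = cnj (T $$ (i, j)) \<and> cmod (T $$ (i, j)) < \<delta> / K"
    show "map (kron T) X \<in> herm_ball g (N * n) \<epsilon>"
    proof (rule \<delta>(2))
      show "map (kron T) X \<in> herm_tuples g (N * n)"
        by (rule kron_herm_tuples[OF T _ X]) (use Ts in blast)
      fix M i j assume "M \<in> set (map (kron T) X)" and ij: "i < N * n" "j < N * n"
      then obtain Y where Y: "Y \<in> set X" "M = kron T Y" by auto
      have Yc: "Y \<in> carrier_mat n n" using Xt Y by (simp add: tuples_def)
      obtain p r q s where i: "i = p * n + r" "p < N" "r < n" and j: "j = q * n + s" "q < N" "s < n"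
        using ij by (auto elim!: block_index_cases)
      have "cmod (M $$ (i, j)) = cmod (T $$ (p, q)) * cmod (Y $$ (r, s))"
        unfolding Y(2) i(1) j(1) kron_entry[OF T Yc i(2) j(2) i(3) j(3)] by (rule norm_mult)
      also have "\<dots> \<le> \<delta> / K * K"
        by (rule mult_mono) (use Ts[OF i(2) j(2)] K Y i j \<delta> in auto)
      finally show "cmod (M $$ (i, j)) \<le> \<delta>" using K by simp
    qed
  qed
qed

text \<open>The d by d block structure of \<open>F\<close> is outermost, so the amplification index
  \<open>p\<close> stands between the block index \<open>i\<close> and the inner index
  \<open>r\<close>: \<open>V\<close> is \<open>v\<close> with \<open>x\<close> inserted as a middle
  tensor factor. At such a vector the form of each term splits into a coefficient that depends on
  \<open>v\<close> only and the form of \<open>T ^\<^sub>m k\<close> at \<open>x\<close>.\<close>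

lemma nc_quadratic_form_sums:
  fixes F :: "nc_fun mat"
  assumes F: "F \<in> carrier_mat d d" and ser: "\<And>i j. i < d \<Longrightarrow> j < d \<Longrightarrow> x_series gt g (\<lambda>k. P k $$ (i, j))"
    and Pc: "\<And>k. P k \<in> carrier_mat d d"
    and \<alpha>: "\<alpha> \<in> tuples gt n" and X: "X \<in> tuples g n" and T: "T \<in> carrier_mat N N"
    and sums: "\<And>i j. i < d \<Longrightarrow> j < d \<Longrightarrow>
      mat_sums (N * n) (\<lambda>k. nc_poly_eval (N * n) (map (kron (1\<^sub>m N)) \<alpha>) (map (kron T) X) (P k $$ (i, j)))
        ((F $$ (i, j)) (N * n) (map (kron (1\<^sub>m N)) \<alpha>) (map (kron T) X))"
    and v: "v \<in> carrier_vec (d * n)"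
    and V: "V \<in> carrier_vec (d * (N * n))"
      "\<And>i p r. i < d \<Longrightarrow> p < N \<Longrightarrow> r < n \<Longrightarrow> V $ (i * (N * n) + (p * n + r)) = of_real (x p) * v $ (i * n + r)"
  shows "(\<lambda>k. ((nc_mat_eval n \<alpha> X (P k) *\<^sub>v v) \<bullet>c v) *
      (\<Sum>p<N. \<Sum>q<N. of_real (x p) * of_real (x q) * (T ^\<^sub>m k) $$ (p, q)))
    sums ((nc_fun_eval (N * n) (map (kron (1\<^sub>m N)) \<alpha>) (map (kron T) X) F *\<^sub>v V) \<bullet>c V)"
proof -
  let ?a = "map (kron (1\<^sub>m N)) \<alpha>" and ?X = "map (kron T) X"
  let ?E = "\<lambda>k i j r s. nc_poly_eval n \<alpha> X (P k $$ (i, j)) $$ (r, s)"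
  have 1: "(\<lambda>k. \<Sum>i<d. \<Sum>p<N. \<Sum>r<n. \<Sum>j<d. \<Sum>q<N. \<Sum>s<n.
      cnj (V $ (i * (N * n) + (p * n + r))) *
      nc_poly_eval (N * n) ?a ?X (P k $$ (i, j)) $$ (p * n + r, q * n + s) * V $ (j * (N * n) + (q * n + s)))
    sums ((nc_fun_eval (N * n) ?a ?X F *\<^sub>v V) \<bullet>c V)"
  proof -
    have FM: "map_mat (\<lambda>f. f (N * n) ?a ?X) F \<in> carrier_mat d d" using F by simp
    let ?f = "\<lambda>i p r j q s. map_mat (\<lambda>f. f (N * n) ?a ?X) F $$ (i, j) $$ (p * n + r, q * n + s)"
    have entry: "(\<lambda>k. cnj (V $ (i * (N * n) + (p * n + r))) *
          nc_poly_eval (N * n) ?a ?X (P k $$ (i, j)) $$ (p * n + r, q * n + s) * V $ (j * (N * n) + (q * n + s)))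
        sums (cnj (V $ (i * (N * n) + (p * n + r))) * ?f i p r j q s * V $ (j * (N * n) + (q * n + s)))"
      if "i \<in> {..<d}" "p \<in> {..<N}" "r \<in> {..<n}" "j \<in> {..<d}" "q \<in> {..<N}" "s \<in> {..<n}" for i p r j q s
    proof -
      have i: "i < d" "p < N" "r < n" "j < d" "q < N" "s < n" using that by auto
      have "map_mat (\<lambda>f. f (N * n) ?a ?X) F $$ (i, j) = (F $$ (i, j)) (N * n) ?a ?X"
        using F i by simp
      then have "(\<lambda>k. nc_poly_eval (N * n) ?a ?X (P k $$ (i, j)) $$ (p * n + r, q * n + s)) sums ?f i p r j q s"
        using sums[OF i(1,4)] block_index_less[OF i(2,3)] block_index_less[OF i(5,6)]
        unfolding mat_sums_def by presburger
      then show ?thesis by (intro sums_mult sums_mult2)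
    qed
    have "(nc_fun_eval (N * n) ?a ?X F *\<^sub>v V) \<bullet>c V = (\<Sum>i<d. \<Sum>p<N. \<Sum>r<n. \<Sum>j<d. \<Sum>q<N. \<Sum>s<n.
        cnj (V $ (i * (N * n) + (p * n + r))) * ?f i p r j q s * V $ (j * (N * n) + (q * n + s)))"
      unfolding nc_fun_eval_def block_quadratic_form[OF FM V(1)] sum_lessThan_mult[of _ N n] ..
    then show ?thesis using entry by (simp only:) (rule sums_sum)+
  qed
  have 2: "(\<Sum>i<d. \<Sum>p<N. \<Sum>r<n. \<Sum>j<d. \<Sum>q<N. \<Sum>s<n.
      cnj (V $ (i * (N * n) + (p * n + r))) *
      nc_poly_eval (N * n) ?a ?X (P k $$ (i, j)) $$ (p * n + r, q * n + s) * V $ (j * (N * n) + (q * n + s)))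
    = ((nc_mat_eval n \<alpha> X (P k) *\<^sub>v v) \<bullet>c v) *
      (\<Sum>p<N. \<Sum>q<N. of_real (x p) * of_real (x q) * (T ^\<^sub>m k) $$ (p, q))" (is "?L = ?R") for k
  proof -
    let ?e = "\<lambda>i r j s. cnj (v $ (i * n + r)) * ?E k i j r s * v $ (j * n + s)"
    let ?t = "\<lambda>p q. of_real (x p) * of_real (x q) * (T ^\<^sub>m k) $$ (p, q)"
    have "?L = (\<Sum>i<d. \<Sum>p<N. \<Sum>r<n. \<Sum>j<d. \<Sum>q<N. \<Sum>s<n. ?e i r j s * ?t p q)"
    proof (intro sum.cong refl)
      fix i p r j q s assume "i \<in> {..<d}" "p \<in> {..<N}" "r \<in> {..<n}" "j \<in> {..<d}" "q \<in> {..<N}" "s \<in> {..<n}"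
      then have i: "i < d" "p < N" "r < n" "j < d" "q < N" "s < n" by auto
      have "nc_poly_vars gt g (P k $$ (i, j))" "x_homogeneous k (P k $$ (i, j))"
        using ser[OF i(1,4)] by (auto simp: x_series_def)
      from nc_poly_eval_kron[OF \<alpha> X T this i(2,5,3,6)]
      show "cnj (V $ (i * (N * n) + (p * n + r))) *
          nc_poly_eval (N * n) ?a ?X (P k $$ (i, j)) $$ (p * n + r, q * n + s) * V $ (j * (N * n) + (q * n + s))
          = ?e i r j s * ?t p q"
        unfolding V(2)[OF i(1,2,3)] V(2)[OF i(4,5,6)] by (simp only: complex_cnj_mult complex_cnj_complex_of_real mult_ac)
    qed
    \<comment> \<open>The amplification sums over \<open>p\<close> and \<open>q\<close> move
      innermost, after which the whole sum is a product.\<close>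
    also have "\<dots> = (\<Sum>i<d. \<Sum>r<n. \<Sum>j<d. \<Sum>s<n. \<Sum>p<N. \<Sum>q<N. ?e i r j s * ?t p q)"
    proof (rule sum.cong[OF refl])
      fix i
      have "(\<Sum>p<N. \<Sum>r<n. \<Sum>j<d. \<Sum>q<N. \<Sum>s<n. ?e i r j s * ?t p q)
          = (\<Sum>r<n. \<Sum>p<N. \<Sum>j<d. \<Sum>q<N. \<Sum>s<n. ?e i r j s * ?t p q)"
        by (rule sum.swap)
      also have "\<dots> = (\<Sum>r<n. \<Sum>j<d. \<Sum>p<N. \<Sum>q<N. \<Sum>s<n. ?e i r j s * ?t p q)"
        by (intro sum.cong refl sum.swap)
      also have "\<dots> = (\<Sum>r<n. \<Sum>j<d. \<Sum>p<N. \<Sum>s<n. \<Sum>q<N. ?e i r j s * ?t p q)"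
        by (rule sum.cong[OF refl], rule sum.cong[OF refl], rule sum.cong[OF refl], rule sum.swap)
      also have "\<dots> = (\<Sum>r<n. \<Sum>j<d. \<Sum>s<n. \<Sum>p<N. \<Sum>q<N. ?e i r j s * ?t p q)"
        by (rule sum.cong[OF refl], rule sum.cong[OF refl], rule sum.swap)
      finally show "(\<Sum>p<N. \<Sum>r<n. \<Sum>j<d. \<Sum>q<N. \<Sum>s<n. ?e i r j s * ?t p q)
          = (\<Sum>r<n. \<Sum>j<d. \<Sum>s<n. \<Sum>p<N. \<Sum>q<N. ?e i r j s * ?t p q)" .
    qed
    also have "\<dots> = (\<Sum>i<d. \<Sum>r<n. \<Sum>j<d. \<Sum>s<n. ?e i r j s) * (\<Sum>p<N. \<Sum>q<N. ?t p q)"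
      by (simp only: sum_distrib_right) (simp only: sum_distrib_left)
    also have "(\<Sum>i<d. \<Sum>r<n. \<Sum>j<d. \<Sum>s<n. ?e i r j s) = (nc_mat_eval n \<alpha> X (P k) *\<^sub>v v) \<bullet>c v"
    proof -
      have PM: "map_mat (nc_poly_eval n \<alpha> X) (P k) \<in> carrier_mat d d" using Pc by simp
      show ?thesis unfolding nc_mat_eval_def block_quadratic_form[OF PM v]
        by (intro sum.cong refl) (use Pc[of k] in simp)
    qed
    finally show ?thesis .
  qed
  show ?thesis using 1 unfolding 2 .
qed

lemma quadratic_form_midpoint:
  assumes A: "A \<in> carrier_mat n n" "B \<in> carrier_mat n n" "C \<in> carrier_mat n n" and v: "v \<in> carrier_vec n"
  shows "((complex_of_real (1/2) \<cdot>\<^sub>m A + complex_of_real (1 - 1/2) \<cdot>\<^sub>m B - C) *\<^sub>v v) \<bullet>c v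
    = ((A *\<^sub>v v) \<bullet>c v + (B *\<^sub>v v) \<bullet>c v) / 2 - (C *\<^sub>v v) \<bullet>c v"
proof -
  let ?D = "complex_of_real (1/2) \<cdot>\<^sub>m A + complex_of_real (1 - 1/2) \<cdot>\<^sub>m B - C"
  have D: "?D \<in> carrier_mat n n" by (rule minus_carrier_mat[OF A(3)])
  have "?D $$ (i, j) = A $$ (i, j) / 2 + B $$ (i, j) / 2 - C $$ (i, j)" if "i < n" "j < n" for i j
    using A that by simp
  then have "(?D *\<^sub>v v) \<bullet>c v
      = (\<Sum>i<n. \<Sum>j<n. cnj (v $ i) * (A $$ (i, j) / 2 + B $$ (i, j) / 2 - C $$ (i, j)) * v $ j)"
    unfolding quadratic_form_sum[OF D v] by (intro sum.cong refl) simp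
  also have "\<dots> = (\<Sum>i<n. \<Sum>j<n. (cnj (v $ i) * A $$ (i, j) * v $ j + cnj (v $ i) * B $$ (i, j) * v $ j) / 2
      - cnj (v $ i) * C $$ (i, j) * v $ j)"
    by (intro sum.cong refl) (simp add: field_simps)
  also have "\<dots> = ((A *\<^sub>v v) \<bullet>c v + (B *\<^sub>v v) \<bullet>c v) / 2 - (C *\<^sub>v v) \<bullet>c v"
    unfolding quadratic_form_sum[OF A(1) v] quadratic_form_sum[OF A(2) v] quadratic_form_sum[OF A(3) v]
    by (simp only: sum_subtractf sum_divide_distrib[symmetric] sum.distrib)
  finally show ?thesis .
qed

text \<open>A Loewner inequality at the amplified pair, tested on \<open>V\<close>, says that a
  combination of three convergent scalar series is real and nonnegative. These are the series for
  \<open>T\<close>, for \<open>T'\<close> and for their midpoint.\<close>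

lemma matrix_convex_coefficients:
  fixes F :: "nc_fun mat"
  assumes \<kappa>: "\<kappa> \<ge> 1" and m: "m \<ge> 1" and A: "A \<in> tuples gt \<kappa>" and \<alpha>: "\<alpha> \<in> C_set \<kappa> A m"
    and X: "X \<in> herm_tuples g (\<kappa> * m)"
    and F: "F \<in> carrier_mat d d" and Pc: "\<And>k. P k \<in> carrier_mat d d"
    and ser: "\<And>i j. i < d \<Longrightarrow> j < d \<Longrightarrow> x_series gt g (\<lambda>k. P k $$ (i, j))"
    and \<epsilon>: "\<epsilon> > 0"
    and sums: "\<And>i j m \<alpha> Y. \<lbrakk>i < d; j < d; m \<ge> 1; \<alpha> \<in> C_set \<kappa> A m; Y \<in> herm_ball g (\<kappa> * m) \<epsilon>\<rbrakk> \<Longrightarrow>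
      mat_sums (\<kappa> * m) (\<lambda>k. nc_poly_eval (\<kappa> * m) \<alpha> Y (P k $$ (i, j))) ((F $$ (i, j)) (\<kappa> * m) \<alpha> Y)"
    and conv: "\<And>m \<alpha> Y Z. \<lbrakk>m \<ge> 1; \<alpha> \<in> C_set \<kappa> A m; Y \<in> herm_ball g (\<kappa> * m) \<epsilon>; Z \<in> herm_ball g (\<kappa> * m) \<epsilon>\<rbrakk> \<Longrightarrow>
      loewner_le (d * (\<kappa> * m)) (nc_fun_eval (\<kappa> * m) \<alpha> (convex_comb (1/2) Y Z) F)
        (complex_of_real (1/2) \<cdot>\<^sub>m nc_fun_eval (\<kappa> * m) \<alpha> Y F
          + complex_of_real (1 - 1/2) \<cdot>\<^sub>m nc_fun_eval (\<kappa> * m) \<alpha> Z F)"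
    and v: "v \<in> carrier_vec (d * (\<kappa> * m))"
  shows "matrix_convex_series (\<lambda>k. (nc_mat_eval (\<kappa> * m) \<alpha> X (P k) *\<^sub>v v) \<bullet>c v)"
  unfolding matrix_convex_series_def
proof (intro allI impI)
  fix N :: nat assume N: "N \<ge> 1"
  define n where "n = \<kappa> * m"
  define q where "q k = (nc_mat_eval n \<alpha> X (P k) *\<^sub>v v) \<bullet>c v" for k
  have n: "n > 0" using \<kappa> m by (simp add: n_def)
  have Xh: "X \<in> herm_tuples g n" using X by (simp add: n_def)
  then have Xt: "X \<in> tuples g n" by (simp add: herm_tuples_def)
  have \<alpha>t: "\<alpha> \<in> tuples gt n" unfolding n_def by (rule C_set_tuples[OF \<alpha> A])
  let ?a = "map (kron (1\<^sub>m N)) \<alpha>"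
  have a: "?a \<in> C_set \<kappa> A (N * m)" by (rule C_set_ampliation[OF \<alpha> A])
  have Nm: "N * m \<ge> 1" using N m by (simp add: Suc_le_eq)
  have size: "\<kappa> * (N * m) = N * n" by (simp add: n_def)
  note sums' = sums[OF _ _ Nm a, unfolded size]
  note conv' = conv[OF Nm a, unfolded size]
  have N0: "N > 0" using N by simp
  obtain \<delta> where \<delta>: "\<delta> > 0" and ball: "\<And>T. T \<in> carrier_mat N N \<Longrightarrow>
     (\<And>i j. i < N \<Longrightarrow> j < N \<Longrightarrow> T $$ (j, i) = cnj (T $$ (i, j)) \<and> cmod (T $$ (i, j)) < \<delta>) \<Longrightarrow>
     map (kron T) X \<in> herm_ball g (N * n) \<epsilon>"
    using kron_herm_ball[OF N0 n \<epsilon> Xh] by blast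
  have "\<exists>s\<ge>0. (\<lambda>k. q k * (\<Sum>i<N. \<Sum>j<N. of_real (x i) * of_real (x j) *
            (((T ^\<^sub>m k) $$ (i, j) + (T' ^\<^sub>m k) $$ (i, j)) / 2 - (M ^\<^sub>m k) $$ (i, j)))) sums of_real s"
    if sm: "small_midpoint N \<delta> T T' M" for T T' M and x :: "nat \<Rightarrow> real"
  proof -
    have T: "T \<in> carrier_mat N N" "T' \<in> carrier_mat N N" "M \<in> carrier_mat N N"
      using sm by (auto simp: small_midpoint_def)
    have e: "cmod (T $$ (i, j)) < \<delta>" "T $$ (j, i) = cnj (T $$ (i, j))"
        "cmod (T' $$ (i, j)) < \<delta>" "T' $$ (j, i) = cnj (T' $$ (i, j))"
        "M $$ (i, j) = (T $$ (i, j) + T' $$ (i, j)) / 2" if "i < N" "j < N" for i j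
      using sm that unfolding small_midpoint_def by blast+
    \<comment> \<open>The midpoint has to give a point of the ball as well, since its series is
      summed too.\<close>
    have eM: "M $$ (j, i) = cnj (M $$ (i, j))" "cmod (M $$ (i, j)) < \<delta>" if ij: "i < N" "j < N" for i j
    proof -
      show "M $$ (j, i) = cnj (M $$ (i, j))"
        unfolding e(5)[OF ij] e(5)[OF ij(2,1)] using e(2,4)[OF ij] by simp
      show "cmod (M $$ (i, j)) < \<delta>"
        unfolding e(5)[OF ij] using norm_triangle_ineq[of "T $$ (i, j)" "T' $$ (i, j)"] e(1,3)[OF ij]
        by (simp add: norm_divide)
    qed
    have b: "map (kron T) X \<in> herm_ball g (N * n) \<epsilon>" "map (kron T') X \<in> herm_ball g (N * n) \<epsilon>"
        "map (kron M) X \<in> herm_ball g (N * n) \<epsilon>"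
      by (rule ball[OF T(1)], rule conjI[OF e(2,1)], assumption+)
         (rule ball[OF T(2)], rule conjI[OF e(4,3)], assumption+,
          rule ball[OF T(3)], rule conjI[OF eM], assumption+)
    \<comment> \<open>\<open>I\<close> is decoded into block, copy and position. The copy selects
      the entry of \<open>x\<close>; block and position select the entry of
      \<open>v\<close>.\<close>
    define V where "V = vec (d * (N * n)) (\<lambda>I. of_real (x ((I mod (N * n)) div n)) *
        v $ ((I div (N * n)) * n + (I mod (N * n)) mod n))"
    have V: "V \<in> carrier_vec (d * (N * n))" by (simp add: V_def)
    have Ve: "V $ (i * (N * n) + (p * n + r)) = of_real (x p) * v $ (i * n + r)"
      if i: "i < d" "p < N" "r < n" for i p r
    proof -
      have l: "p * n + r < N * n" by (rule block_index_less[OF i(2,3)])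
      have "i * (N * n) + (p * n + r) < d * (N * n)" by (rule block_index_less[OF i(1) l])
      then have "V $ (i * (N * n) + (p * n + r)) = of_real (x (((i * (N * n) + (p * n + r)) mod (N * n)) div n)) *
          v $ (((i * (N * n) + (p * n + r)) div (N * n)) * n + ((i * (N * n) + (p * n + r)) mod (N * n)) mod n)"
        by (simp only: V_def index_vec)
      moreover have g: "(i * c + k) mod c = k" "(i * c + k) div c = i" if "k < c" for i c k :: nat
        using that by simp_all
      ultimately show ?thesis by (simp only: g[OF l] g[OF i(3)])
    qed
    let ?f = "\<lambda>T. (nc_fun_eval (N * n) ?a (map (kron T) X) F *\<^sub>v V) \<bullet>c V"
    let ?t = "\<lambda>T k. \<Sum>i<N. \<Sum>j<N. of_real (x i) * of_real (x j) * (T ^\<^sub>m k) $$ (i, j)"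
    have s: "(\<lambda>k. q k * ?t T k) sums ?f T"
      if "T \<in> carrier_mat N N" "map (kron T) X \<in> herm_ball g (N * n) \<epsilon>" for T
      unfolding q_def
      by (rule nc_quadratic_form_sums[OF F ser Pc \<alpha>t Xt that(1) sums' v[folded n_def] V Ve])
        (use that in auto)
    have "(\<lambda>k. (q k * ?t T k + q k * ?t T' k) / 2 - q k * ?t M k) sums ((?f T + ?f T') / 2 - ?f M)"
      by (intro sums_diff sums_divide sums_add s T b)
    moreover have "(q k * ?t T k + q k * ?t T' k) / 2 - q k * ?t M k
        = q k * (\<Sum>i<N. \<Sum>j<N. of_real (x i) * of_real (x j) *
            (((T ^\<^sub>m k) $$ (i, j) + (T' ^\<^sub>m k) $$ (i, j)) / 2 - (M ^\<^sub>m k) $$ (i, j)))" for k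
    proof -
      have "(\<Sum>i<N. \<Sum>j<N. of_real (x i) * of_real (x j) *
            (((T ^\<^sub>m k) $$ (i, j) + (T' ^\<^sub>m k) $$ (i, j)) / 2 - (M ^\<^sub>m k) $$ (i, j)))
          = (\<Sum>i<N. \<Sum>j<N. (of_real (x i) * of_real (x j) * (T ^\<^sub>m k) $$ (i, j)
              + of_real (x i) * of_real (x j) * (T' ^\<^sub>m k) $$ (i, j)) / 2
            - of_real (x i) * of_real (x j) * (M ^\<^sub>m k) $$ (i, j))"
        by (intro sum.cong refl) (simp add: field_simps)
      also have "\<dots> = (?t T k + ?t T' k) / 2 - ?t M k"
        by (simp only: sum_subtractf sum_divide_distrib[symmetric] sum.distrib)
      finally have sum_eq: "(\<Sum>i<N. \<Sum>j<N. of_real (x i) * of_real (x j) *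
            (((T ^\<^sub>m k) $$ (i, j) + (T' ^\<^sub>m k) $$ (i, j)) / 2 - (M ^\<^sub>m k) $$ (i, j)))
          = (?t T k + ?t T' k) / 2 - ?t M k" .
      have "(y * a + y * b) / 2 - y * c = y * ((a + b) / 2 - c)" for y a b c :: complex
        by (simp add: field_simps)
      then show ?thesis unfolding sum_eq .
    qed
    ultimately have S: "(\<lambda>k. q k * (\<Sum>i<N. \<Sum>j<N. of_real (x i) * of_real (x j) *
            (((T ^\<^sub>m k) $$ (i, j) + (T' ^\<^sub>m k) $$ (i, j)) / 2 - (M ^\<^sub>m k) $$ (i, j))))
        sums ((?f T + ?f T') / 2 - ?f M)" by (simp only:)
    have mid: "convex_comb (1/2) (map (kron T) X) (map (kron T') X) = map (kron M) X"
      by (rule kron_midpoint[OF T e(5) Xt])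
    have FN: "nc_fun_eval (N * n) ?a Y F \<in> carrier_mat (d * (N * n)) (d * (N * n))" for Y
      unfolding nc_fun_eval_def by (rule block_mat_carrier) (use F in simp)
    have psd: "psd (d * (N * n)) (complex_of_real (1/2) \<cdot>\<^sub>m nc_fun_eval (N * n) ?a (map (kron T) X) F
          + complex_of_real (1 - 1/2) \<cdot>\<^sub>m nc_fun_eval (N * n) ?a (map (kron T') X) F
          - nc_fun_eval (N * n) ?a (map (kron M) X) F)"
      using conv'[OF b(1,2)] unfolding mid loewner_le_def .
    define z where "z = (?f T + ?f T') / 2 - ?f M"
    have "Im z = 0"
      using psd_form_real[OF psd V] unfolding quadratic_form_midpoint[OF FN FN FN V] z_def .
    then have "z = of_real (Re z)" by (simp add: complex_eq_iff)
    moreover have "0 \<le> Re z"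
      using psd V unfolding z_def psd_def quadratic_form_midpoint[OF FN FN FN V, symmetric] by blast
    moreover have "(\<lambda>k. q k * (\<Sum>i<N. \<Sum>j<N. of_real (x i) * of_real (x j) *
            (((T ^\<^sub>m k) $$ (i, j) + (T' ^\<^sub>m k) $$ (i, j)) / 2 - (M ^\<^sub>m k) $$ (i, j)))) sums z"
      using S unfolding z_def .
    ultimately show ?thesis by (intro exI[of _ "Re z"]) simp
  qed
  then show "\<exists>\<delta>>0. \<forall>T T' M x. small_midpoint N \<delta> T T' M \<longrightarrow>
      (\<exists>s\<ge>0. (\<lambda>k. (nc_mat_eval (\<kappa> * m) \<alpha> X (P k) *\<^sub>v v) \<bullet>c v * (\<Sum>i<N. \<Sum>j<N. of_real (x i) * of_real (x j) *
            (((T ^\<^sub>m k) $$ (i, j) + (T' ^\<^sub>m k) $$ (i, j)) / 2 - (M ^\<^sub>m k) $$ (i, j)))) sums of_real s)"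
    using \<delta> unfolding q_def n_def by blast
qed

text \<open>Each entry of F comes with its own radius; there are finitely many, so the minimum
  works. Including \<open>\<epsilon>0\<close> brings in the radius of convexity and keeps the set
  nonempty when d = 0.\<close>

lemma uniform_radius:
  fixes d :: nat and Q :: "nat \<Rightarrow> nat \<Rightarrow> real \<Rightarrow> bool"
  assumes "\<And>i j. i < d \<Longrightarrow> j < d \<Longrightarrow> \<exists>\<epsilon>>0. Q i j \<epsilon>" and "\<epsilon>0 > 0"
    and mono: "\<And>i j \<epsilon> \<epsilon>'. Q i j \<epsilon> \<Longrightarrow> 0 < \<epsilon>' \<Longrightarrow> \<epsilon>' \<le> \<epsilon> \<Longrightarrow> Q i j \<epsilon>'"
  shows "\<exists>\<epsilon>>0. \<epsilon> \<le> \<epsilon>0 \<and> (\<forall>i<d. \<forall>j<d. Q i j \<epsilon>)"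
proof -
  obtain e where e: "\<And>i j. i < d \<Longrightarrow> j < d \<Longrightarrow> e i j > 0 \<and> Q i j (e i j)"
    using assms(1) by metis
  define E where "E = insert \<epsilon>0 ((\<lambda>(i, j). e i j) ` ({..<d} \<times> {..<d}))"
  have fin: "finite E" "E \<noteq> {}" by (auto simp: E_def)
  have pos: "0 < Min E"
    using e assms(2) fin by (subst Min_gr_iff) (auto simp: E_def)
  have "Min E \<le> \<epsilon>0" by (rule Min_le) (auto simp: E_def)
  moreover have "Q i j (Min E)" if "i < d" "j < d" for i j
  proof -
    have "e i j \<in> E" using that by (force simp: E_def)
    then have "Min E \<le> e i j" by (rule Min_le[OF fin(1)])
    then show ?thesis using mono e[OF that] pos by blast
  qed
  ultimately show ?thesis using pos by blast
qed

section \<open>Vanishing of the coefficients of degree at least 3 and the value of every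
  continuation\<close>

theorem theorem1p4:
  fixes \<kappa> gt g d :: nat
    and A :: mtuple
    and D :: nc_dom
    and F :: "nc_fun mat"
    and P :: "nat \<Rightarrow> nc_poly mat"
  assumes "\<kappa> \<ge> 1"
    and "A \<in> herm_tuples gt \<kappa>"
    and "nc_set gt g D"
    and "nc_mat_function d D F"
    and "matrix_convex_x d g \<kappa> A D F P"
    and "mat_x_real_entire d gt g \<kappa> A D F P"
  shows "\<forall>m\<ge>1. \<forall>\<alpha> \<in> C_set \<kappa> A m. \<forall>X \<in> herm_tuples g (\<kappa> * m).
           nc_fun_eval (\<kappa> * m) \<alpha> X (map_mat (x_extension g) F)
             = nc_mat_eval (\<kappa> * m) \<alpha> X (P 0)
             + nc_mat_eval (\<kappa> * m) \<alpha> X (P 1)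
             + nc_mat_eval (\<kappa> * m) \<alpha> X (P 2)"
proof (intro allI impI ballI)
  fix m \<alpha> X
  assume m: "m \<ge> 1" and \<alpha>: "\<alpha> \<in> C_set \<kappa> A m" and X: "X \<in> herm_tuples g (\<kappa> * m)"
  have F: "F \<in> carrier_mat d d" using assms(4) by (simp add: nc_mat_function_def)
  have Pc: "P k \<in> carrier_mat d d" for k using assms(6) by (simp add: mat_x_real_entire_def)
  have ent: "x_real_entire gt g \<kappa> A D (F $$ (i, j)) (\<lambda>k. P k $$ (i, j))" if "i < d" "j < d" for i j
    using assms(6) that by (simp add: mat_x_real_entire_def)
  have ser: "x_series gt g (\<lambda>k. P k $$ (i, j))" if "i < d" "j < d" for i j
    using ent[OF that] by (simp add: x_real_entire_def)
  have At: "A \<in> tuples gt \<kappa>" using assms(2) by (simp add: herm_tuples_def)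
  define n where "n = \<kappa> * m"
  have n: "n > 0" using assms(1) m by (simp add: n_def)
  have Xh: "X \<in> herm_tuples g n" using X by (simp add: n_def)
  have \<alpha>t: "\<alpha> \<in> tuples gt n" unfolding n_def by (rule C_set_tuples[OF \<alpha> At])
  \<comment> \<open>Only convergence needs a radius common to all entries, and it passes to smaller
    balls. The continuations keep their own radii.\<close>
  define R where "R i j \<epsilon> \<longleftrightarrow> (\<forall>m\<ge>1. \<forall>\<alpha> \<in> C_set \<kappa> A m. \<forall>Y \<in> herm_ball g (\<kappa> * m) \<epsilon>.
      mat_sums (\<kappa> * m) (\<lambda>k. nc_poly_eval (\<kappa> * m) \<alpha> Y (P k $$ (i, j))) ((F $$ (i, j)) (\<kappa> * m) \<alpha> Y))" for i j \<epsilon>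
  obtain \<epsilon>0 where \<epsilon>0: "\<epsilon>0 > 0" and conv0: "\<And>m \<alpha> Y Z t. \<lbrakk>m \<ge> 1; \<alpha> \<in> C_set \<kappa> A m;
      Y \<in> herm_ball g (\<kappa> * m) \<epsilon>0; Z \<in> herm_ball g (\<kappa> * m) \<epsilon>0; t \<in> {0..1}\<rbrakk> \<Longrightarrow>
      loewner_le (d * (\<kappa> * m)) (nc_fun_eval (\<kappa> * m) \<alpha> (convex_comb t Y Z) F)
        (complex_of_real t \<cdot>\<^sub>m nc_fun_eval (\<kappa> * m) \<alpha> Y F
          + complex_of_real (1 - t) \<cdot>\<^sub>m nc_fun_eval (\<kappa> * m) \<alpha> Z F)"
    using assms(5) unfolding matrix_convex_x_def by blast
  have ex: "\<exists>\<epsilon>>0. R i j \<epsilon>" if "i < d" "j < d" for i j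
    using ent[OF that] unfolding x_real_entire_def R_def by blast
  have mono: "R i j \<epsilon>'" if "R i j \<epsilon>" "0 < \<epsilon>'" "\<epsilon>' \<le> \<epsilon>" for i j \<epsilon> \<epsilon>'
    using that(1) herm_ball_mono[OF that(3)] unfolding R_def by blast
  have "\<exists>\<epsilon>>0. \<epsilon> \<le> \<epsilon>0 \<and> (\<forall>i<d. \<forall>j<d. R i j \<epsilon>)"
    by (rule uniform_radius[OF _ \<epsilon>0]) (use ex mono in blast)+
  then obtain \<epsilon> where \<epsilon>: "0 < \<epsilon>" "\<epsilon> \<le> \<epsilon>0" and Rs: "\<And>i j. i < d \<Longrightarrow> j < d \<Longrightarrow> R i j \<epsilon>"
    by blast
  note sums = Rs[unfolded R_def, rule_format]
  have cont: "\<exists>\<epsilon>>0. \<exists>\<Omega> G. continues g n \<epsilon> (F $$ (i, j)) \<alpha> \<Omega> G" if "i < d" "j < d" for i j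
    using ent[OF that] m \<alpha> unfolding x_real_entire_def n_def by blast
  have entire: "real_entire (\<lambda>k. nc_poly_eval n \<alpha> X (P k $$ (i, j)) $$ (r, c)) (\<lambda>z. G (scale_tuple z X) $$ (r, c))"
    if "i < d" "j < d" "r < n" "c < n" "\<epsilon>' > 0" "continues g n \<epsilon>' (F $$ (i, j)) \<alpha> \<Omega> G" for i j r c \<epsilon>' \<Omega> G
    by (rule real_entire_coefficients[OF n ser[OF that(1,2)] \<alpha>t Xh \<epsilon>(1) that(5) _ that(6,3,4)])
       (use sums[OF that(1,2) m \<alpha>] in \<open>simp add: n_def\<close>)
  have Qc: "nc_mat_eval n \<alpha> X (P k) \<in> carrier_mat (d * n) (d * n)" for k
    unfolding nc_mat_eval_def by (rule block_mat_carrier) (use Pc in simp)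
  have Qe: "nc_mat_eval n \<alpha> X (P k) $$ (i * n + r, j * n + c) = nc_poly_eval n \<alpha> X (P k $$ (i, j)) $$ (r, c)"
    if "i < d" "j < d" "r < n" "c < n" for k i j r c
  proof -
    have "map_mat (nc_poly_eval n \<alpha> X) (P k) \<in> carrier_mat d d" using Pc by simp
    from block_mat_entry[OF this that] show ?thesis unfolding nc_mat_eval_def using that Pc[of k] by simp
  qed
  have Qent: "\<exists>h. real_entire (\<lambda>k. nc_mat_eval n \<alpha> X (P k) $$ (I, J)) h" if I: "I < d * n" and J: "J < d * n" for I J
  proof -
    obtain i r where i: "I = i * n + r" "i < d" "r < n" using I by (rule block_index_cases)
    obtain j c where j: "J = j * n + c" "j < d" "c < n" using J by (rule block_index_cases)
    show ?thesis unfolding i(1) j(1) Qe[OF i(2) j(2) i(3) j(3)]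
      using entire[OF i(2) j(2) i(3) j(3)] cont[OF i(2) j(2)] by blast
  qed
  then obtain h where h: "\<And>I J. I < d * n \<Longrightarrow> J < d * n \<Longrightarrow> real_entire (\<lambda>k. nc_mat_eval n \<alpha> X (P k) $$ (I, J)) (h I J)"
    by metis
  \<comment> \<open>Convexity controls quadratic forms, whereas continuations are given entry by
    entry. The form at a fixed vector is a finite combination of entries, so it is real entire; once
    it vanishes for every vector, polarization returns to the entries.\<close>
  have vanish: "nc_mat_eval n \<alpha> X (P k) $$ (I, J) = 0" if k: "k \<ge> 3" and IJ: "I < d * n" "J < d * n" for k I J
  proof (rule quadratic_form_zero[OF _ IJ])
    fix v :: "nat \<Rightarrow> complex"
    define w where "w = vec (d * n) v"
    have w: "w \<in> carrier_vec (d * n)" by (simp add: w_def)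
    define q where "q k = (nc_mat_eval n \<alpha> X (P k) *\<^sub>v w) \<bullet>c w" for k
    have q: "q k = (\<Sum>I<d * n. \<Sum>J<d * n. cnj (v I) * nc_mat_eval n \<alpha> X (P k) $$ (I, J) * v J)" for k
      unfolding q_def quadratic_form_sum[OF Qc w] by (simp add: w_def)
    have q': "q = (\<lambda>k. \<Sum>I\<in>{..<d * n}. \<Sum>J\<in>{..<d * n}. (cnj (v I) * v J) * nc_mat_eval n \<alpha> X (P k) $$ (I, J))"
      by (rule ext) (simp add: q mult_ac)
    have h': "real_entire (\<lambda>k. nc_mat_eval n \<alpha> X (P k) $$ (I, J)) (h I J)"
      if "I \<in> {..<d * n}" "J \<in> {..<d * n}" for I J
      using h that by simp
    have qe: "real_entire q (\<lambda>z. \<Sum>I\<in>{..<d * n}. \<Sum>J\<in>{..<d * n}. (cnj (v I) * v J) * h I J z)"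
      unfolding q' by (intro real_entire_sum real_entire_cmult h' finite_lessThan)
    then obtain \<rho> where \<rho>: "\<rho> > 0" "\<And>t. \<bar>t\<bar> < \<rho> \<Longrightarrow> summable (\<lambda>k. q k * of_real t ^ k)"
      unfolding real_entire_def by (meson sums_summable)
    have mc: "matrix_convex_series q"
      unfolding q_def n_def
    proof (rule matrix_convex_coefficients[OF assms(1) m At \<alpha> X F Pc ser \<epsilon>(1)])
      show "w \<in> carrier_vec (d * (\<kappa> * m))" using w by (simp add: n_def)
    next
      fix i j m \<alpha> Y
      assume "i < d" "j < d" "1 \<le> m" "\<alpha> \<in> C_set \<kappa> A m" "Y \<in> herm_ball g (\<kappa> * m) \<epsilon>"
      then show "mat_sums (\<kappa> * m) (\<lambda>k. nc_poly_eval (\<kappa> * m) \<alpha> Y (P k $$ (i, j))) ((F $$ (i, j)) (\<kappa> * m) \<alpha> Y)"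
        using sums by blast
    next
      fix m \<alpha> Y Z
      assume "1 \<le> m" "\<alpha> \<in> C_set \<kappa> A m" "Y \<in> herm_ball g (\<kappa> * m) \<epsilon>" "Z \<in> herm_ball g (\<kappa> * m) \<epsilon>"
      then show "loewner_le (d * (\<kappa> * m)) (nc_fun_eval (\<kappa> * m) \<alpha> (convex_comb (1/2) Y Z) F)
        (complex_of_real (1/2) \<cdot>\<^sub>m nc_fun_eval (\<kappa> * m) \<alpha> Y F
          + complex_of_real (1 - 1/2) \<cdot>\<^sub>m nc_fun_eval (\<kappa> * m) \<alpha> Z F)"
        using herm_ball_mono[OF \<epsilon>(2)] by (intro conv0) auto
    qed auto
    have "\<rho> / 2 > 0" "summable (\<lambda>k. q k * of_real (\<rho> / 2) ^ k)" using \<rho>(1) \<rho>(2)[of "\<rho> / 2"] by simp_all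
    note hankel = matrix_convex_series_hankel[OF mc this]
    have "q k = 0"
      by (rule hankel_real_entire_vanishing[OF qe _ _ k]) (use hankel in blast)+
    then show "(\<Sum>I<d * n. \<Sum>J<d * n. cnj (v I) * nc_mat_eval n \<alpha> X (P k) $$ (I, J) * v J) = 0"
      unfolding q .
  qed
  let ?p = "\<lambda>i j r c k. nc_poly_eval n \<alpha> X (P k $$ (i, j)) $$ (r, c)"
  \<comment> \<open>The right side does not mention \<open>G\<close>, so this also shows that all
    continuations agree at \<open>X\<close>; the uniqueness required by \<open>THE\<close> in
    \<open>x_extension\<close> follows.\<close>
  have val: "G X $$ (r, c) = ?p i j r c 0 + ?p i j r c 1 + ?p i j r c 2"
    if ij: "i < d" "j < d" "r < n" "c < n" and G: "\<epsilon>' > 0" "continues g n \<epsilon>' (F $$ (i, j)) \<alpha> \<Omega> G"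
    for i j r c \<epsilon>' \<Omega> G
  proof -
    have "?p i j r c k = 0" if "k \<ge> 3" for k
      using vanish[OF that block_index_less[OF ij(1,3)] block_index_less[OF ij(2,4)]] Qe[OF ij] by simp
    from real_entire_polynomial[OF entire[OF ij G] this] show ?thesis by simp
  qed
  have ext: "x_extension g (F $$ (i, j)) n \<alpha> X $$ (r, c) = ?p i j r c 0 + ?p i j r c 1 + ?p i j r c 2"
    if ij: "i < d" "j < d" and rc: "r < n" "c < n" for i j r c
  proof -
    obtain \<epsilon>' \<Omega> G where G: "\<epsilon>' > 0" "continues g n \<epsilon>' (F $$ (i, j)) \<alpha> \<Omega> G" using cont[OF ij] by blast
    have car: "H X \<in> carrier_mat n n" if "continues g n \<epsilon>'' (F $$ (i, j)) \<alpha> \<Omega>' H" for \<epsilon>'' \<Omega>' H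
      using that Xh unfolding continues_def by blast
    have "x_extension g (F $$ (i, j)) n \<alpha> X = G X"
      unfolding x_extension_def
    proof (rule the_equality)
      show "\<exists>\<epsilon>>0. \<exists>\<Omega> H. continues g n \<epsilon> (F $$ (i, j)) \<alpha> \<Omega> H \<and> G X = H X" using G by blast
      fix W assume "\<exists>\<epsilon>>0. \<exists>\<Omega> H. continues g n \<epsilon> (F $$ (i, j)) \<alpha> \<Omega> H \<and> W = H X"
      then obtain \<epsilon>'' \<Omega>' H where H: "\<epsilon>'' > 0" "continues g n \<epsilon>'' (F $$ (i, j)) \<alpha> \<Omega>' H" "W = H X" by blast
      show "W = G X" unfolding H(3)
        by (rule eq_matI) (use car[OF G(2)] car[OF H(2)] val[OF ij _ _ G] val[OF ij _ _ H(1,2)] in auto)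
    qed
    then show ?thesis using val[OF ij rc G] by simp
  qed
  let ?L = "nc_fun_eval n \<alpha> X (map_mat (x_extension g) F)"
  let ?Q = "\<lambda>k. nc_mat_eval n \<alpha> X (P k)"
  have EM: "map_mat (\<lambda>f. f n \<alpha> X) (map_mat (x_extension g) F) \<in> carrier_mat d d" using F by simp
  have "?L = ?Q 0 + ?Q 1 + ?Q 2"
  proof (rule eq_matI)
    fix I J assume "I < dim_row (?Q 0 + ?Q 1 + ?Q 2)" "J < dim_col (?Q 0 + ?Q 1 + ?Q 2)"
    then have I: "I < d * n" and J: "J < d * n" using Qc[of 2] by auto
    obtain i r where i: "I = i * n + r" "i < d" "r < n" using I by (rule block_index_cases)
    obtain j c where j: "J = j * n + c" "j < d" "c < n" using J by (rule block_index_cases)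
    have "?L $$ (I, J) = x_extension g (F $$ (i, j)) n \<alpha> X $$ (r, c)"
      unfolding nc_fun_eval_def i(1) j(1) block_mat_entry[OF EM i(2) j(2) i(3) j(3)] using F i j by simp
    also have "\<dots> = ?Q 0 $$ (I, J) + ?Q 1 $$ (I, J) + ?Q 2 $$ (I, J)"
      unfolding ext[OF i(2) j(2) i(3) j(3)] i(1) j(1) Qe[OF i(2) j(2) i(3) j(3)] ..
    also have "\<dots> = (?Q 0 + ?Q 1 + ?Q 2) $$ (I, J)"
      using I J Qc[of 0] Qc[of 1] Qc[of 2] by simp
    finally show "?L $$ (I, J) = (?Q 0 + ?Q 1 + ?Q 2) $$ (I, J)" .
  qed (use block_mat_carrier[OF EM, of n] Qc[of 2] in \<open>auto simp: nc_fun_eval_def\<close>)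
  then show "nc_fun_eval (\<kappa> * m) \<alpha> X (map_mat (x_extension g) F)
             = nc_mat_eval (\<kappa> * m) \<alpha> X (P 0)
             + nc_mat_eval (\<kappa> * m) \<alpha> X (P 1)
             + nc_mat_eval (\<kappa> * m) \<alpha> X (P 2)"
    unfolding n_def .
qed

end
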